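(* Consider the small-world navigation and the directed small-world navigation on a Poisson point process of intensity $1$ on $\mathbb{R}^d$, with connection function $f$ satisfying $f(t)\sim c\,t^{-\beta}$ as $t\to\infty$, $c>0$, and assume $\beta>d$. Let $e_1\in S^{d-1}$. If $|X|$ tends to $+\infty$ and $X/|X|$ tends to $e_1$, then $S_{-X}\circ\mathcal{T}_O(N^{O,X})$ converges to $\mathcal{T}_{-e_1}(N^O)$ for the local weak convergence.
   Context: $N$ is a Poisson point process of intensity $1$ on $\mathbb{R}^d$, $O$ is the origin, $|\cdot|$ and $\langle\cdot,\cdot\rangle$ are the Euclidean norm and scalar product, $B(O,r)$ is the open ball of radius $r$ centred at $O$, $S^{d-1}$ is the unit sphere, $N^O=N+\delta_O$, $N^{O,X}=N+\delta_X+\delta_O$, and $\mathcal{H}_{e}(X)=\{Y:\langle Y-X,e\rangle>0\}$ for $e\in S^{d-1}$. Small-world navigation. Let $f:\mathbb{R}_+\to[0,1]$ be nonincreasing with $f(t)\sim c\,t^{-\beta}$ as $t\to\infty$, $c>0$, $\beta>0$. For a point set $M$ containing $O$ (here $M=N^{O,X}$), attach to each pair $(X,Y)$ of distinct points an independent uniform variable $U(X,Y)$ on $[0,1]$, independent of the point set, and let $(X,Y)\in E$ if $U(X,Y)\le f(|X-Y|)$. Given the point set, for each point $X\ne O$ the variables $(U(X,Y),\,Y\in M\cap B(O,|X|))$ are conditioned on the event that $V_X=\{Y\in M\cap B(O,|X|):(X,Y)\in E\}$ is nonempty; given the point set, the sets $V_X$ for distinct $X$ are independent. The small-world navigation is $\mathcal{A}(O)=O$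 and $\mathcal{A}(X)=\arg\min\{|Y|:(X,Y)\in E\}$ for $X\ne O$. Its navigation tree $\mathcal{T}_O(M)$ has vertex set $M$ and an edge between $X$ and $Y$ if $\mathcal{A}(X)=Y$ or $\mathcal{A}(Y)=X$. Directed small-world navigation with direction $e$ ($\beta>d$). On a point set $M$ (here $M=N^O$), attach to each pair $(X,Y)$ of distinct points of $M$ an independent uniform variable $U(X,Y)$ on $[0,1]$, independent of the point set, and let $(X,Y)\in E$ if $U(X,Y)\le f(|X-Y|)$, where the variables $U$ are now conditioned on the event that every point $X$ has at least one neighbour in $\mathcal{H}_e(X)$; set $\mathcal{A}_e(X)=\arg\max\{\langle Y,e\rangle:(X,Y)\in E\}$. The directed navigation forest $\mathcal{T}_e(M)$ has vertex set $M$ and an edge between $X$ and $\mathcal{A}_e(X)$ for each $X$. For a graph $\mathcal{G}=(M,E)$ with $M\subset\mathbb{R}^d$, $S_Y\circ\mathcal{G}$ is the graph obtained by translating all vertices by $Y$ and keeping the same edges. Local weak convergence is in the sense of Aldous and Steele: graphs are rooted at $O$ (only the connected component of the root matters), edges carry their Euclidean lengths, and rooted graphs $G_n$ converge to $G$ if for every $\rho>0$ that is not the graph distance (sum of lengths) of a vertex of $G$ to the root, for all large $n$ there is a root-preserving isomorphism between the neighbourhoods of radius $\rho$ of the root in $G$ and in $G_n$ whose edge lengths converge to those of $G$; for random graphs, local weak convergence is convergence in distribution for this topology. *)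

theory Defs
  imports "HOL-Probability.Probability" "HOL-Library.Landau_Symbols"
begin

section \<open>Poisson point processes\<close>

text \<open>
  A Poisson point process of intensity \<open>r\<close> on a Euclidean space, as a locally finite random set
  of points (the intensity measure is diffuse, so there are no multiple points).
  The law of the counts is written out because \<^const>\<open>poisson_pmf\<close> requires a positive rate, whereas
  \<open>B\<close> may be a null set.  Finite disjoint families are covered by padding them with empty sets.
\<close>

definition poisson_point_process ::
    "real \<Rightarrow> 'w measure \<Rightarrow> ('w \<Rightarrow> 'a::euclidean_space set) \<Rightarrow> bool" where
  "poisson_point_process r P N \<longleftrightarrow>
     prob_space P \<and>
     (\<forall>\<omega>\<in>space P. \<forall>R. finite (N \<omega> \<inter> ball 0 R)) \<and>
     (\<forall>B\<in>sets borel. bounded B \<longrightarrow>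
        (\<lambda>\<omega>. card (N \<omega> \<inter> B)) \<in> measurable P (count_space UNIV) \<and>
        (\<forall>k. measure P {\<omega>\<in>space P. card (N \<omega> \<inter> B) = k}
             = (r * measure lborel B) ^ k / fact k * exp (- (r * measure lborel B)))) \<and>
     (\<forall>B::nat \<Rightarrow> 'a set.
        (\<forall>i. B i \<in> sets borel \<and> bounded (B i)) \<and> disjoint_family B \<longrightarrow>
        prob_space.indep_vars P (\<lambda>_. count_space UNIV) (\<lambda>i \<omega>. card (N \<omega> \<inter> B i)) UNIV)"


section \<open>Graphs, translation, and rooted graphs with edge lengths\<close>

text \<open>A graph is a vertex set with a symmetric irreflexive adjacency relation.\<close>

type_synonym 'v graph = "'v set \<times> ('v \<times> 'v) set"

definition translate :: "'a::ab_group_add \<Rightarrow> 'a graph \<Rightarrow> 'a graph" where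
  "translate Y G = ((\<lambda>v. v + Y) ` fst G, map_prod (\<lambda>v. v + Y) (\<lambda>v. v + Y) ` snd G)"

record 'v rooted_graph =
  gverts :: "'v set"
  gedges :: "('v \<times> 'v) set"
  glen :: "'v \<Rightarrow> 'v \<Rightarrow> real"
  groot :: 'v

text \<open>The connected component of the origin, rooted there, with Euclidean edge lengths.\<close>

definition rooted_at_origin :: "'a::euclidean_space graph \<Rightarrow> 'a rooted_graph" where
  "rooted_at_origin G =
     (let C = {v \<in> fst G. (0, v) \<in> (snd G)\<^sup>*}
      in \<lparr>gverts = C, gedges = snd G \<inter> C \<times> C, glen = dist, groot = 0\<rparr>)"

fun walk_length :: "('v \<Rightarrow> 'v \<Rightarrow> real) \<Rightarrow> 'v list \<Rightarrow> real" where
  "walk_length l (x # y # zs) = l x y + walk_length l (y # zs)"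
| "walk_length l xs = 0"

definition gdist :: "'v rooted_graph \<Rightarrow> 'v \<Rightarrow> 'v \<Rightarrow> real" where
  "gdist G u v = Inf {walk_length (glen G) xs | xs.
     xs \<noteq> [] \<and> hd xs = u \<and> last xs = v \<and> successively (\<lambda>x y. (x, y) \<in> gedges G) xs}"

text \<open>The induced subgraph on the vertices at graph distance at most \<open>\<rho>\<close> from the root.\<close>

definition nbhd :: "real \<Rightarrow> 'v rooted_graph \<Rightarrow> 'v rooted_graph" where
  "nbhd \<rho> G =
     (let B = {v \<in> gverts G. gdist G (groot G) v \<le> \<rho>}
      in G\<lparr>gverts := B, gedges := gedges G \<inter> B \<times> B\<rparr>)"

definition rooted_iso :: "('v \<Rightarrow> 'v) \<Rightarrow> 'v rooted_graph \<Rightarrow> 'v rooted_graph \<Rightarrow> bool" where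
  "rooted_iso \<gamma> G H \<longleftrightarrow>
     bij_betw \<gamma> (gverts G) (gverts H) \<and>
     \<gamma> (groot G) = groot H \<and>
     (\<forall>u\<in>gverts G. \<forall>v\<in>gverts G. (u, v) \<in> gedges G \<longleftrightarrow> (\<gamma> u, \<gamma> v) \<in> gedges H)"


section \<open>Local weak convergence (Aldous and Steele)\<close>

text \<open>The rooted geometric graphs: connected, with finitely many vertices within any distance.\<close>

definition geometric_graphs :: "'v rooted_graph set" where
  "geometric_graphs = {G.
     groot G \<in> gverts G \<and>
     gedges G \<subseteq> gverts G \<times> gverts G \<and> sym (gedges G) \<and> irrefl (gedges G) \<and>
     (\<forall>(u, v)\<in>gedges G. 0 < glen G u v \<and> glen G u v = glen G v u) \<and>
     (\<forall>v\<in>gverts G. (groot G, v) \<in> (gedges G)\<^sup>*) \<and>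
     (\<forall>u\<in>gverts G. \<forall>\<rho>. finite {v \<in> gverts G. gdist G u v \<le> \<rho>})}"

definition local_converges :: "(nat \<Rightarrow> 'v rooted_graph) \<Rightarrow> 'v rooted_graph \<Rightarrow> bool" where
  "local_converges Gs G \<longleftrightarrow>
     (\<forall>\<rho>>0. (\<forall>v\<in>gverts G. gdist G (groot G) v \<noteq> \<rho>) \<longrightarrow>
        (\<exists>\<gamma>. (\<forall>\<^sub>F n in sequentially. rooted_iso (\<gamma> n) (nbhd \<rho> G) (nbhd \<rho> (Gs n))) \<and>
             (\<forall>(u, v)\<in>gedges (nbhd \<rho> G).
                (\<lambda>n. glen (Gs n) (\<gamma> n u) (\<gamma> n v)) \<longlonglongrightarrow> glen G u v)))"

text \<open>
  The topology whose open sets are the sequentially open sets for this convergence.  It is not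
  necessary to pass to isomorphism classes: if \<open>G'\<close> is isomorphic to \<open>G\<close>, then the constant
  sequence \<open>G'\<close> converges to \<open>G\<close>, so that open sets and continuous functions are automatically
  invariant under isomorphism.
\<close>

definition local_open :: "'v rooted_graph set \<Rightarrow> bool" where
  "local_open W \<longleftrightarrow> W \<subseteq> geometric_graphs \<and>
     (\<forall>G\<in>W. \<forall>Gs. (\<forall>n. Gs n \<in> geometric_graphs) \<and> local_converges Gs G \<longrightarrow>
        (\<forall>\<^sub>F n in sequentially. Gs n \<in> W))"

definition local_topology :: "'v rooted_graph topology" where
  "local_topology = topology local_open"

lemma istopology_local_open: "istopology local_open"
  unfolding istopology_def
proof (intro conjI allI impI)
  fix S T :: "'a rooted_graph set"
  assume "local_open S" "local_open T"
  then show "local_open (S \<inter> T)"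
    unfolding local_open_def by (auto simp: eventually_conj_iff)
next
  fix K :: "'a rooted_graph set set"
  assume K: "\<forall>W\<in>K. local_open W"
  show "local_open (\<Union> K)"
    unfolding local_open_def
  proof (intro conjI ballI allI impI)
    show "\<Union> K \<subseteq> geometric_graphs"
      using K unfolding local_open_def by blast
  next
    fix G and Gs :: "nat \<Rightarrow> 'a rooted_graph"
    assume "G \<in> \<Union> K" and Gs: "(\<forall>n. Gs n \<in> geometric_graphs) \<and> local_converges Gs G"
    then obtain W where W: "W \<in> K" "G \<in> W" by blast
    with K Gs have "\<forall>\<^sub>F n in sequentially. Gs n \<in> W"
      unfolding local_open_def by blast
    then show "\<forall>\<^sub>F n in sequentially. Gs n \<in> \<Union> K"
      by (rule eventually_mono) (use W in blast)
  qed
qed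

lemma openin_local_topology: "openin local_topology W \<longleftrightarrow> local_open W"
  by (simp add: local_topology_def topology_inverse' istopology_local_open)

lemma topspace_local_topology: "topspace local_topology = geometric_graphs"
proof -
  have "local_open geometric_graphs" by (simp add: local_open_def)
  then show ?thesis
    unfolding topspace_def openin_local_topology by (auto simp: local_open_def)
qed

definition local_borel :: "'v rooted_graph measure" where
  "local_borel = sigma geometric_graphs {W. openin local_topology W}"

text \<open>
  Convergence in distribution for the local topology, stated for the laws of the random graphs.
\<close>

definition local_weak_conv ::
    "(nat \<Rightarrow> 'v rooted_graph measure) \<Rightarrow> 'v rooted_graph measure \<Rightarrow> bool" where
  "local_weak_conv \<mu> \<nu> \<longleftrightarrow>
     (\<forall>n. prob_space (\<mu> n) \<and> sets (\<mu> n) = sets local_borel) \<and>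
     prob_space \<nu> \<and> sets \<nu> = sets local_borel \<and>
     (\<forall>g :: 'v rooted_graph \<Rightarrow> real.
        continuous_map local_topology euclideanreal g \<and> bounded (g ` geometric_graphs) \<longrightarrow>
        (\<lambda>n. integral\<^sup>L (\<mu> n) g) \<longlonglongrightarrow> integral\<^sup>L \<nu> g)"


section \<open>Small-world navigations\<close>

definition half_space :: "'a::euclidean_space \<Rightarrow> 'a \<Rightarrow> 'a set" where
  "half_space e X = {Y. (Y - X) \<bullet> e > 0}"

text \<open>
  The marks \<open>U\<close> are indexed by ordered pairs of distinct points, row \<open>U X\<close> being the family of
  all \<open>U X Y\<close>.
\<close>

definition sw_edges :: "(real \<Rightarrow> real) \<Rightarrow> 'a::euclidean_space set \<Rightarrow> ('a \<Rightarrow> 'a \<Rightarrow> real) \<Rightarrow> ('a \<times> 'a) set"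
  where "sw_edges f M U = {(X, Y). X \<in> M \<and> Y \<in> M \<and> X \<noteq> Y \<and> U X Y \<le> f (norm (X - Y))}"

text \<open>
  The law \<open>\<mu>\<close> conditioned on \<open>A\<close>.  The unconditioned law for null \<open>A\<close> is a dummy value: for a
  Poisson process almost surely only events of positive probability occur below.
\<close>

definition conditioned :: "'b measure \<Rightarrow> 'b set \<Rightarrow> 'b measure" where
  "conditioned \<mu> A = (if emeasure \<mu> A = 0 then \<mu> else uniform_measure \<mu> A)"

definition row_law :: "'a set \<Rightarrow> 'a \<Rightarrow> ('a \<Rightarrow> real) measure" where
  "row_law M X = PiM (M - {X}) (\<lambda>_. uniform_measure lborel {0..1})"

definition has_neighbour_in ::
    "(real \<Rightarrow> real) \<Rightarrow> 'a::euclidean_space set \<Rightarrow> 'a \<Rightarrow> 'a set \<Rightarrow> ('a \<Rightarrow> real) set" where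
  "has_neighbour_in f M X A =
     {u \<in> space (row_law M X). \<exists>Y\<in>M \<inter> A - {X}. u Y \<le> f (norm (X - Y))}"

text \<open>
  The laws of the marks given the point set \<open>M\<close>.  The conditioning events for distinct points \<open>X\<close>
  concern distinct rows, so conditioning on all of them amounts to conditioning each row
  separately; for infinite \<open>M\<close> this is what the conditioning means, since the intersection of the
  events may be null.
\<close>

definition sw_marks :: "(real \<Rightarrow> real) \<Rightarrow> 'a::euclidean_space set \<Rightarrow> ('a \<Rightarrow> 'a \<Rightarrow> real) measure" where
  "sw_marks f M = PiM M (\<lambda>X.
     if X = 0 then row_law M X
     else conditioned (row_law M X) (has_neighbour_in f M X (ball 0 (norm X))))"

definition dir_marks ::
    "(real \<Rightarrow> real) \<Rightarrow> 'a::euclidean_space \<Rightarrow> 'a set \<Rightarrow> ('a \<Rightarrow> 'a \<Rightarrow> real) measure" where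
  "dir_marks f e M = PiM M (\<lambda>X.
     conditioned (row_law M X) (has_neighbour_in f M X (half_space e X)))"

text \<open>
  Extremal points almost surely exist and are unique.  Otherwise, the dummy value \<open>X\<close> is taken
  (giving no edge) rather than the arbitrary choice made by \<^const>\<open>arg_min\<close> and \<^const>\<open>arg_max\<close>,
  which could destroy measurability.
\<close>

definition unique_or :: "'v \<Rightarrow> ('v \<Rightarrow> bool) \<Rightarrow> 'v" where
  "unique_or X Q = (if \<exists>!Y. Q Y then (THE Y. Q Y) else X)"

definition sw_nav ::
    "(real \<Rightarrow> real) \<Rightarrow> 'a::euclidean_space set \<Rightarrow> ('a \<Rightarrow> 'a \<Rightarrow> real) \<Rightarrow> 'a \<Rightarrow> 'a" where
  "sw_nav f M U X =
     (if X = 0 then 0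
      else unique_or X (is_arg_min norm (\<lambda>Y. (X, Y) \<in> sw_edges f M U)))"

definition dir_nav ::
    "(real \<Rightarrow> real) \<Rightarrow> 'a::euclidean_space \<Rightarrow> 'a set \<Rightarrow> ('a \<Rightarrow> 'a \<Rightarrow> real) \<Rightarrow> 'a \<Rightarrow> 'a" where
  "dir_nav f e M U X =
     unique_or X (is_arg_max (\<lambda>Y. Y \<bullet> e) (\<lambda>Y. (X, Y) \<in> sw_edges f M U))"

text \<open>The graph of a navigation \<open>A\<close> on \<open>M\<close>; the loop given by \<open>A 0 = 0\<close> is not an edge.\<close>

definition nav_graph :: "'a set \<Rightarrow> ('a \<Rightarrow> 'a) \<Rightarrow> 'a graph" where
  "nav_graph M A = (M, {(X, Y). X \<in> M \<and> Y \<in> M \<and> X \<noteq> Y \<and> (A X = Y \<or> A Y = X)})"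

text \<open>
  The law of the translate by \<open>Z\<close>, rooted at the origin, of the navigation tree on the random
  point set \<open>M \<omega>\<close>, and the law of the directed navigation forest rooted at the origin.
  In both cases the point set is drawn first, and then the marks are drawn given the point set.
\<close>

definition sw_tree_law ::
    "(real \<Rightarrow> real) \<Rightarrow> 'w measure \<Rightarrow> ('w \<Rightarrow> 'a::euclidean_space set) \<Rightarrow> 'a \<Rightarrow> 'a rooted_graph measure"
  where
  "sw_tree_law f P M Z = P \<bind> (\<lambda>\<omega>. distr (sw_marks f (M \<omega>)) local_borel
     (\<lambda>U. rooted_at_origin (translate Z (nav_graph (M \<omega>) (sw_nav f (M \<omega>) U)))))"

definition dir_forest_law ::
    "(real \<Rightarrow> real) \<Rightarrow> 'a \<Rightarrow> 'w measure \<Rightarrow> ('w \<Rightarrow> 'a::euclidean_space set) \<Rightarrow> 'a rooted_graph measure"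
  where
  "dir_forest_law f e P M = P \<bind> (\<lambda>\<omega>. distr (dir_marks f e (M \<omega>)) local_borel
     (\<lambda>U. rooted_at_origin (nav_graph (M \<omega>) (dir_nav f e (M \<omega>) U))))"

end

theory Submission
  imports Defs
begin

text \<open>
  Translating by \<open>- X n\<close> puts the root at the origin and the target of the navigation at
  \<open>Z n = - X n\<close>.  The translated Poisson process has the law of \<open>N\<close> (\<open>poisson_translate\<close>,
  \<open>poisson_law_unique\<close>), so that the points may be kept fixed while only the target escapes to
  infinity, in the direction \<open>e = - e1\<close>.  For two fixed points, being closer to \<open>Z n\<close> eventually
  means being further ahead in the direction \<open>e\<close> (\<open>eventually_closer_to_far_point\<close>): this is why
  the directed navigation appears in the limit.

  Given the points, the choices \<open>\<A>(X)\<close> are independent, and the probability of \<open>\<A>(X) = Y\<close> is an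
  explicit infinite product \<open>navp\<close>.  Almost surely the weights \<open>f (dist X Y)\<close> are summable over the
  points \<open>Y\<close>, which is where \<open>\<beta> > d\<close> enters, no two points tie in the direction \<open>e\<close>, and every
  point has a point ahead of it (\<open>AE_bounded_sums\<close>, \<open>AE_no_ties\<close>, \<open>AE_unbounded\<close>).  Then the
  probabilities converge as \<open>n\<close> grows (\<open>navp_tendsto\<close>), and no mass is lost in the limit, since a
  point has finitely many neighbours and hence a highest one (\<open>navq_sums_1\<close>).  If the choices are
  realised as quantiles of the same uniform variables for all \<open>n\<close>, this becomes an almost sure
  statement: every single choice is eventually constant (\<open>quant_eventually_eq\<close>).

  To return from choices to trees, the points are enumerated measurably, and points and choices are
  recorded in a sequence.  The map \<open>ctree\<close> from such sequences to rooted graphs is sequentially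
  continuous (\<open>ctree_local_converges\<close>).  On the one hand, this turns the almost sure convergence of
  the sequences into that of bounded continuous functionals of the trees, and dominated convergence
  concludes.  On the other hand, it settles measurability: the preimage of an open set of rooted
  graphs is relatively open in a second countable space, hence Borel (\<open>measurable_ctree\<close>), so that the laws in
  the theorem are images of a product measure under measurable maps (\<open>nav_graph_law\<close>,
  \<open>bind_distr_eq\<close>).
\<close>

section \<open>Rooted trees coded by sequences\<close>

text \<open>
  Walks are extended at their end, so that induction also covers all initial segments of a walk: a
  short walk from the root never leaves a small ball.
\<close>

inductive reach :: "('v \<times> 'v) set \<Rightarrow> ('v \<Rightarrow> 'v \<Rightarrow> real) \<Rightarrow> 'v \<Rightarrow> 'v \<Rightarrow> real \<Rightarrow> bool"
  for E l u where
  reach_refl: "reach E l u u 0"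
| reach_step: "reach E l u v r \<Longrightarrow> (v, w) \<in> E \<Longrightarrow> reach E l u w (r + l v w)"

lemma walk_length_snoc:
  "xs \<noteq> [] \<Longrightarrow> walk_length l (xs @ [y]) = walk_length l xs + l (last xs) y"
  by (induction l xs rule: walk_length.induct) auto

lemma reach_imp_walk:
  assumes "reach E l u v r"
  shows "\<exists>xs. xs \<noteq> [] \<and> hd xs = u \<and> last xs = v \<and> successively (\<lambda>x y. (x, y) \<in> E) xs
           \<and> walk_length l xs = r"
  using assms
proof induction
  case reach_refl
  then show ?case by (intro exI[of _ "[u]"]) auto
next
  case (reach_step v r w)
  then obtain xs where "xs \<noteq> []" "hd xs = u" "last xs = v"
    "successively (\<lambda>x y. (x, y) \<in> E) xs" "walk_length l xs = r" by blast
  then show ?case using reach_step.hyps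
    by (intro exI[of _ "xs @ [w]"]) (auto simp: walk_length_snoc successively_append_iff)
qed

lemma walk_imp_reach:
  assumes "successively (\<lambda>x y. (x, y) \<in> E) xs" "xs \<noteq> []" "reach E l u (hd xs) r"
  shows "reach E l u (last xs) (r + walk_length l xs)"
  using assms
proof (induction l xs arbitrary: r rule: walk_length.induct)
  case (1 l x y zs)
  then have "reach E l u y (r + l x y)" by (auto intro: reach_step)
  then have "reach E l u (last (y # zs)) (r + l x y + walk_length l (y # zs))"
    using 1 by (intro "1.IH") auto
  then show ?case by (simp add: add.assoc)
qed auto

lemma gdist_eq_Inf_reach: "gdist G u v = Inf {r. reach (gedges G) (glen G) u v r}"
proof -
  have "(\<exists>xs. r = walk_length (glen G) xs \<and> xs \<noteq> [] \<and> hd xs = u \<and> last xs = v \<and>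
      successively (\<lambda>x y. (x, y) \<in> gedges G) xs) \<longleftrightarrow> reach (gedges G) (glen G) u v r" for r
  proof
    assume "reach (gedges G) (glen G) u v r"
    from reach_imp_walk[OF this] show "\<exists>xs. r = walk_length (glen G) xs \<and> xs \<noteq> [] \<and> hd xs = u \<and>
      last xs = v \<and> successively (\<lambda>x y. (x, y) \<in> gedges G) xs" by blast
  next
    assume "\<exists>xs. r = walk_length (glen G) xs \<and> xs \<noteq> [] \<and> hd xs = u \<and>
      last xs = v \<and> successively (\<lambda>x y. (x, y) \<in> gedges G) xs"
    then show "reach (gedges G) (glen G) u v r"
      using walk_imp_reach[of "gedges G" _ "glen G" u 0] by (auto intro: reach_refl)
  qed
  then show ?thesis unfolding gdist_def by simp
qed

lemma dist_le_reach: "reach E dist u v r \<Longrightarrow> dist u v \<le> r"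
proof (induction rule: reach.induct)
  case (reach_step v r w)
  then show ?case using dist_triangle[of u w v] by linarith
qed simp

lemma reach_iff_rtrancl: "(\<exists>r. reach E l u v r) \<longleftrightarrow> (u, v) \<in> E\<^sup>*"
proof
  assume "\<exists>r. reach E l u v r"
  then obtain r where "reach E l u v r" by blast
  then show "(u, v) \<in> E\<^sup>*" by induction auto
next
  assume "(u, v) \<in> E\<^sup>*"
  then show "\<exists>r. reach E l u v r" by induction (auto intro: reach.intros)
qed

lemma reach_mono: "reach E l u v r \<Longrightarrow> E \<subseteq> E' \<Longrightarrow> reach E' l u v r"
  by (induction rule: reach.induct) (auto intro: reach.intros)

lemma reach_component:
  assumes "reach E dist u v r" "u \<in> C" "\<And>x y. x \<in> C \<Longrightarrow> (x, y) \<in> E \<Longrightarrow> y \<in> C"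
  shows "reach (E \<inter> C \<times> C) dist u v r \<and> v \<in> C"
  using assms(1) by induction (use assms in \<open>auto intro: reach.intros\<close>)

locale embedded_graph =
  fixes V :: "'a::euclidean_space set" and E :: "('a \<times> 'a) set"
  assumes origin: "0 \<in> V"
    and edges: "E \<subseteq> V \<times> V" "sym E" "irrefl E"
    and loc_fin: "finite (V \<inter> cball 0 R)"
begin

abbreviation "G \<equiv> rooted_at_origin (V, E)"

abbreviation "Cmp \<equiv> {v \<in> V. (0, v) \<in> E\<^sup>*}"

lemma component_closed: "x \<in> Cmp \<Longrightarrow> (x, y) \<in> E \<Longrightarrow> y \<in> Cmp"
  using edges(1) by (auto intro: rtrancl_into_rtrancl)

lemma reach_iff:
  assumes "u \<in> Cmp"
  shows "reach (gedges G) (glen G) u v r \<longleftrightarrow> reach E dist u v r"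
proof -
  have "gedges G = E \<inter> Cmp \<times> Cmp" "glen G = dist"
    by (simp_all add: rooted_at_origin_def Let_def)
  moreover have "reach (E \<inter> Cmp \<times> Cmp) dist u v r \<Longrightarrow> reach E dist u v r"
    by (erule reach_mono) blast
  moreover have "reach E dist u v r \<Longrightarrow> reach (E \<inter> Cmp \<times> Cmp) dist u v r"
    by (rule conjunct1[OF reach_component[OF _ assms]]) (assumption | rule component_closed)+
  ultimately show ?thesis by metis
qed

lemma gdist_eq: "u \<in> Cmp \<Longrightarrow> gdist G u v = Inf {r. reach E dist u v r}"
  unfolding gdist_eq_Inf_reach using reach_iff[of u v] by (intro arg_cong[where f = Inf]) auto

lemma connected_component:
  assumes "u \<in> Cmp" "v \<in> Cmp"
  shows "\<exists>r. reach E dist u v r"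
proof -
  have "(u, 0) \<in> E\<^sup>*" using assms(1) edges(2) by (metis (mono_tags, lifting) mem_Collect_eq sym_rtrancl symD)
  then have "(u, v) \<in> E\<^sup>*" using assms(2) by auto
  then show ?thesis using reach_iff_rtrancl[of E dist u v] by blast
qed

lemma gdist_less_iff:
  assumes "u \<in> Cmp" "v \<in> Cmp"
  shows "gdist G u v < r \<longleftrightarrow> (\<exists>r'<r. reach E dist u v r')"
proof -
  have "bdd_below {r. reach E dist u v r}"
    by (rule bdd_belowI[of _ "dist u v"]) (auto dest: dist_le_reach)
  moreover have "{r. reach E dist u v r} \<noteq> {}" using connected_component assms by blast
  ultimately show ?thesis using cInf_less_iff[of "{r. reach E dist u v r}" r] gdist_eq[OF assms(1)] by auto
qed

lemma dist_le_gdist: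
  assumes "u \<in> Cmp" "v \<in> Cmp"
  shows "dist u v \<le> gdist G u v"
proof (rule ccontr)
  assume "\<not> ?thesis"
  then have "gdist G u v < dist u v" by simp
  then obtain r where "r < dist u v" "reach E dist u v r" using gdist_less_iff[OF assms] by blast
  then show False using dist_le_reach[of E u v r] by linarith
qed

text \<open>
  A walk is at least as long as the Euclidean distance of its ends, so that local finiteness of the
  vertex set passes to the graph distance.
\<close>

lemma geometric: "G \<in> geometric_graphs"
proof -
  have v: "gverts G = Cmp" "gedges G = E \<inter> Cmp \<times> Cmp" "glen G = dist" "groot G = 0"
    by (simp_all add: rooted_at_origin_def Let_def)
  have "finite {v \<in> Cmp. gdist G u v \<le> \<rho>}" if "u \<in> Cmp" for u \<rho>
  proof (rule finite_subset[OF _ loc_fin[of "norm u + \<rho>"]])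
    show "{v \<in> Cmp. gdist G u v \<le> \<rho>} \<subseteq> V \<inter> cball 0 (norm u + \<rho>)"
    proof clarsimp
      fix v assume "v \<in> V" "(0, v) \<in> E\<^sup>*" "gdist G u v \<le> \<rho>"
      then have "dist u v \<le> \<rho>" using dist_le_gdist[OF that, of v] by auto
      then show "norm v \<le> norm u + \<rho>"
        using dist_triangle[of 0 v u] by simp
    qed
  qed
  moreover have "(0, v) \<in> (E \<inter> Cmp \<times> Cmp)\<^sup>*" if v: "v \<in> Cmp" for v
  proof -
    have "0 \<in> Cmp" using origin by simp
    then obtain r where "reach E dist 0 v r" using connected_component[OF _ v] by blast
    then have "reach (E \<inter> Cmp \<times> Cmp) dist 0 v r"
      by (rule conjunct1[OF reach_component[OF _ \<open>0 \<in> Cmp\<close>]]) (assumption | rule component_closed)+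
    then show ?thesis using reach_iff_rtrancl[of "E \<inter> Cmp \<times> Cmp" dist 0 v] by blast
  qed
  moreover have "\<forall>(x, y)\<in>E \<inter> Cmp \<times> Cmp. 0 < dist x y \<and> dist x y = dist y x"
    using edges(3) by (auto simp: irrefl_def dist_commute)
  moreover have "sym (E \<inter> Cmp \<times> Cmp)" using edges(2) by (auto simp: sym_def)
  moreover have "irrefl (E \<inter> Cmp \<times> Cmp)" using edges(3) by (auto simp: irrefl_def)
  ultimately show ?thesis unfolding geometric_graphs_def mem_Collect_eq v
    using origin by (intro conjI) simp_all
qed

end

text \<open>
  Entry \<open>i\<close> of a code holds the position of the point with index \<open>i\<close>, its choice, and a bound for
  the indices of all points of norm at most \<open>i\<close>.  The choice is \<open>0\<close> for an unused index, \<open>Suc j\<close> if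
  the point chooses \<open>j\<close>, and \<open>Suc i\<close> if it chooses nothing.  The bounds make coordinatewise
  convergence control whole balls: otherwise points of ever larger index could appear near the root.
\<close>

definition cpos :: "(nat \<Rightarrow> 'a \<times> nat \<times> nat) \<Rightarrow> nat \<Rightarrow> 'a" where
  "cpos s i = fst (s i)"

definition cnav :: "(nat \<Rightarrow> 'a \<times> nat \<times> nat) \<Rightarrow> nat \<Rightarrow> nat" where
  "cnav s i = fst (snd (s i))"

definition cbound :: "(nat \<Rightarrow> 'a \<times> nat \<times> nat) \<Rightarrow> nat \<Rightarrow> nat" where
  "cbound s R = snd (snd (s R))"

definition idx :: "(nat \<Rightarrow> 'a \<times> nat \<times> nat) \<Rightarrow> nat set" where
  "idx s = {i. cnav s i \<noteq> 0}"

definition links :: "(nat \<Rightarrow> 'a \<times> nat \<times> nat) \<Rightarrow> (nat \<times> nat) set" where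
  "links s = {(i, j). i \<in> idx s \<and> j \<in> idx s \<and> i \<noteq> j \<and> (cnav s i = Suc j \<or> cnav s j = Suc i)}"

definition clen :: "(nat \<Rightarrow> 'a::metric_space \<times> nat \<times> nat) \<Rightarrow> nat \<Rightarrow> nat \<Rightarrow> real" where
  "clen s i j = dist (cpos s i) (cpos s j)"

definition cgraph :: "(nat \<Rightarrow> 'a \<times> nat \<times> nat) \<Rightarrow> 'a graph" where
  "cgraph s = (cpos s ` idx s, map_prod (cpos s) (cpos s) ` links s)"

definition configs :: "(nat \<Rightarrow> 'a::euclidean_space \<times> nat \<times> nat) set" where
  "configs = {s. 0 \<in> idx s \<and> cpos s 0 = 0 \<and> inj_on (cpos s) (idx s) \<and>
     (\<forall>i\<in>idx s. \<forall>R. norm (cpos s i) \<le> real R \<longrightarrow> i < cbound s R)}"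

lemma embedded_graph_cgraph:
  assumes "s \<in> configs"
  shows "embedded_graph (fst (cgraph s)) (snd (cgraph s))"
proof
  show "0 \<in> fst (cgraph s)" using assms by (force simp: configs_def cgraph_def)
  show "snd (cgraph s) \<subseteq> fst (cgraph s) \<times> fst (cgraph s)"
    by (auto simp: cgraph_def links_def)
  show "sym (snd (cgraph s))" by (force simp: cgraph_def links_def sym_def)
  show "irrefl (snd (cgraph s))" using assms
    by (auto simp: cgraph_def links_def irrefl_def configs_def inj_on_def)
  fix R
  have "fst (cgraph s) \<inter> cball 0 R \<subseteq> cpos s ` {..<cbound s (nat \<lceil>R\<rceil>)}"
  proof
    fix v assume "v \<in> fst (cgraph s) \<inter> cball 0 R"
    then obtain i where i: "i \<in> idx s" "v = cpos s i" "norm v \<le> R" by (auto simp: cgraph_def)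
    then have "norm v \<le> real (nat \<lceil>R\<rceil>)" by linarith
    then show "v \<in> cpos s ` {..<cbound s (nat \<lceil>R\<rceil>)}" using i assms by (auto simp: configs_def)
  qed
  then show "finite (fst (cgraph s) \<inter> cball 0 R)" by (rule finite_subset) simp
qed

lemma reach_cgraph_iff:
  assumes s: "s \<in> configs"
  shows "reach (snd (cgraph s)) dist 0 v r \<longleftrightarrow>
     (\<exists>i\<in>idx s. v = cpos s i \<and> reach (links s) (clen s) 0 i r)"
proof
  assume "reach (snd (cgraph s)) dist 0 v r"
  then show "\<exists>i\<in>idx s. v = cpos s i \<and> reach (links s) (clen s) 0 i r"
  proof induction
    case reach_refl
    then show ?case using s by (auto simp: configs_def intro!: bexI[of _ 0] reach.intros)
  next
    case (reach_step v r w)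
    then obtain i where i: "i \<in> idx s" "v = cpos s i" "reach (links s) (clen s) 0 i r" by blast
    obtain j k where jk: "(j, k) \<in> links s" "v = cpos s j" "w = cpos s k"
      using reach_step.hyps(2) by (auto simp: cgraph_def)
    then have "i = j" using i s by (auto simp: configs_def inj_on_def links_def)
    then have "reach (links s) (clen s) 0 k (r + clen s j k)"
      using i jk reach.reach_step[of "links s" "clen s" 0 j r k] by simp
    moreover have "k \<in> idx s" using jk(1) by (simp add: links_def)
    ultimately show ?case using jk by (intro bexI[of _ k] conjI) (simp_all add: clen_def[of s j k])
  qed
next
  assume "\<exists>i\<in>idx s. v = cpos s i \<and> reach (links s) (clen s) 0 i r"
  then obtain i where "v = cpos s i" "reach (links s) (clen s) 0 i r" by blast
  from this(2,1) show "reach (snd (cgraph s)) dist 0 v r"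
  proof (induction arbitrary: v)
    case reach_refl
    then show ?case using s by (auto simp: configs_def intro: reach.intros)
  next
    case (reach_step i r j)
    then have "(cpos s i, v) \<in> snd (cgraph s)" by (force simp: cgraph_def)
    moreover have "reach (snd (cgraph s)) dist 0 (cpos s i) r" by (rule reach_step.IH) simp
    ultimately have "reach (snd (cgraph s)) dist 0 v (r + dist (cpos s i) v)"
      by (intro reach.reach_step)
    then show ?case using reach_step.prems by (simp add: clen_def)
  qed
qed

definition closer :: "(nat \<Rightarrow> 'a::euclidean_space \<times> nat \<times> nat) \<Rightarrow> real \<Rightarrow> nat set" where
  "closer s r = {i. \<exists>r'<r. reach (links s) (clen s) 0 i r'}"

lemma reach_in_idx: "s \<in> configs \<Longrightarrow> reach (links s) (clen s) 0 i r \<Longrightarrow> i \<in> idx s"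
  by (erule reach.cases) (auto simp: configs_def links_def)

lemma norm_le_reach:
  "s \<in> configs \<Longrightarrow> reach (links s) (clen s) 0 i r \<Longrightarrow> norm (cpos s i) \<le> r"
  using reach_cgraph_iff[of s "cpos s i" r] reach_in_idx[of s i r] dist_le_reach[of _ 0 "cpos s i" r]
  by auto

lemma closer_bound:
  assumes "s \<in> configs" "i \<in> closer s r" "r \<le> real R"
  shows "i < cbound s R"
proof -
  obtain r' where r': "r' < r" "reach (links s) (clen s) 0 i r'" using assms(2) unfolding closer_def by blast
  have "norm (cpos s i) \<le> real R" using norm_le_reach[OF assms(1) r'(2)] r'(1) assms(3) by linarith
  then show ?thesis using assms(1) reach_in_idx[OF assms(1) r'(2)] by (simp add: configs_def)
qed

definition ctree :: "(nat \<Rightarrow> 'a::euclidean_space \<times> nat \<times> nat) \<Rightarrow> 'a rooted_graph" where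
  "ctree s = rooted_at_origin (cgraph s)"

lemma ctree_geometric: "s \<in> configs \<Longrightarrow> ctree s \<in> geometric_graphs"
  using embedded_graph.geometric[OF embedded_graph_cgraph] by (simp add: ctree_def)

lemma ctree_component:
  assumes "s \<in> configs"
  shows "{v \<in> fst (cgraph s). (0, v) \<in> (snd (cgraph s))\<^sup>*} =
     cpos s ` {i. \<exists>r. reach (links s) (clen s) 0 i r}"
proof -
  have "(0, v) \<in> (snd (cgraph s))\<^sup>* \<longleftrightarrow> v \<in> cpos s ` {i. \<exists>r. reach (links s) (clen s) 0 i r}" for v
    unfolding reach_iff_rtrancl[of _ dist, symmetric] reach_cgraph_iff[OF assms]
    using reach_in_idx[OF assms] by auto
  then show ?thesis using reach_in_idx[OF assms] by (auto simp: cgraph_def)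
qed

lemma gdist_ctree_less:
  assumes s: "s \<in> configs" and i: "reach (links s) (clen s) 0 i r0"
  shows "gdist (ctree s) 0 (cpos s i) < r \<longleftrightarrow> i \<in> closer s r"
proof -
  interpret embedded_graph "fst (cgraph s)" "snd (cgraph s)" by (rule embedded_graph_cgraph[OF s])
  have "i \<in> idx s" using reach_in_idx[OF s i] .
  have "gdist (ctree s) 0 (cpos s i) < r \<longleftrightarrow> (\<exists>r'<r. reach (snd (cgraph s)) dist 0 (cpos s i) r')"
    using gdist_less_iff[of 0 "cpos s i" r] ctree_component[OF s] i origin by (auto simp: ctree_def)
  also have "\<dots> \<longleftrightarrow> i \<in> closer s r"
  proof -
    have "j = i" if "j \<in> idx s" "cpos s i = cpos s j" for j
      using that \<open>i \<in> idx s\<close> s by (auto simp: configs_def inj_on_def)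
    then have "reach (snd (cgraph s)) dist 0 (cpos s i) r' \<longleftrightarrow> reach (links s) (clen s) 0 i r'" for r'
      unfolding reach_cgraph_iff[OF s] using \<open>i \<in> idx s\<close> by auto
    then show ?thesis unfolding closer_def by simp
  qed
  finally show ?thesis .
qed

text \<open>
  The graph distance is an infimum over walks, so the closed ball is the intersection of the sets
  \<open>closer\<close>, which can be described by walks.
\<close>

definition inball :: "(nat \<Rightarrow> 'a::euclidean_space \<times> nat \<times> nat) \<Rightarrow> real \<Rightarrow> nat set" where
  "inball s \<rho> = {i. \<forall>r>\<rho>. i \<in> closer s r}"

lemma closer_subset_inball: "closer s \<rho> \<subseteq> inball s \<rho>"
  unfolding closer_def inball_def by (auto intro: less_trans)

lemma ctree_simps:
  assumes "s \<in> configs"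
  shows "gverts (ctree s) = cpos s ` {i. \<exists>r. reach (links s) (clen s) 0 i r}"
    "glen (ctree s) = dist" "groot (ctree s) = 0"
    "gedges (ctree s) = snd (cgraph s) \<inter> gverts (ctree s) \<times> gverts (ctree s)"
  using ctree_component[OF assms] by (auto simp: ctree_def rooted_at_origin_def Let_def)

lemma inball_reach: "i \<in> inball s \<rho> \<Longrightarrow> \<exists>r. reach (links s) (clen s) 0 i r"
  unfolding inball_def closer_def by (auto dest: spec[of _ "\<rho> + 1"])

lemma gverts_nbhd_ctree:
  assumes s: "s \<in> configs"
  shows "gverts (nbhd \<rho> (ctree s)) = cpos s ` inball s \<rho>"
proof -
  have "gdist (ctree s) 0 (cpos s i) \<le> \<rho> \<longleftrightarrow> i \<in> inball s \<rho>"
    if "reach (links s) (clen s) 0 i r0" for i r0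
  proof -
    have "gdist (ctree s) 0 (cpos s i) \<le> \<rho> \<longleftrightarrow> (\<forall>r>\<rho>. gdist (ctree s) 0 (cpos s i) < r)"
      using dense[of \<rho> "gdist (ctree s) 0 (cpos s i)"] by force
    then show ?thesis using gdist_ctree_less[OF s that] unfolding inball_def by simp
  qed
  then have "{i. (\<exists>r. reach (links s) (clen s) 0 i r) \<and> gdist (ctree s) 0 (cpos s i) \<le> \<rho>} = inball s \<rho>"
    using inball_reach[of _ s \<rho>] by blast
  then have "cpos s ` inball s \<rho> = {v \<in> gverts (ctree s). gdist (ctree s) 0 v \<le> \<rho>}"
    unfolding ctree_simps(1)[OF s] by (simp only: image_iff set_eq_iff mem_Collect_eq) blast
  then show ?thesis by (simp add: nbhd_def Let_def ctree_simps(3)[OF s])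
qed

lemma nbhd_ctree_edge_iff:
  assumes s: "s \<in> configs" and ij: "i \<in> inball s \<rho>" "j \<in> inball s \<rho>"
  shows "(cpos s i, cpos s j) \<in> gedges (nbhd \<rho> (ctree s)) \<longleftrightarrow> (i, j) \<in> links s"
proof -
  have g: "gedges (nbhd \<rho> (ctree s)) = gedges (ctree s) \<inter> gverts (nbhd \<rho> (ctree s)) \<times> gverts (nbhd \<rho> (ctree s))"
    by (simp add: nbhd_def Let_def)
  have *: "i \<in> idx s" "j \<in> idx s" using ij inball_reach reach_in_idx[OF s] by blast+
  have "(cpos s i, cpos s j) \<in> gedges (nbhd \<rho> (ctree s)) \<longleftrightarrow> (cpos s i, cpos s j) \<in> snd (cgraph s)"
    unfolding g gverts_nbhd_ctree[OF s] ctree_simps(4)[OF s] ctree_simps(1)[OF s]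
    using ij inball_reach[of _ s \<rho>] by auto
  also have "\<dots> \<longleftrightarrow> (i, j) \<in> links s"
  proof
    assume "(cpos s i, cpos s j) \<in> snd (cgraph s)"
    then obtain i' j' where l: "(i', j') \<in> links s" "cpos s i = cpos s i'" "cpos s j = cpos s j'"
      by (auto simp: cgraph_def)
    have inj: "inj_on (cpos s) (idx s)" using s by (simp add: configs_def)
    have "i' = i" "j' = j" using inj_onD[OF inj l(2)] inj_onD[OF inj l(3)] * l(1) by (auto simp: links_def)
    then show "(i, j) \<in> links s" using l by simp
  qed (force simp: cgraph_def)
  finally show ?thesis .
qed


text \<open>
  A given walk has finitely many edges; these persist, and their lengths converge.
\<close>

lemma reach_limit:
  assumes links: "\<And>i j. (i, j) \<in> L \<Longrightarrow> \<forall>\<^sub>F n in sequentially. (i, j) \<in> L' n"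
    and len: "\<And>i j. (i, j) \<in> L \<Longrightarrow> (\<lambda>n. l' n i j) \<longlonglongrightarrow> l i j"
    and "reach L l u i r"
  shows "\<exists>rn. rn \<longlonglongrightarrow> r \<and> (\<forall>\<^sub>F n in sequentially. reach (L' n) (l' n) u i (rn n))"
  using assms(3)
proof induction
  case reach_refl
  then show ?case by (intro exI[of _ "\<lambda>_. 0"]) (simp add: reach.reach_refl)
next
  case (reach_step i r j)
  then obtain rn where rn: "rn \<longlonglongrightarrow> r" "\<forall>\<^sub>F n in sequentially. reach (L' n) (l' n) u i (rn n)" by blast
  have "\<forall>\<^sub>F n in sequentially. reach (L' n) (l' n) u j (rn n + l' n i j)"
    using rn(2) links[OF reach_step.hyps(2)] by eventually_elim (rule reach.reach_step)
  moreover have "(\<lambda>n. rn n + l' n i j) \<longlonglongrightarrow> r + l i j"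
    using rn(1) len[OF reach_step.hyps(2)] by (rule tendsto_add)
  ultimately show ?case by blast
qed

text \<open>
  Walks of the approximating graphs may have arbitrarily many steps, so that additive errors would
  accumulate.  Comparing lengths up to a factor \<open>a\<close> avoids this.
\<close>

lemma reach_shrink:
  assumes comp: "\<And>i j. i \<in> B \<Longrightarrow> j \<in> B \<Longrightarrow> (i, j) \<in> L' \<Longrightarrow> (i, j) \<in> L \<and> a * l i j \<le> l' i j"
    and B: "\<And>i r. reach L' l' u i r \<Longrightarrow> r < R \<Longrightarrow> i \<in> B"
    and nonneg: "\<And>i j. 0 \<le> l' i j" and "0 < (a::real)"
    and "reach L' l' u i r" "r < R"
  shows "\<exists>r'. reach L l u i r' \<and> a * r' \<le> r"
  using assms(5,6)
proof induction
  case reach_refl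
  then show ?case by (intro exI[of _ 0]) (auto intro: reach.intros)
next
  case (reach_step i r j)
  have "r < R" using reach_step.prems nonneg[of i j] by linarith
  then obtain r' where r': "reach L l u i r'" "a * r' \<le> r" using reach_step.IH by blast
  have "i \<in> B" using B reach_step.hyps(1) \<open>r < R\<close> by blast
  moreover have "j \<in> B" using B[OF reach.reach_step[OF reach_step.hyps]] reach_step.prems .
  ultimately have *: "(i, j) \<in> L" "a * l i j \<le> l' i j" using comp reach_step.hyps(2) by auto
  have "reach L l u j (r' + l i j)" using r'(1) *(1) by (rule reach.reach_step)
  moreover have "a * (r' + l i j) \<le> r + l' i j" using r'(2) *(2) by (simp add: distrib_left)
  ultimately show ?case by blast
qed

lemma cpos_tendsto:
  fixes s :: "nat \<Rightarrow> 'a::euclidean_space \<times> nat \<times> nat"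
  assumes "S \<longlonglongrightarrow> s"
  shows "(\<lambda>n. cpos (S n) i) \<longlonglongrightarrow> cpos s i"
    "\<forall>\<^sub>F n in sequentially. cnav (S n) i = cnav s i"
    "\<forall>\<^sub>F n in sequentially. cbound (S n) i = cbound s i"
proof -
  have *: "(\<lambda>n. S n i) \<longlonglongrightarrow> s i" using continuous_on_tendsto_compose[OF continuous_on_product_coordinates assms, of i] by simp
  show "(\<lambda>n. cpos (S n) i) \<longlonglongrightarrow> cpos s i" unfolding cpos_def using tendsto_fst[OF *] .
  show "\<forall>\<^sub>F n in sequentially. cnav (S n) i = cnav s i"
    using tendsto_fst[OF tendsto_snd[OF *]] unfolding cnav_def tendsto_discrete .
  show "\<forall>\<^sub>F n in sequentially. cbound (S n) i = cbound s i"
    using tendsto_snd[OF tendsto_snd[OF *]] unfolding cbound_def tendsto_discrete .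
qed

lemma eventually_links_eq:
  fixes s :: "nat \<Rightarrow> 'a::euclidean_space \<times> nat \<times> nat"
  assumes "S \<longlonglongrightarrow> s"
  shows "\<forall>\<^sub>F n in sequentially. (i, j) \<in> links (S n) \<longleftrightarrow> (i, j) \<in> links s"
  using cpos_tendsto(2)[OF assms, of i] cpos_tendsto(2)[OF assms, of j]
  by eventually_elim (simp add: links_def idx_def)

text \<open>
  All walks of length at most \<open>\<rho> + 1\<close> stay among finitely many indices, bounded by \<open>cbound\<close>.  Points
  strictly inside the ball are reached by a walk that persists; points outside are kept at a distance
  by the multiplicative comparison of lengths.
\<close>

lemma eventually_inball_eq:
  fixes s :: "nat \<Rightarrow> 'a::euclidean_space \<times> nat \<times> nat"
  assumes S: "S \<longlonglongrightarrow> s" "\<And>n. S n \<in> configs" and s: "s \<in> configs"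
    and \<rho>: "inball s \<rho> \<subseteq> closer s \<rho>"
  shows "\<forall>\<^sub>F n in sequentially. inball (S n) \<rho> = inball s \<rho> \<and>
           (\<forall>i\<in>inball s \<rho>. \<forall>j\<in>inball s \<rho>. (i, j) \<in> links (S n) \<longleftrightarrow> (i, j) \<in> links s)"
proof -
  define R where "R = nat \<lceil>\<rho>\<rceil> + 1"
  have R: "\<rho> + 1 \<le> real R" unfolding R_def by linarith
  define b where "b = cbound s R"
  have B: "\<forall>\<^sub>F n in sequentially. cbound (S n) R = b" unfolding b_def by (rule cpos_tendsto(3)[OF S(1)])
  have L: "\<forall>\<^sub>F n in sequentially. \<forall>i\<in>{..<b}. \<forall>j\<in>{..<b}. (i, j) \<in> links (S n) \<longleftrightarrow> (i, j) \<in> links s"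
    by (intro eventually_ball_finite ballI eventually_links_eq S) auto
  have len: "(\<lambda>n. clen (S n) i j) \<longlonglongrightarrow> clen s i j" for i j
    unfolding clen_def by (intro tendsto_dist cpos_tendsto S)
  have inball_mono: "inball x \<rho> \<subseteq> closer x (\<rho> + 1)" for x :: "nat \<Rightarrow> 'a \<times> nat \<times> nat"
    by (auto simp: inball_def)
  have b: "inball s \<rho> \<subseteq> {..<b}"
    using inball_mono[of s] closer_bound[OF s _ R] unfolding b_def by auto
  have bn: "\<forall>\<^sub>F n in sequentially. closer (S n) (\<rho> + 1) \<subseteq> {..<b}"
    using B
  proof eventually_elim
    case (elim n)
    then show ?case using closer_bound[OF S(2)[of n] _ R] by auto
  qed
  have close: "\<forall>\<^sub>F n in sequentially. i \<in> closer (S n) \<rho>" if i: "i \<in> closer s \<rho>" for i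
  proof -
    obtain r where r: "r < \<rho>" "reach (links s) (clen s) 0 i r" using i by (auto simp: closer_def)
    have "\<exists>rn. rn \<longlonglongrightarrow> r \<and> (\<forall>\<^sub>F n in sequentially. reach (links (S n)) (clen (S n)) 0 i (rn n))"
    proof (rule reach_limit[OF _ len r(2)])
      show "\<forall>\<^sub>F n in sequentially. (i, j) \<in> links (S n)" if "(i, j) \<in> links s" for i j
        using eventually_links_eq[OF S(1), of i j] that by simp
    qed
    then obtain rn where "rn \<longlonglongrightarrow> r" and
      rn: "\<forall>\<^sub>F n in sequentially. reach (links (S n)) (clen (S n)) 0 i (rn n)" by blast
    then have "\<forall>\<^sub>F n in sequentially. rn n < \<rho>" using order_tendstoD(2) r(1) by blast
    with rn show ?thesis by eventually_elim (auto simp: closer_def)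
  qed
  have far: "\<forall>\<^sub>F n in sequentially. i \<notin> inball (S n) \<rho>" if i: "i \<notin> inball s \<rho>" for i
  proof -
    obtain r0' where "r0' > \<rho>" "i \<notin> closer s r0'" using i by (auto simp: inball_def)
    define r0 where "r0 = min r0' (\<rho> + 1)"
    have r0: "\<rho> < r0" "i \<notin> closer s r0"
      using \<open>r0' > \<rho>\<close> \<open>i \<notin> closer s r0'\<close> unfolding r0_def closer_def by auto
    show ?thesis
    proof (cases "\<rho> \<ge> 0")
      case False
      have "inball (S n) \<rho> = {}" for n
      proof -
        have "norm (cpos (S n) k) < 0" if k: "k \<in> closer (S n) 0" for k
        proof -
          obtain r' where "r' < 0" "reach (links (S n)) (clen (S n)) 0 k r'"
            using k unfolding closer_def by blast
          then show ?thesis using norm_le_reach[OF S(2), of n k r'] by linarith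
        qed
        then have "closer (S n) 0 = {}" by (meson equals0I norm_not_less_zero)
        then show ?thesis using False unfolding inball_def by (auto intro!: exI[of _ 0])
      qed
      then show ?thesis by simp
    next
      case True
      \<comment> \<open>this makes \<open>(\<rho> + \<eta>) / (1 - \<eta>)\<close> equal to \<open>r0\<close>\<close>
      define \<eta> where "\<eta> = (r0 - \<rho>) / (1 + r0)"
      have \<eta>: "0 < \<eta>" "\<eta> < 1" "\<rho> + \<eta> \<le> (1 - \<eta>) * r0" "\<eta> \<le> 1"
        using r0 True unfolding \<eta>_def by (auto simp: field_simps)
      have "\<forall>\<^sub>F n in sequentially. (j, k) \<in> links s \<longrightarrow> (1 - \<eta>) * clen s j k \<le> clen (S n) j k" for j k
      proof (cases "(j, k) \<in> links s")
        case jk: True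
        then have "0 < clen s j k" using s by (auto simp: clen_def links_def configs_def inj_on_def)
        then have "(1 - \<eta>) * clen s j k < clen s j k" using \<eta> by auto
        from order_tendstoD(1)[OF len this] show ?thesis by eventually_elim auto
      qed simp
      then have "\<forall>\<^sub>F n in sequentially. \<forall>j\<in>{..<b}. \<forall>k\<in>{..<b}.
          (j, k) \<in> links s \<longrightarrow> (1 - \<eta>) * clen s j k \<le> clen (S n) j k"
        by (intro eventually_ball_finite ballI) auto
      with L bn show ?thesis
      proof eventually_elim
        case (elim n)
        show ?case
        proof
          assume "i \<in> inball (S n) \<rho>"
          then have "i \<in> closer (S n) (\<rho> + \<eta>)" using \<eta>(1) unfolding inball_def by simp
          then obtain r where r: "r < \<rho> + \<eta>" "reach (links (S n)) (clen (S n)) 0 i r"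
            unfolding closer_def by blast
          have "\<exists>r'. reach (links s) (clen s) 0 i r' \<and> (1 - \<eta>) * r' \<le> r"
          proof (rule reach_shrink[where B = "{..<b}" and R = "\<rho> + 1" and L' = "links (S n)" and l' = "clen (S n)"])
            show "(j, k) \<in> links s \<and> (1 - \<eta>) * clen s j k \<le> clen (S n) j k"
              if "j \<in> {..<b}" "k \<in> {..<b}" "(j, k) \<in> links (S n)" for j k
              using that elim by auto
            show "j \<in> {..<b}" if "reach (links (S n)) (clen (S n)) 0 j r" "r < \<rho> + 1" for j r
              using that elim unfolding closer_def by blast
          qed (use r \<eta> in \<open>auto simp: clen_def\<close>)
          then obtain r' where r': "reach (links s) (clen s) 0 i r'" "(1 - \<eta>) * r' \<le> r" by blast
          then have "(1 - \<eta>) * r' < (1 - \<eta>) * r0" using r \<eta> by linarith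
          then have "r' < r0" using \<eta> by (simp add: mult_less_cancel_left)
          then show False using r' r0 unfolding closer_def by blast
        qed
      qed
    qed
  qed
  have "\<forall>\<^sub>F n in sequentially. \<forall>i\<in>{..<b}. i \<in> inball (S n) \<rho> \<longleftrightarrow> i \<in> inball s \<rho>"
  proof (intro eventually_ball_finite ballI)
    fix i
    show "\<forall>\<^sub>F n in sequentially. i \<in> inball (S n) \<rho> \<longleftrightarrow> i \<in> inball s \<rho>"
    proof (cases "i \<in> inball s \<rho>")
      case True
      then have "i \<in> closer s \<rho>" using \<rho> by blast
      from close[OF this] show ?thesis
        by eventually_elim (use True closer_subset_inball in blast)
    next
      case False
      from far[OF False] show ?thesis by eventually_elim (use False in auto)
    qed
  qed simp
  with bn L show ?thesis
  proof eventually_elim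
    case (elim n)
    have "inball (S n) \<rho> \<subseteq> {..<b}" using inball_mono[of "S n"] elim(1) by blast
    then have "inball (S n) \<rho> = inball s \<rho>" using elim(3) b by blast
    then show ?case using elim(2) b by blast
  qed
qed

text \<open>
  The isomorphism matches points of equal index.  If no vertex has distance exactly \<open>\<rho>\<close>, the open and
  the closed ball of radius \<open>\<rho>\<close> agree, which makes the ball stable.
\<close>

lemma ctree_local_converges:
  fixes s :: "nat \<Rightarrow> 'a::euclidean_space \<times> nat \<times> nat"
  assumes S: "S \<longlonglongrightarrow> s" "\<And>n. S n \<in> configs" and s: "s \<in> configs"
  shows "local_converges (\<lambda>n. ctree (S n)) (ctree s)"
  unfolding local_converges_def
proof (intro allI impI)
  fix \<rho> :: real
  assume "\<rho> > 0" and ne: "\<forall>v\<in>gverts (ctree s). gdist (ctree s) (groot (ctree s)) v \<noteq> \<rho>"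
  have inj: "inj_on (cpos s) (idx s)" using s by (simp add: configs_def)
  have idx: "inball x \<rho> \<subseteq> idx x" if "x \<in> configs" for x :: "nat \<Rightarrow> 'a \<times> nat \<times> nat"
    using inball_reach reach_in_idx[OF that] by blast
  have sub: "inball s \<rho> \<subseteq> closer s \<rho>"
  proof
    fix i assume i: "i \<in> inball s \<rho>"
    then obtain r0 where r0: "reach (links s) (clen s) 0 i r0" using inball_reach by blast
    have "gdist (ctree s) 0 (cpos s i) \<noteq> \<rho>" using ne r0 by (auto simp: ctree_simps[OF s])
    moreover have "gdist (ctree s) 0 (cpos s i) < r" if "r > \<rho>" for r
      using i that unfolding gdist_ctree_less[OF s r0] inball_def by blast
    then have "gdist (ctree s) 0 (cpos s i) \<le> \<rho>"
      using dense[of \<rho> "gdist (ctree s) 0 (cpos s i)"] by (meson less_asym not_le)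
    ultimately have "gdist (ctree s) 0 (cpos s i) < \<rho>" by simp
    then show "i \<in> closer s \<rho>" using gdist_ctree_less[OF s r0] by blast
  qed
  define \<gamma> where "\<gamma> n v = cpos (S n) (the_inv_into (idx s) (cpos s) v)" for n v
  have \<gamma>: "\<gamma> n (cpos s i) = cpos (S n) i" if "i \<in> idx s" for n i
    unfolding \<gamma>_def using the_inv_into_f_f[OF inj that] by simp
  have "\<forall>\<^sub>F n in sequentially. rooted_iso (\<gamma> n) (nbhd \<rho> (ctree s)) (nbhd \<rho> (ctree (S n)))"
    using eventually_inball_eq[OF S s sub]
  proof eventually_elim
    case (elim n)
    note Sn = S(2)[of n]
    have injn: "inj_on (cpos (S n)) (inball (S n) \<rho>)"
      using Sn idx[OF Sn] by (auto simp: configs_def intro: inj_on_subset)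
    have "bij_betw (\<gamma> n \<circ> cpos s) (inball s \<rho>) (cpos (S n) ` inball s \<rho>)"
      using injn elim idx[OF s] by (auto simp: bij_betw_def inj_on_def \<gamma> subset_iff)
    moreover have "bij_betw (cpos s) (inball s \<rho>) (cpos s ` inball s \<rho>)"
      using inj idx[OF s] by (auto simp: bij_betw_def intro: inj_on_subset)
    ultimately have 1: "bij_betw (\<gamma> n) (cpos s ` inball s \<rho>) (cpos (S n) ` inball s \<rho>)"
      using bij_betw_comp_iff by metis
    have 2: "\<gamma> n 0 = 0"
    proof -
      have "0 \<in> idx s" "cpos s 0 = 0" "cpos (S n) 0 = 0" using s Sn by (auto simp: configs_def)
      then show ?thesis using \<gamma>[of 0 n] by simp
    qed
    have groot: "groot (nbhd \<rho> x) = groot x" for x :: "'a rooted_graph" by (simp add: nbhd_def Let_def)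
    have 3: "(cpos s i, cpos s j) \<in> gedges (nbhd \<rho> (ctree s)) \<longleftrightarrow>
       (\<gamma> n (cpos s i), \<gamma> n (cpos s j)) \<in> gedges (nbhd \<rho> (ctree (S n)))"
      if ij: "i \<in> inball s \<rho>" "j \<in> inball s \<rho>" for i j
    proof -
      have "i \<in> idx s" "j \<in> idx s" using idx[OF s] ij by auto
      then show ?thesis
        using ij elim nbhd_ctree_edge_iff[OF s ij] nbhd_ctree_edge_iff[OF Sn, of i \<rho> j] by (simp add: \<gamma>)
    qed
    show ?case unfolding rooted_iso_def gverts_nbhd_ctree[OF s] gverts_nbhd_ctree[OF Sn] groot
      using 1 2 3 elim by (auto simp: ctree_simps[OF s] ctree_simps[OF Sn])
  qed
  moreover have "(\<lambda>n. glen (ctree (S n)) (\<gamma> n u) (\<gamma> n v)) \<longlonglongrightarrow> glen (ctree s) u v"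
    if "(u, v) \<in> gedges (nbhd \<rho> (ctree s))" for u v
  proof -
    have "u \<in> gverts (nbhd \<rho> (ctree s))" "v \<in> gverts (nbhd \<rho> (ctree s))"
      using that by (auto simp: nbhd_def Let_def)
    then obtain i j where "i \<in> idx s" "j \<in> idx s" "u = cpos s i" "v = cpos s j"
      unfolding gverts_nbhd_ctree[OF s] using idx[OF s] by blast
    then show ?thesis
      unfolding ctree_simps(2)[OF s] ctree_simps(2)[OF S(2)]
      by (simp add: \<gamma>) (intro tendsto_dist cpos_tendsto S)
  qed
  ultimately show "\<exists>\<gamma>. (\<forall>\<^sub>F n in sequentially. rooted_iso (\<gamma> n) (nbhd \<rho> (ctree s)) (nbhd \<rho> (ctree (S n)))) \<and>
     (\<forall>(u, v)\<in>gedges (nbhd \<rho> (ctree s)). (\<lambda>n. glen (ctree (S n)) (\<gamma> n u) (\<gamma> n v)) \<longlonglongrightarrow> glen (ctree s) u v)"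
    by (intro exI[of _ \<gamma>]) auto
qed


text \<open>
  Open sets of rooted graphs are defined by sequences, and in the first countable space of codes
  sequences detect open sets.
\<close>

lemma ctree_open_preimage:
  assumes W: "local_open (W :: 'a::euclidean_space rooted_graph set)"
  shows "\<exists>T. open T \<and> {s \<in> configs. ctree s \<in> W} = T \<inter> configs"
proof (intro exI conjI)
  let ?T = "\<Union>{U. open U \<and> (\<forall>x\<in>U \<inter> configs. ctree x \<in> W)}"
  show "open ?T" by blast
  show "{s \<in> configs. ctree s \<in> W} = ?T \<inter> configs"
  proof (intro equalityI subsetI)
    fix s assume s: "s \<in> {s \<in> configs. ctree s \<in> W}"
    have "eventually (\<lambda>x. ctree x \<in> W) (at s within configs)"
    proof (intro sequentially_imp_eventually_within allI impI, elim conjE)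
      fix S assume S: "\<forall>n. S n \<in> configs \<and> S n \<noteq> s" "S \<longlonglongrightarrow> s"
      then have "local_converges (\<lambda>n. ctree (S n)) (ctree s)"
        using ctree_local_converges[OF S(2)] s by blast
      moreover have "\<forall>n. ctree (S n) \<in> geometric_graphs" using S(1) ctree_geometric by blast
      ultimately show "\<forall>\<^sub>F n in sequentially. ctree (S n) \<in> W"
        using W[unfolded local_open_def, THEN conjunct2, rule_format, of "ctree s" "\<lambda>n. ctree (S n)"] s
        by simp
    qed
    then obtain U where "open U" "s \<in> U" "\<forall>x\<in>U. x \<noteq> s \<longrightarrow> x \<in> configs \<longrightarrow> ctree x \<in> W"
      unfolding eventually_at_topological by blast
    then have "U \<in> {U. open U \<and> (\<forall>x\<in>U \<inter> configs. ctree x \<in> W)}" using s by auto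
    then show "s \<in> ?T \<inter> configs" using s \<open>s \<in> U\<close> by auto
  qed auto
qed

lemma measurable_ctree:
  fixes S :: "'b \<Rightarrow> nat \<Rightarrow> 'a::euclidean_space \<times> nat \<times> nat"
  assumes [measurable]: "S \<in> borel_measurable M" and S: "\<And>x. x \<in> space M \<Longrightarrow> S x \<in> configs"
  shows "(\<lambda>x. ctree (S x)) \<in> M \<rightarrow>\<^sub>M local_borel"
  unfolding local_borel_def
proof (rule measurable_measure_of)
  show "{W. openin local_topology W} \<subseteq> Pow (geometric_graphs :: 'a rooted_graph set)"
    using openin_subset topspace_local_topology by blast
  show "(\<lambda>x. ctree (S x)) \<in> space M \<rightarrow> geometric_graphs" using ctree_geometric S by blast
  fix W :: "'a rooted_graph set" assume "W \<in> {W. openin local_topology W}"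
  then obtain T where T: "open T" "{s \<in> configs. ctree s \<in> W} = T \<inter> configs"
    using ctree_open_preimage openin_local_topology by blast
  then have "(\<lambda>x. ctree (S x)) -` W \<inter> space M = S -` T \<inter> space M" using S by blast
  also have "\<dots> \<in> sets M" using T(1) by measurable
  finally show "(\<lambda>x. ctree (S x)) -` W \<inter> space M \<in> sets M" .
qed

lemma continuous_ctree_tendsto:
  fixes g :: "'a::euclidean_space rooted_graph \<Rightarrow> real"
  assumes g: "continuous_map local_topology euclideanreal g"
    and S: "S \<longlonglongrightarrow> s" "\<And>n. S n \<in> configs" and s: "s \<in> configs"
  shows "(\<lambda>n. g (ctree (S n))) \<longlonglongrightarrow> g (ctree s)"
proof (rule topological_tendstoI)
  fix U :: "real set" assume U: "open U" "g (ctree s) \<in> U"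
  have "local_open {x \<in> geometric_graphs. g x \<in> U}"
    using openin_continuous_map_preimage[OF g, of U] U(1)
    by (simp add: openin_local_topology topspace_local_topology)
  moreover have "ctree s \<in> {x \<in> geometric_graphs. g x \<in> U}" using U(2) ctree_geometric[OF s] by simp
  ultimately have "\<forall>\<^sub>F n in sequentially. ctree (S n) \<in> {x \<in> geometric_graphs. g x \<in> U}"
    using ctree_local_converges[OF S s] ctree_geometric[OF S(2)] unfolding local_open_def by simp
  then show "\<forall>\<^sub>F n in sequentially. g (ctree (S n)) \<in> U" by eventually_elim simp
qed

lemma measurable_local_borel_continuous:
  assumes "continuous_map local_topology euclideanreal g"
  shows "g \<in> borel_measurable local_borel"
proof (rule borel_measurableI)
  fix U :: "real set" assume "open U"
  then have "openin local_topology {x \<in> geometric_graphs. g x \<in> U}"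
    using openin_continuous_map_preimage[OF assms, of U] by (simp add: topspace_local_topology)
  moreover have "g -` U \<inter> space local_borel = {x \<in> geometric_graphs. g x \<in> U}"
    by (auto simp: local_borel_def space_measure_of_conv)
  moreover have "{W. openin local_topology W} \<subseteq> Pow (geometric_graphs :: 'a rooted_graph set)"
    using openin_subset topspace_local_topology by blast
  ultimately show "g -` U \<inter> space local_borel \<in> sets local_borel"
    unfolding local_borel_def by (auto simp: sets_measure_of)
qed

section \<open>Locally finite point sets\<close>

definition locfin :: "'a::euclidean_space set set" where
  "locfin = {M. \<forall>R. finite (M \<inter> ball 0 R)}"

definition point_space :: "'a::euclidean_space set measure" where
  "point_space = sigma locfin
     {{M \<in> locfin. card (M \<inter> B) = k} | B k. B \<in> sets borel \<and> bounded B}"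

lemma locfin_finite: "M \<in> locfin \<Longrightarrow> bounded B \<Longrightarrow> finite (M \<inter> B)"
proof -
  assume M: "M \<in> locfin" and "bounded B"
  then obtain R where "B \<subseteq> ball 0 R" using bounded_subset_ballD by blast
  then show ?thesis using M finite_subset[of "M \<inter> B" "M \<inter> ball 0 R"] by (auto simp: locfin_def)
qed

lemma locfin_insert: "M \<in> locfin \<Longrightarrow> insert z M \<in> locfin"
  by (simp add: locfin_def Int_insert_left)

lemma locfin_translate:
  assumes "M \<in> locfin"
  shows "(\<lambda>v. v + z) ` M \<in> locfin"
  unfolding locfin_def
proof clarify
  fix R
  have "(\<lambda>v. v + z) ` M \<inter> ball 0 R \<subseteq> (\<lambda>v. v + z) ` (M \<inter> ball 0 (R + norm z))"
  proof clarsimp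
    fix v assume "v \<in> M" "norm (v + z) < R"
    then have "norm v < R + norm z" using norm_triangle_ineq[of "v + z" "- z"] by simp
    then show "v + z \<in> (\<lambda>v. v + z) ` (M \<inter> ball 0 (R + norm z))" using \<open>v \<in> M\<close> by simp
  qed
  then show "finite ((\<lambda>v. v + z) ` M \<inter> ball 0 R)"
    by (rule finite_subset) (use assms in \<open>simp add: locfin_def\<close>)
qed

lemma locfin_countable: "M \<in> locfin \<Longrightarrow> countable M"
proof -
  assume M: "M \<in> locfin"
  have "M = (\<Union>n::nat. M \<inter> ball 0 (real n))" using reals_Archimedean2 by auto
  moreover have "countable (\<Union>n::nat. M \<inter> ball 0 (real n))"
    using M by (intro countable_UN) (auto simp: locfin_def intro: countable_finite)
  ultimately show ?thesis by simp
qed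

lemma space_point_space: "space point_space = locfin"
  unfolding point_space_def by (rule space_measure_of) auto

lemma measurable_card_Int[measurable]:
  assumes "B \<in> sets borel" "bounded B"
  shows "(\<lambda>M. card (M \<inter> B)) \<in> point_space \<rightarrow>\<^sub>M count_space UNIV"
proof (rule measurable_count_space_eq2_countable[THEN iffD2, OF _], safe)
  fix k
  have "{M \<in> locfin. card (M \<inter> B) = k} \<in> sets point_space"
    unfolding point_space_def by (rule in_measure_of) (use assms in auto)
  also have "{M \<in> locfin. card (M \<inter> B) = k} = (\<lambda>M. card (M \<inter> B)) -` {k} \<inter> space point_space"
    by (auto simp: space_point_space)
  finally show "(\<lambda>M. card (M \<inter> B)) -` {k} \<inter> space point_space \<in> sets point_space" .
qed auto

lemma measurable_point_spaceI:
  assumes "\<And>x. x \<in> space M \<Longrightarrow> F x \<in> locfin"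
    and "\<And>B. B \<in> sets borel \<Longrightarrow> bounded B \<Longrightarrow> (\<lambda>x. card (F x \<inter> B)) \<in> M \<rightarrow>\<^sub>M count_space UNIV"
  shows "F \<in> M \<rightarrow>\<^sub>M point_space"
  unfolding point_space_def
proof (rule measurable_measure_of)
  show "F \<in> space M \<rightarrow> locfin" using assms(1) by blast
  fix A :: "'b set set" assume "A \<in> {{M \<in> locfin. card (M \<inter> B) = k} |B k. B \<in> sets borel \<and> bounded B}"
  then obtain B k where A: "A = {M \<in> locfin. card (M \<inter> B) = k}" "B \<in> sets borel" "bounded B" by blast
  have "F -` A \<inter> space M = (\<lambda>x. card (F x \<inter> B)) -` {k} \<inter> space M" using assms(1) A(1) by auto
  also have "\<dots> \<in> sets M" using assms(2)[OF A(2,3)] by (rule measurable_sets) simp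
  finally show "F -` A \<inter> space M \<in> sets M" .
qed auto

lemma measurable_insert_point: "insert z \<in> point_space \<rightarrow>\<^sub>M point_space"
proof (rule measurable_point_spaceI)
  fix B :: "'a set" assume B: "B \<in> sets borel" "bounded B"
  have "bounded (B - {z})" using B(2) by (rule bounded_subset) auto
  have [measurable]: "(\<lambda>M. card (M \<inter> (B - {z}))) \<in> point_space \<rightarrow>\<^sub>M count_space UNIV"
    using B(1) \<open>bounded (B - {z})\<close> by (intro measurable_card_Int) auto
  have [measurable]: "(\<lambda>M. card (M \<inter> B)) \<in> point_space \<rightarrow>\<^sub>M count_space UNIV"
    using B by (rule measurable_card_Int)
  have "(\<lambda>M. if z \<in> B then card (M \<inter> (B - {z})) + 1 else card (M \<inter> B)) \<in> point_space \<rightarrow>\<^sub>M count_space UNIV"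
    by measurable
  then show "(\<lambda>M. card (insert z M \<inter> B)) \<in> point_space \<rightarrow>\<^sub>M count_space UNIV"
  proof (rule measurable_cong[THEN iffD1, rotated])
    fix M :: "'a set" assume "M \<in> space point_space"
    then have fin: "finite (M \<inter> (B - {z}))" using \<open>bounded (B - {z})\<close> locfin_finite space_point_space by blast
    have "insert z M \<inter> B = (if z \<in> B then insert z (M \<inter> (B - {z})) else M \<inter> B)" by auto
    then show "(if z \<in> B then card (M \<inter> (B - {z})) + 1 else card (M \<inter> B)) = card (insert z M \<inter> B)"
      using fin by (auto simp: card_insert_if)
  qed
qed (simp add: space_point_space locfin_insert)

lemma card_translate_Int: "card ((\<lambda>v. v + z) ` M \<inter> B) = card (M \<inter> (\<lambda>v. v + z) -` (B :: 'a::ab_group_add set))"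
proof -
  have "(\<lambda>v. v + z) ` M \<inter> B = (\<lambda>v. v + z) ` (M \<inter> (\<lambda>v. v + z) -` B)" by auto
  then show ?thesis by (simp add: card_image)
qed

lemma vimage_translate_borel:
  fixes B :: "'a::euclidean_space set"
  assumes "B \<in> sets borel"
  shows "(\<lambda>v. v + z) -` B \<in> sets borel"
  using measurable_sets[of "\<lambda>v. v + z" borel borel B] assms by simp

lemma vimage_translate_bounded:
  fixes B :: "'a::euclidean_space set"
  assumes "bounded B"
  shows "bounded ((\<lambda>v. v + z) -` B)"
proof -
  have "(\<lambda>v. v + z) -` B = (\<lambda>v. - z + v) ` B" by (force simp: image_iff)
  then show ?thesis using bounded_translation[OF assms, of "- z"] by simp
qed

lemma measurable_translate_points: "(\<lambda>M. (\<lambda>v. v + z) ` M) \<in> point_space \<rightarrow>\<^sub>M point_space"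
proof (rule measurable_point_spaceI)
  fix B :: "'a set" assume B: "B \<in> sets borel" "bounded B"
  show "(\<lambda>M. card ((\<lambda>v. v + z) ` M \<inter> B)) \<in> point_space \<rightarrow>\<^sub>M count_space UNIV"
    unfolding card_translate_Int
    by (intro measurable_card_Int vimage_translate_borel vimage_translate_bounded B)
qed (simp add: space_point_space locfin_translate)

section \<open>A measurable enumeration of locally finite sets\<close>

definition dense_pts :: "'a::euclidean_space set" where
  "dense_pts = (SOME D. countable D \<and> (\<forall>X. open X \<longrightarrow> X \<noteq> {} \<longrightarrow> (\<exists>d\<in>D. d \<in> X)))"

lemma dense_pts: "countable (dense_pts :: 'a::euclidean_space set)"
  "open X \<Longrightarrow> X \<noteq> {} \<Longrightarrow> \<exists>d\<in>(dense_pts :: 'a set). d \<in> X"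
  using someI_ex[OF countable_dense_exists[where 'a='a]] unfolding dense_pts_def[symmetric] by blast+

text \<open>
  Countably many bounded sets that isolate the points of every locally finite set.  The first one
  makes sure that the origin, if it is a point, gets index \<open>0\<close>.
\<close>

definition cell :: "nat \<Rightarrow> 'a::euclidean_space set" where
  "cell i = (case i of 0 \<Rightarrow> {0}
     | Suc m \<Rightarrow> ball (from_nat_into dense_pts (fst (prod_decode m))) (1 / Suc (snd (prod_decode m))))"

lemma cell_0: "cell 0 = {0}" by (simp add: cell_def)

lemma cell_borel[measurable]: "cell i \<in> sets borel" by (simp add: cell_def split: nat.split)

lemma cell_bounded: "bounded (cell i)" by (simp add: cell_def split: nat.split)

lemma cell_isolates:
  assumes M: "M \<in> locfin" and x: "(x::'a::euclidean_space) \<in> M"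
  shows "\<exists>i. M \<inter> cell i = {x}"
proof -
  have "finite (M \<inter> ball x 1)" using locfin_finite[OF M] by blast
  then have "finite ((\<lambda>y. dist x y) ` (M \<inter> ball x 1 - {x}))" by simp
  then obtain \<epsilon> where \<epsilon>: "\<epsilon> > 0" "\<And>y. y \<in> M \<inter> ball x 1 - {x} \<Longrightarrow> \<epsilon> < dist x y"
    using finite_set_avoid[of "M \<inter> ball x 1" x] \<open>finite (M \<inter> ball x 1)\<close>
    by (metis DiffE dense field_lbound_gt_zero insertI1 order_less_le_trans)
  define \<delta> where "\<delta> = min \<epsilon> 1"
  obtain n where n: "1 / real (Suc n) < \<delta> / 2" using nat_approx_posE[of "\<delta> / 2"] \<epsilon>(1) unfolding \<delta>_def by auto
  obtain d where d: "d \<in> dense_pts" "d \<in> ball x (1 / real (Suc n))" using dense_pts(2)[of "ball x (1 / real (Suc n))"] by auto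
  obtain m where m: "from_nat_into dense_pts m = d"
    using from_nat_into_surj[OF dense_pts(1) d(1)] by blast
  define i where "i = Suc (prod_encode (m, n))"
  have c: "cell i = ball d (1 / real (Suc n))" unfolding cell_def i_def by (simp add: m)
  have "M \<inter> cell i = {x}"
  proof (intro equalityI subsetI)
    fix y assume y: "y \<in> M \<inter> cell i"
    have "dist x y < \<delta>" using dist_triangle[of x y d] y d(2) n unfolding c by (simp add: dist_commute)
    then show "y \<in> {x}" using \<epsilon>(2)[of y] y unfolding \<delta>_def by auto
  next
    fix y assume "y \<in> {x}"
    then show "y \<in> M \<inter> cell i" using x d(2) unfolding c by (simp add: dist_commute)
  qed
  then show ?thesis by blast
qed

text \<open>
  The index \<open>i\<close> is used if \<open>cell i\<close> contains exactly one point and no earlier cell has isolated the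
  same point.  Both conditions are conditions on counts, hence measurable.
\<close>

definition valid :: "'a::euclidean_space set \<Rightarrow> nat \<Rightarrow> bool" where
  "valid M i \<longleftrightarrow> card (M \<inter> cell i) = 1 \<and>
     (\<forall>j<i. card (M \<inter> cell j) = 1 \<longrightarrow> card (M \<inter> (cell i \<inter> cell j)) \<noteq> 1)"

definition pt :: "'a::euclidean_space set \<Rightarrow> nat \<Rightarrow> 'a" where
  "pt M i = (if card (M \<inter> cell i) = 1 then the_elem (M \<inter> cell i) else 0)"

definition bnd :: "'a::euclidean_space set \<Rightarrow> nat \<Rightarrow> nat" where
  "bnd M R = (LEAST b. \<forall>i\<ge>b. valid M i \<longrightarrow> real R < norm (pt M i))"

lemma pt_eq: "M \<inter> cell i = {x} \<Longrightarrow> pt M i = x" by (simp add: pt_def)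

lemma pt_cell: "card (M \<inter> cell i) = 1 \<Longrightarrow> M \<inter> cell i = {pt M i}"
proof -
  assume "card (M \<inter> cell i) = 1"
  then obtain x where x: "M \<inter> cell i = {x}" by (rule card_1_singletonE)
  show ?thesis unfolding pt_eq[OF x] by (rule x)
qed

lemma valid_pt: "valid M i \<Longrightarrow> M \<inter> cell i = {pt M i}"
  unfolding valid_def by (rule pt_cell) (rule conjunct1)

lemma valid_pt_mem: "valid M i \<Longrightarrow> pt M i \<in> M"
  using valid_pt by blast

lemma inj_on_pt: "inj_on (pt M) {i. valid M i}"
proof -
  have "\<not> pt M i = pt M j" if "valid M i" "valid M j" "j < i" for i j
  proof
    assume "pt M i = pt M j"
    then have "M \<inter> (cell i \<inter> cell j) = {pt M i}" using valid_pt that by blast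
    then have "card (M \<inter> (cell i \<inter> cell j)) = 1" by simp
    then show False using that unfolding valid_def by blast
  qed
  then show ?thesis unfolding inj_on_def by (metis linorder_neqE_nat mem_Collect_eq)
qed

lemma pt_surj:
  assumes M: "M \<in> locfin" and x: "x \<in> M"
  shows "\<exists>i. valid M i \<and> pt M i = x"
proof -
  define i where "i = (LEAST i. M \<inter> cell i = {x})"
  have i: "M \<inter> cell i = {x}" unfolding i_def using LeastI_ex[OF cell_isolates[OF M x]] .
  have less: "M \<inter> cell j \<noteq> {x}" if "j < i" for j using not_less_Least[of j] that unfolding i_def by blast
  have "card (M \<inter> (cell i \<inter> cell j)) \<noteq> 1" if "j < i" "card (M \<inter> cell j) = 1" for j
  proof
    assume "card (M \<inter> (cell i \<inter> cell j)) = 1"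
    then have "M \<inter> (cell i \<inter> cell j) \<noteq> {}" by auto
    moreover have "M \<inter> (cell i \<inter> cell j) = {x} \<inter> cell j" unfolding i[symmetric] by blast
    ultimately have "x \<in> M \<inter> cell j" using i by auto
    then have "x \<in> {pt M j}" unfolding pt_cell[OF that(2)] .
    then have "M \<inter> cell j = {x}" using pt_cell[OF that(2)] by simp
    then show False using less that by blast
  qed
  then have "valid M i" using i by (simp add: valid_def)
  then show ?thesis using pt_eq[OF i] by blast
qed

lemma pt_image: "M \<in> locfin \<Longrightarrow> pt M ` {i. valid M i} = M"
  using pt_surj valid_pt_mem by blast

lemma valid_0: "0 \<in> M \<Longrightarrow> valid M 0 \<and> pt M 0 = 0"
  by (simp add: valid_def pt_def cell_0)

lemma finite_valid_ball:
  assumes "M \<in> locfin"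
  shows "finite {i. valid M i \<and> norm (pt M i) \<le> R}"
proof (rule inj_on_finite)
  show "inj_on (pt M) {i. valid M i \<and> norm (pt M i) \<le> R}" by (rule inj_on_subset[OF inj_on_pt]) auto
  show "pt M ` {i. valid M i \<and> norm (pt M i) \<le> R} \<subseteq> M \<inter> cball 0 R" using valid_pt_mem by auto
qed (simp add: locfin_finite assms)

lemma less_bnd:
  assumes M: "M \<in> locfin" and i: "valid M i" "norm (pt M i) \<le> real R"
  shows "i < bnd M R"
proof -
  obtain b where "\<forall>i\<in>{i. valid M i \<and> norm (pt M i) \<le> real R}. i < b"
    using finite_valid_ball[OF M] finite_nat_set_iff_bounded by blast
  then have "\<exists>b. \<forall>i\<ge>b. valid M i \<longrightarrow> real R < norm (pt M i)"
    by (metis mem_Collect_eq not_le)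
  from LeastI_ex[OF this] have "\<forall>i\<ge>bnd M R. valid M i \<longrightarrow> real R < norm (pt M i)"
    unfolding bnd_def .
  then show ?thesis using i by (meson not_le)
qed

lemma measurable_valid[measurable]: "Measurable.pred point_space (\<lambda>M. valid M i)"
proof -
  have [measurable]: "(\<lambda>M. card (M \<inter> cell j)) \<in> point_space \<rightarrow>\<^sub>M count_space UNIV" for j
    by (intro measurable_card_Int cell_borel cell_bounded)
  have [measurable]: "(\<lambda>M. card (M \<inter> (cell i \<inter> cell j))) \<in> point_space \<rightarrow>\<^sub>M count_space UNIV" for i j
    by (intro measurable_card_Int bounded_Int) (auto intro: cell_bounded)
  show ?thesis unfolding valid_def by measurable
qed

lemma measurable_pt[measurable]: "(\<lambda>M. pt M i) \<in> borel_measurable point_space"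
proof (rule measurableI)
  fix A :: "'a set" assume A[measurable]: "A \<in> sets borel"
  have [measurable]: "(\<lambda>M. card (M \<inter> cell i)) \<in> point_space \<rightarrow>\<^sub>M count_space UNIV"
    by (intro measurable_card_Int cell_borel cell_bounded)
  have [measurable]: "(\<lambda>M. card (M \<inter> (cell i \<inter> A))) \<in> point_space \<rightarrow>\<^sub>M count_space UNIV"
    by (intro measurable_card_Int bounded_Int) (auto intro: cell_bounded)
  have "pt M i \<in> A \<longleftrightarrow> card (M \<inter> (cell i \<inter> A)) = 1" if "card (M \<inter> cell i) = 1" for M
  proof -
    have "M \<inter> (cell i \<inter> A) = (M \<inter> cell i) \<inter> A" by blast
    also have "\<dots> = (if pt M i \<in> A then {pt M i} else {})" unfolding pt_cell[OF that] by simp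
    finally have "M \<inter> (cell i \<inter> A) = (if pt M i \<in> A then {pt M i} else {})" .
    then show ?thesis by auto
  qed
  then have "(\<lambda>M. pt M i) -` A \<inter> space point_space = {M \<in> space point_space.
     if card (M \<inter> cell i) = 1 then card (M \<inter> (cell i \<inter> A)) = 1 else 0 \<in> A}"
    by (auto simp: pt_def)
  also have "\<dots> \<in> sets point_space" by measurable
  finally show "(\<lambda>M. pt M i) -` A \<inter> space point_space \<in> sets point_space" .
qed simp

lemma measurable_bnd[measurable]: "(\<lambda>M. bnd M R) \<in> point_space \<rightarrow>\<^sub>M count_space UNIV"
  unfolding bnd_def by measurable

text \<open>
  Cells and balls are bounded and do not see a point that is far away.
\<close>

lemma eventually_enumeration_insert:
  fixes Z :: "nat \<Rightarrow> 'a::euclidean_space"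
  assumes M: "M \<in> locfin" and Z: "filterlim (\<lambda>n. norm (Z n)) at_top sequentially"
  shows "\<forall>\<^sub>F n in sequentially. valid (insert (Z n) M) i = valid M i \<and> pt (insert (Z n) M) i = pt M i"
    and "\<forall>\<^sub>F n in sequentially. bnd (insert (Z n) M) R = bnd M R"
proof -
  have far: "\<forall>\<^sub>F n in sequentially. Z n \<notin> B" if B: "bounded B" for B
  proof -
    obtain r where "\<forall>x\<in>B. norm x \<le> r" using B bounded_iff by blast
    moreover have "\<forall>\<^sub>F n in sequentially. r < norm (Z n)" using Z unfolding filterlim_at_top_dense by blast
    ultimately show ?thesis by (auto elim!: eventually_mono)
  qed
  have same: "\<forall>\<^sub>F n in sequentially. valid (insert (Z n) M) i = valid M i \<and> pt (insert (Z n) M) i = pt M i" for i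
  proof -
    have "\<forall>\<^sub>F n in sequentially. Z n \<notin> (\<Union>j\<le>i. cell j)" by (intro far bounded_UN) (auto intro: cell_bounded)
    then show ?thesis
    proof eventually_elim
      case (elim n)
      have *: "insert (Z n) M \<inter> cell j = M \<inter> cell j" if "j \<le> i" for j using elim that by auto
      moreover have "insert (Z n) M \<inter> (cell i \<inter> cell j) = M \<inter> (cell i \<inter> cell j)" for j using *[of i] by auto
      ultimately show ?case by (simp add: valid_def pt_def)
    qed
  qed
  then show "\<forall>\<^sub>F n in sequentially. valid (insert (Z n) M) i = valid M i \<and> pt (insert (Z n) M) i = pt M i" .
  let ?I = "\<lambda>M. {i. valid M i \<and> norm (pt M i) \<le> real R}"
  have "\<forall>\<^sub>F n in sequentially. \<forall>i\<in>?I M. valid (insert (Z n) M) i = valid M i \<and> pt (insert (Z n) M) i = pt M i"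
    by (intro eventually_ball_finite finite_valid_ball M ballI same)
  moreover have "\<forall>\<^sub>F n in sequentially. Z n \<notin> cball 0 (real R)" by (intro far bounded_cball)
  ultimately show "\<forall>\<^sub>F n in sequentially. bnd (insert (Z n) M) R = bnd M R"
  proof eventually_elim
    case (elim n)
    have "?I (insert (Z n) M) = ?I M"
    proof (intro equalityI subsetI)
      fix i assume i: "i \<in> ?I (insert (Z n) M)"
      then have "pt (insert (Z n) M) i \<in> M" using valid_pt_mem[of "insert (Z n) M" i] elim(2) by auto
      then obtain j where j: "valid M j" "pt M j = pt (insert (Z n) M) i" using pt_surj[OF M] by blast
      then have "valid (insert (Z n) M) j" "pt (insert (Z n) M) j = pt (insert (Z n) M) i"
        using elim(1) i by auto
      then have "j = i" using i inj_onD[OF inj_on_pt, of "insert (Z n) M" j i] by auto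
      then show "i \<in> ?I M" using j i by auto
    qed (use elim(1) in auto)
    then have "(valid (insert (Z n) M) i \<longrightarrow> real R < norm (pt (insert (Z n) M) i)) \<longleftrightarrow>
       (valid M i \<longrightarrow> real R < norm (pt M i))" for i
      by (auto simp: set_eq_iff not_le[symmetric])
    then show ?case unfolding bnd_def by presburger
  qed
qed

section \<open>The law of a Poisson process\<close>

lemma poisson_locfin: "poisson_point_process r P N \<Longrightarrow> \<omega> \<in> space P \<Longrightarrow> N \<omega> \<in> locfin"
  by (simp add: poisson_point_process_def locfin_def)

lemma poisson_measurable:
  assumes "poisson_point_process r P N"
  shows "N \<in> P \<rightarrow>\<^sub>M point_space"
  by (rule measurable_point_spaceI)
     (use assms in \<open>auto simp: poisson_point_process_def locfin_def\<close>)

lemma poisson_prob_space: "poisson_point_process r P N \<Longrightarrow> prob_space P"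
  by (simp add: poisson_point_process_def)

lemma poisson_count_prob:
  assumes "poisson_point_process r P N" "B \<in> sets borel" "bounded B"
  shows "measure P {\<omega> \<in> space P. card (N \<omega> \<inter> B) = k} =
     (r * measure lborel B) ^ k / fact k * exp (- (r * measure lborel B))"
  using assms by (simp add: poisson_point_process_def)

lemma poisson_indep:
  assumes "poisson_point_process r P N" "\<And>i::nat. B i \<in> sets borel \<and> bounded (B i)" "disjoint_family B"
  shows "prob_space.indep_vars P (\<lambda>_. count_space UNIV) (\<lambda>i \<omega>. card (N \<omega> \<inter> B i)) UNIV"
  using assms by (simp add: poisson_point_process_def)

lemma poisson_count_measurable:
  assumes "poisson_point_process r P N" "B \<in> sets borel" "bounded B"
  shows "(\<lambda>\<omega>. card (N \<omega> \<inter> B)) \<in> P \<rightarrow>\<^sub>M count_space UNIV"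
  using assms by (simp add: poisson_point_process_def)

lemma measure_lborel_translate:
  fixes B :: "'a::euclidean_space set"
  assumes "B \<in> sets borel"
  shows "measure lborel ((\<lambda>v. v + z) -` B) = measure lborel B"
proof -
  have "measure lborel B = measure (distr lborel borel ((+) z)) B" using lborel_distr_plus[of z] by metis
  also have "\<dots> = measure lborel ((+) z -` B)" by (subst measure_distr) (use assms in auto)
  also have "(+) z -` B = (\<lambda>v. v + z) -` B" by (auto simp: add.commute)
  finally show ?thesis by simp
qed

lemma poisson_translate:
  assumes N: "poisson_point_process r P (N :: 'w \<Rightarrow> 'a::euclidean_space set)"
  shows "poisson_point_process r P (\<lambda>\<omega>. (\<lambda>v. v + z) ` N \<omega>)"
  unfolding poisson_point_process_def card_translate_Int
proof (intro conjI ballI allI impI)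
  show "prob_space P" using N poisson_prob_space by blast
  show "finite ((\<lambda>v. v + z) ` N \<omega> \<inter> ball 0 R)" if "\<omega> \<in> space P" for \<omega> R
    using locfin_translate[OF poisson_locfin[OF N that]] by (simp add: locfin_def)
next
  fix B :: "'a set" and k assume B: "B \<in> sets borel" "bounded B"
  let ?B = "(\<lambda>v. v + z) -` B"
  have B': "?B \<in> sets borel" "bounded ?B"
    using B by (auto intro: vimage_translate_borel vimage_translate_bounded)
  then show "(\<lambda>\<omega>. card (N \<omega> \<inter> ?B)) \<in> P \<rightarrow>\<^sub>M count_space UNIV"
    by (rule poisson_count_measurable[OF N])
  show "measure P {\<omega> \<in> space P. card (N \<omega> \<inter> ?B) = k} =
      (r * measure lborel B) ^ k / fact k * exp (- (r * measure lborel B))"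
    using poisson_count_prob[OF N B'] by (simp add: measure_lborel_translate[OF B(1)])
next
  fix B :: "nat \<Rightarrow> 'a set"
  assume B: "(\<forall>i. B i \<in> sets borel \<and> bounded (B i)) \<and> disjoint_family B"
  let ?B = "\<lambda>i. (\<lambda>v. v + z) -` B i"
  have "?B i \<in> sets borel \<and> bounded (?B i)" for i
    using B vimage_translate_borel vimage_translate_bounded by blast
  moreover have "disjoint_family ?B" using B unfolding disjoint_family_on_def by blast
  ultimately show "prob_space.indep_vars P (\<lambda>_. count_space UNIV) (\<lambda>i \<omega>. card (N \<omega> \<inter> ?B i)) UNIV"
    by (rule poisson_indep[OF N])
qed

lemma poisson_count_law:
  assumes N: "poisson_point_process r P N" "poisson_point_process r Q L"
    and B: "B \<in> sets borel" "bounded B"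
  shows "distr P (count_space UNIV) (\<lambda>\<omega>. card (N \<omega> \<inter> B)) = distr Q (count_space UNIV) (\<lambda>\<omega>. card (L \<omega> \<inter> B))"
proof -
  note m = measurable_compose[OF poisson_measurable[OF N(1)] measurable_card_Int[OF B]]
    measurable_compose[OF poisson_measurable[OF N(2)] measurable_card_Int[OF B]]
  interpret P: prob_space P using N poisson_prob_space by blast
  interpret Q: prob_space Q using N poisson_prob_space by blast
  show ?thesis
  proof (rule measure_eqI_countable[where A = UNIV])
    fix k
    have "measure P {\<omega> \<in> space P. card (N \<omega> \<inter> B) = k} = measure Q {\<omega> \<in> space Q. card (L \<omega> \<inter> B) = k}"
      unfolding poisson_count_prob[OF N(1) B] poisson_count_prob[OF N(2) B] ..
    moreover have "(\<lambda>\<omega>. card (N \<omega> \<inter> B)) -` {k} \<inter> space P = {\<omega> \<in> space P. card (N \<omega> \<inter> B) = k}"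
      "(\<lambda>\<omega>. card (L \<omega> \<inter> B)) -` {k} \<inter> space Q = {\<omega> \<in> space Q. card (L \<omega> \<inter> B) = k}" by auto
    ultimately show "emeasure (distr P (count_space UNIV) (\<lambda>\<omega>. card (N \<omega> \<inter> B))) {k} =
        emeasure (distr Q (count_space UNIV) (\<lambda>\<omega>. card (L \<omega> \<inter> B))) {k}"
      using m by (simp add: emeasure_distr P.emeasure_eq_measure Q.emeasure_eq_measure)
  qed auto
qed

lemma poisson_joint_law:
  assumes N: "poisson_point_process r P N" "poisson_point_process r Q L"
    and D: "\<And>n::nat. D n \<in> sets borel \<and> bounded (D n)" "disjoint_family D"
  shows "distr P (PiM UNIV (\<lambda>_. count_space UNIV)) (\<lambda>\<omega> n. card (N \<omega> \<inter> D n)) =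
     distr Q (PiM UNIV (\<lambda>_. count_space UNIV)) (\<lambda>\<omega> n. card (L \<omega> \<inter> D n))"
proof -
  interpret P: prob_space P using N poisson_prob_space by blast
  interpret Q: prob_space Q using N poisson_prob_space by blast
  have "P.indep_vars (\<lambda>_. count_space UNIV) (\<lambda>n \<omega>. card (N \<omega> \<inter> D n)) UNIV"
    "Q.indep_vars (\<lambda>_. count_space UNIV) (\<lambda>n \<omega>. card (L \<omega> \<inter> D n)) UNIV"
    using poisson_indep[OF N(1) D] poisson_indep[OF N(2) D] by blast+
  moreover have "(\<lambda>\<omega>. card (N \<omega> \<inter> D n)) \<in> P \<rightarrow>\<^sub>M count_space UNIV"
    "(\<lambda>\<omega>. card (L \<omega> \<inter> D n)) \<in> Q \<rightarrow>\<^sub>M count_space UNIV" for n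
    using poisson_count_measurable[OF N(1), of "D n"] poisson_count_measurable[OF N(2), of "D n"] D(1)[of n]
    by blast+
  ultimately show ?thesis
    using P.indep_vars_iff_distr_eq_PiM[where I = UNIV and M' = "\<lambda>_. count_space UNIV" and X = "\<lambda>n \<omega>. card (N \<omega> \<inter> D n)"]
      Q.indep_vars_iff_distr_eq_PiM[where I = UNIV and M' = "\<lambda>_. count_space UNIV" and X = "\<lambda>n \<omega>. card (L \<omega> \<inter> D n)"]
      poisson_count_law[OF N] D(1) by (simp add: restrict_UNIV)
qed

text \<open>
  The atom of a point \<open>x\<close> is determined by the set of all \<open>i\<close> with \<open>x \<in> B i\<close>, encoded as a number.
\<close>

lemma atoms:
  fixes B :: "nat \<Rightarrow> 'a::euclidean_space set"
  assumes B: "\<And>i. i < m \<Longrightarrow> B i \<in> sets borel \<and> bounded (B i)"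
  obtains D :: "nat \<Rightarrow> 'a set" and A :: "nat \<Rightarrow> nat set" where
    "\<And>n. D n \<in> sets borel \<and> bounded (D n)" "disjoint_family D" "\<And>i. finite (A i)"
    "\<And>i. i < m \<Longrightarrow> B i = (\<Union>n\<in>A i. D n)"
proof
  let ?code = "\<lambda>x. set_encode {i \<in> {..<m}. x \<in> B i}"
  let ?D = "\<lambda>n. (\<Union>i<m. B i) \<inter> ?code -` {n}"
  let ?A = "\<lambda>i. set_encode ` {S \<in> Pow {..<m}. i \<in> S}"
  have code: "?code = (\<lambda>x. \<Sum>i<m. if x \<in> B i then 2 ^ i else 0)"
    by (intro ext, unfold set_encode_def, subst sum.inter_filter) auto
  have [measurable]: "B i \<in> sets borel" if "i < m" for i using B that by blast
  have code_meas: "?code \<in> borel \<rightarrow>\<^sub>M count_space UNIV"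
    unfolding code using B by measurable
  show "?D n \<in> sets borel \<and> bounded (?D n)" for n
  proof
    have "?code -` {n} \<inter> space borel \<in> sets borel" by (rule measurable_sets[OF code_meas]) simp
    then have "?code -` {n} \<in> sets borel" by simp
    then show "?D n \<in> sets borel" using B by (intro sets.Int sets.finite_UN) auto
    have "bounded (\<Union>i<m. B i)" using B by auto
    then show "bounded (?D n)" by (rule bounded_subset) auto
  qed
  show "disjoint_family ?D" by (auto simp: disjoint_family_on_def)
  show "finite (?A i)" for i by simp
  show "B i = (\<Union>n\<in>?A i. ?D n)" if "i < m" for i
  proof (intro equalityI subsetI)
    fix x assume "x \<in> B i"
    then have "?code x \<in> ?A i" "x \<in> ?D (?code x)" using that by auto
    then show "x \<in> (\<Union>n\<in>?A i. ?D n)" by blast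
  next
    fix x assume "x \<in> (\<Union>n\<in>?A i. ?D n)"
    then obtain S where S: "S \<subseteq> {..<m}" "i \<in> S" "?code x = set_encode S" by auto
    have "finite S" using S(1) finite_subset by blast
    have "{i \<in> {..<m}. x \<in> B i} = set_decode (?code x)" by simp
    also have "\<dots> = S" unfolding S(3) using \<open>finite S\<close> by simp
    finally show "x \<in> B i" using S(2) by blast
  qed
qed

text \<open>
  The law is characterised by its finite dimensional distributions: counts of arbitrary bounded sets
  are sums of counts of disjoint atoms, whose joint law is a product of Poisson laws.
\<close>

lemma poisson_law_unique:
  assumes N: "poisson_point_process r P (N :: 'w \<Rightarrow> 'a::euclidean_space set)"
    "poisson_point_process r Q (L :: 'v \<Rightarrow> 'a set)"
  shows "distr P point_space N = distr Q point_space L"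
proof -
  interpret P: prob_space P using N poisson_prob_space by blast
  interpret Q: prob_space Q using N poisson_prob_space by blast
  note Nm[measurable] = poisson_measurable[OF N(1)] and Lm[measurable] = poisson_measurable[OF N(2)]
  define E where "E = {{M \<in> locfin. \<forall>i<m. card (M \<inter> B i) = k i} | (m::nat) (B :: nat \<Rightarrow> 'a set) (k :: nat \<Rightarrow> nat).
     \<forall>i<m. B i \<in> sets borel \<and> bounded (B i)}"
  have E_sets: "A \<in> sets point_space" if "A \<in> E" for A
  proof -
    obtain m B k where A: "A = {M \<in> locfin. \<forall>i<(m::nat). card (M \<inter> B i) = k i}"
      "\<And>i. i < m \<Longrightarrow> B i \<in> sets borel \<and> bounded (B i)" using \<open>A \<in> E\<close> unfolding E_def by blast
    have "{M \<in> space point_space. \<forall>i\<in>{..<m}. card (M \<inter> B i) = k i} \<in> sets point_space"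
    proof (rule sets.sets_Collect_finite_All)
      fix i assume "i \<in> {..<m}"
      then have "(\<lambda>M. card (M \<inter> B i)) -` {k i} \<inter> space point_space \<in> sets point_space"
        using A(2)[of i] by (intro measurable_sets[OF measurable_card_Int]) auto
      moreover have "(\<lambda>M. card (M \<inter> B i)) -` {k i} \<inter> space point_space
          = {M \<in> space point_space. card (M \<inter> B i) = k i}" by blast
      ultimately show "{M \<in> space point_space. card (M \<inter> B i) = k i} \<in> sets point_space" by simp
    qed auto
    moreover have "A = {M \<in> space point_space. \<forall>i\<in>{..<m}. card (M \<inter> B i) = k i}"
      unfolding A(1) space_point_space by auto
    ultimately show ?thesis by (simp only:)
  qed
  have "locfin \<in> E" unfolding E_def by (rule CollectI, rule exI[of _ 0]) auto
  show ?thesis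
  proof (rule measure_eqI_generator_eq[where \<Omega> = locfin and E = E and A = "\<lambda>_. locfin"])
    show "Int_stable E"
    proof (rule Int_stableI)
      fix a b assume "a \<in> E" "b \<in> E"
      then obtain m1 B1 k1 m2 B2 k2 where
        ab: "a = {M \<in> locfin. \<forall>i<(m1::nat). card (M \<inter> B1 i) = k1 i}" "\<forall>i<m1. B1 i \<in> sets borel \<and> bounded (B1 i)"
          "b = {M \<in> locfin. \<forall>i<(m2::nat). card (M \<inter> B2 i) = k2 i}" "\<forall>i<m2. B2 i \<in> sets borel \<and> bounded (B2 i)"
        unfolding E_def by blast
      let ?B = "\<lambda>i. if i < m1 then B1 i else B2 (i - m1)"
      let ?k = "\<lambda>i. if i < m1 then k1 i else k2 (i - m1)"
      have *: "(\<forall>i<m1 + m2. if i < m1 then R i else S (i - m1)) \<longleftrightarrow> (\<forall>i<m1. R i) \<and> (\<forall>i<m2. S i)" for R S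
      proof safe
        fix i assume "\<forall>i<m1 + m2. if i < m1 then R i else S (i - m1)" "i < m2"
        then show "S i" by (auto dest: spec[of _ "m1 + i"])
      next
        fix i assume "\<forall>i<m1 + m2. if i < m1 then R i else S (i - m1)" "i < m1"
        then show "R i" by (auto dest: spec[of _ "i"])
      qed auto
      have eq: "card (M \<inter> ?B i) = ?k i \<longleftrightarrow>
        (if i < m1 then card (M \<inter> B1 i) = k1 i else card (M \<inter> B2 (i - m1)) = k2 (i - m1))" for M i by simp
      have "(\<forall>i<m1 + m2. card (M \<inter> ?B i) = ?k i) \<longleftrightarrow>
        (\<forall>i<m1. card (M \<inter> B1 i) = k1 i) \<and> (\<forall>i<m2. card (M \<inter> B2 i) = k2 i)" for M
        unfolding eq by (rule *)
      then have "a \<inter> b = {M \<in> locfin. \<forall>i<m1 + m2. card (M \<inter> ?B i) = ?k i}"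
        unfolding ab(1,3) by (simp only:) blast
      moreover have "\<forall>i<m1 + m2. ?B i \<in> sets borel \<and> bounded (?B i)" using ab(2,4) by auto
      ultimately show "a \<inter> b \<in> E" unfolding E_def
        by (intro CollectI exI[of _ "m1 + m2"] exI[of _ ?B] exI[of _ ?k] conjI)
    qed
    show "E \<subseteq> Pow locfin" unfolding E_def by blast
    have "sigma_sets locfin E = sets point_space"
    proof
      show "sigma_sets locfin E \<subseteq> sets point_space"
        unfolding space_point_space[symmetric] by (rule sets.sigma_sets_subset) (use E_sets in blast)
      have "{{M \<in> locfin. card (M \<inter> B) = k} | B k. B \<in> sets borel \<and> bounded B} \<subseteq> E"
      proof safe
        fix B :: "'a set" and k assume "B \<in> sets borel" "bounded B"
        then show "{M \<in> locfin. card (M \<inter> B) = k} \<in> E"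
          unfolding E_def by (intro CollectI exI[of _ 1] exI[of _ "\<lambda>_. B"] exI[of _ "\<lambda>_. k"]) auto
      qed
      then have "sigma_sets locfin {{M \<in> locfin. card (M \<inter> B) = k} | B k. B \<in> sets borel \<and> bounded B}
          \<subseteq> sigma_sets locfin E" by (rule sigma_sets_mono')
      moreover have "sets (point_space :: 'a set measure) = sigma_sets locfin {{M \<in> locfin. card (M \<inter> B) = k} | B k. B \<in> sets borel \<and> bounded B}"
        unfolding point_space_def by (rule sets_measure_of) auto
      ultimately show "sets point_space \<subseteq> sigma_sets locfin E" by (simp only:)
    qed
    then show "sets (distr P point_space N) = sigma_sets locfin E"
      "sets (distr Q point_space L) = sigma_sets locfin E" by simp_all
    show "range (\<lambda>_. locfin) \<subseteq> E" using \<open>locfin \<in> E\<close> by blast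
    show "emeasure (distr P point_space N) locfin \<noteq> \<infinity>"
      by (simp add: emeasure_distr E_sets \<open>locfin \<in> E\<close>)
  next
    fix X assume "X \<in> E"
    then obtain m B k where X: "X = {M \<in> locfin. \<forall>i<(m::nat). card (M \<inter> B i) = k i}"
      "\<And>i. i < m \<Longrightarrow> B i \<in> sets borel \<and> bounded (B i)" unfolding E_def by blast
    obtain D :: "nat \<Rightarrow> 'a set" and A where D: "\<And>n. D n \<in> sets borel \<and> bounded (D n)" "disjoint_family D" "\<And>i. finite (A i)"
      "\<And>i. i < m \<Longrightarrow> B i = (\<Union>n\<in>A i. D n)" by (rule atoms[of m B, OF X(2)]) (assumption, rule that, assumption+)
    define V where "V = {v :: nat \<Rightarrow> nat. \<forall>i<m. (\<Sum>n\<in>A i. v n) = k i}"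
    have V: "V \<in> sets (PiM UNIV (\<lambda>_. count_space UNIV))"
    proof -
      have [measurable]: "(\<lambda>v. v n) \<in> PiM UNIV (\<lambda>_. count_space UNIV) \<rightarrow>\<^sub>M count_space UNIV" for n :: nat
        by (rule measurable_component_singleton) simp
      have "{v \<in> space (PiM UNIV (\<lambda>_::nat. count_space (UNIV::nat set))). \<forall>i<m. (\<Sum>n\<in>A i. v n) = k i}
          \<in> sets (PiM UNIV (\<lambda>_::nat. count_space UNIV))" by measurable
      then show ?thesis by (simp add: V_def space_PiM)
    qed
    have card: "card (M \<inter> B i) = (\<Sum>n\<in>A i. card (M \<inter> D n))" if "M \<in> locfin" "i < m" for M i
    proof -
      have "M \<inter> B i = (\<Union>n\<in>A i. M \<inter> D n)" using D(4)[OF that(2)] by blast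
      moreover have "card (\<Union>n\<in>A i. M \<inter> D n) = (\<Sum>n\<in>A i. card (M \<inter> D n))"
        using D(1,2,3) locfin_finite[OF that(1)] by (intro card_UN_disjoint) (auto simp: disjoint_family_on_def)
      ultimately show ?thesis by simp
    qed
    have *: "emeasure (distr R point_space K) X =
       emeasure (distr R (PiM UNIV (\<lambda>_. count_space UNIV)) (\<lambda>\<omega> n. card (K \<omega> \<inter> D n))) V"
      if [measurable]: "K \<in> R \<rightarrow>\<^sub>M point_space" for R :: "'x measure" and K
    proof -
      have m: "(\<lambda>\<omega> n. card (K \<omega> \<inter> D n)) \<in> R \<rightarrow>\<^sub>M PiM UNIV (\<lambda>_. count_space UNIV)"
      proof (rule measurable_PiM_single')
        show "(\<lambda>\<omega>. card (K \<omega> \<inter> D n)) \<in> R \<rightarrow>\<^sub>M count_space UNIV" for n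
          using D(1)[of n] by (intro measurable_compose[OF that measurable_card_Int]) auto
      qed (simp add: space_PiM)
      have loc: "\<omega> \<in> space R \<Longrightarrow> K \<omega> \<in> locfin" for \<omega>
        using measurable_space[OF that] space_point_space by blast
      have "K -` X \<inter> space R = (\<lambda>\<omega> n. card (K \<omega> \<inter> D n)) -` V \<inter> space R"
        using card[OF loc] loc unfolding X(1) V_def by auto
      then show ?thesis using m V E_sets[OF \<open>X \<in> E\<close>] by (simp add: emeasure_distr)
    qed
    show "emeasure (distr P point_space N) X = emeasure (distr Q point_space L) X"
      unfolding *[OF Nm] *[OF Lm] poisson_joint_law[OF N D(1,2)] ..
  qed auto
qed

section \<open>The navigation probabilities\<close>

text \<open>
  The probability that \<open>X\<close> has no neighbour in \<open>S\<close>: the infimum over finite subsets is the infinite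
  product of the factors \<open>1 - f (dist X Y)\<close>.
\<close>

definition miss :: "(real \<Rightarrow> real) \<Rightarrow> 'a::euclidean_space \<Rightarrow> 'a set \<Rightarrow> real" where
  "miss f X S = (INF F\<in>{F. finite F \<and> F \<subseteq> S}. \<Prod>Y\<in>F. 1 - f (dist X Y))"

text \<open>
  Both navigations choose the neighbour with the largest value of a key \<open>\<kappa>\<close>: minus the distance to
  the target, or the scalar product with the direction.  The point \<open>Y\<close> is chosen if it is a neighbour
  and nothing of at least the same height is.
\<close>

definition hit :: "(real \<Rightarrow> real) \<Rightarrow> ('a::euclidean_space \<Rightarrow> real) \<Rightarrow> 'a set \<Rightarrow> 'a \<Rightarrow> 'a \<Rightarrow> real" where
  "hit f \<kappa> M X Y = f (dist X Y) * miss f X {Z \<in> M. Z \<noteq> X \<and> Z \<noteq> Y \<and> \<kappa> Y \<le> \<kappa> Z}"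

definition up_prob :: "(real \<Rightarrow> real) \<Rightarrow> ('a::euclidean_space \<Rightarrow> real) \<Rightarrow> 'a set \<Rightarrow> 'a \<Rightarrow> real" where
  "up_prob f \<kappa> M X = 1 - miss f X {Z \<in> M. \<kappa> X < \<kappa> Z}"

text \<open>
  The probability of choosing \<open>Y\<close>, conditioned on having a neighbour above \<open>X\<close>.  If that event is
  null, \<^const>\<open>conditioned\<close> leaves the law unchanged.
\<close>

definition navp :: "(real \<Rightarrow> real) \<Rightarrow> ('a::euclidean_space \<Rightarrow> real) \<Rightarrow> 'a set \<Rightarrow> 'a \<Rightarrow> 'a \<Rightarrow> real" where
  "navp f \<kappa> M X Y =
     (if Y \<notin> M \<or> Y = X then 0
      else if up_prob f \<kappa> M X = 0 then hit f \<kappa> M X Y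
      else if \<kappa> X < \<kappa> Y then hit f \<kappa> M X Y / up_prob f \<kappa> M X else 0)"

definition key_nav :: "(real \<Rightarrow> real) \<Rightarrow> ('a::euclidean_space \<Rightarrow> real) \<Rightarrow> 'a set \<Rightarrow> 'a \<Rightarrow> ('a \<Rightarrow> real) \<Rightarrow> 'a" where
  "key_nav f \<kappa> M X u = unique_or X (is_arg_max \<kappa> (\<lambda>Y. Y \<in> M \<and> Y \<noteq> X \<and> u Y \<le> f (dist X Y)))"

definition key_row :: "(real \<Rightarrow> real) \<Rightarrow> ('a::euclidean_space \<Rightarrow> real) \<Rightarrow> 'a set \<Rightarrow> 'a \<Rightarrow> ('a \<Rightarrow> real) measure" where
  "key_row f \<kappa> M X = conditioned (row_law M X) (has_neighbour_in f M X {Y. \<kappa> X < \<kappa> Y})"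

text \<open>
  Summability of a nonnegative function over a set of points.
\<close>

definition bounded_sums :: "('a \<Rightarrow> real) \<Rightarrow> 'a set \<Rightarrow> bool" where
  "bounded_sums g M \<longleftrightarrow> (\<exists>C. \<forall>F. finite F \<and> F \<subseteq> M \<longrightarrow> sum g F \<le> C)"

lemma bounded_sums_tail:
  assumes "bounded_sums g M" "\<epsilon> > 0"
  shows "\<exists>F0. finite F0 \<and> F0 \<subseteq> M \<and> (\<forall>F. finite F \<and> F \<subseteq> M - F0 \<longrightarrow> sum g F \<le> \<epsilon>)"
proof -
  let ?\<F> = "{F. finite F \<and> F \<subseteq> M}"
  obtain C where C: "\<And>F. F \<in> ?\<F> \<Longrightarrow> sum g F \<le> C" using assms(1) by (auto simp: bounded_sums_def)
  have bdd: "bdd_above (sum g ` ?\<F>)" using C by (auto intro!: bdd_aboveI)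
  have "(SUP F\<in>?\<F>. sum g F) - \<epsilon> < (SUP F\<in>?\<F>. sum g F)" using assms(2) by simp
  then obtain F0 where F0: "F0 \<in> ?\<F>" "(SUP F\<in>?\<F>. sum g F) - \<epsilon> < sum g F0"
    using less_cSUP_iff[OF _ bdd] by (metis (no_types, lifting) empty_subsetI empty_iff finite.emptyI mem_Collect_eq)
  have "sum g F \<le> \<epsilon>" if F: "finite F" "F \<subseteq> M - F0" for F
  proof -
    have "sum g (F \<union> F0) \<le> (SUP F\<in>?\<F>. sum g F)" using F F0(1) by (intro cSUP_upper bdd) auto
    moreover have "sum g (F \<union> F0) = sum g F + sum g F0" using F F0(1) by (intro sum.union_disjoint) auto
    ultimately show ?thesis using F0(2) by simp
  qed
  then show ?thesis using F0(1) by (intro exI[of _ F0]) simp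
qed

locale connection =
  fixes f :: "real \<Rightarrow> real"
  assumes f_range: "0 \<le> t \<Longrightarrow> f t \<in> {0..1}"
begin

lemma f01: "0 \<le> f (dist X Y)" "f (dist X Y) \<le> 1"
  using f_range[of "dist X Y"] by auto

lemma prod01: "0 \<le> (\<Prod>Y\<in>F. 1 - f (dist X Y))" "(\<Prod>Y\<in>F. 1 - f (dist X Y)) \<le> 1"
  using f01 by (auto intro!: prod_nonneg prod_le_1)

lemma miss_le: "finite F \<Longrightarrow> F \<subseteq> S \<Longrightarrow> miss f X S \<le> (\<Prod>Y\<in>F. 1 - f (dist X Y))"
  unfolding miss_def by (rule cINF_lower) (auto intro!: bdd_belowI prod01(1))

lemma miss_greatest:
  assumes "\<And>F. finite F \<Longrightarrow> F \<subseteq> S \<Longrightarrow> c \<le> (\<Prod>Y\<in>F. 1 - f (dist X Y))"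
  shows "c \<le> miss f X S"
  unfolding miss_def by (rule cINF_greatest) (use assms in auto)

lemma miss01: "0 \<le> miss f X S" "miss f X S \<le> 1"
  using miss_greatest[of S 0 X] prod01(1) miss_le[of "{}" S X] by auto

text \<open>
  By the Weierstrass inequality, a set of total weight \<open>\<epsilon>\<close> contributes a factor of at least \<open>1 - \<epsilon>\<close>.
\<close>

lemma miss_le_add:
  assumes "\<And>F. finite F \<Longrightarrow> F \<subseteq> S' - S \<Longrightarrow> (\<Sum>Y\<in>F. f (dist X Y)) \<le> \<epsilon>"
  shows "miss f X S \<le> miss f X S' + \<epsilon>"
proof -
  have "miss f X S - \<epsilon> \<le> (\<Prod>Y\<in>F. 1 - f (dist X Y))" if F: "finite F" "F \<subseteq> S'" for F
  proof -
    let ?p = "\<lambda>F. \<Prod>Y\<in>F. 1 - f (dist X Y)"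
    have "?p F = ?p (F \<inter> S) * ?p (F - S)"
      using F(1) prod.union_disjoint[of "F \<inter> S" "F - S" "\<lambda>Y. 1 - f (dist X Y)"]
      by (simp add: Int_Diff_disjoint Int_Diff_Un)
    moreover have "1 - \<epsilon> \<le> ?p (F - S)"
    proof -
      have "1 - (\<Sum>Y\<in>F - S. f (dist X Y)) \<le> ?p (F - S)"
        by (rule Weierstrass_prod_ineq) (use f01 in auto)
      moreover have "(\<Sum>Y\<in>F - S. f (dist X Y)) \<le> \<epsilon>" using F by (intro assms) auto
      ultimately show ?thesis by linarith
    qed
    moreover have "?p (F \<inter> S) * (1 - ?p (F - S)) \<le> 1 * (1 - ?p (F - S))"
      by (rule mult_right_mono) (use prod01[of X] in auto)
    moreover have "miss f X S \<le> ?p (F \<inter> S)" using F by (intro miss_le) auto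
    ultimately show ?thesis by (simp add: algebra_simps)
  qed
  then have "miss f X S - \<epsilon> \<le> miss f X S'" by (rule miss_greatest)
  then show ?thesis by simp
qed

text \<open>
  Dominated convergence for products.  Up to a set of small weight, \<open>M\<close> is finite, and there the sets
  \<open>Sn n\<close> and \<open>S\<close> eventually agree; the moving point contributes \<open>f (dist X (Z n))\<close>.
\<close>

lemma miss_tendsto:
  assumes sums: "bounded_sums (\<lambda>Y. f (dist X Y)) M"
    and S: "S \<subseteq> M" "\<And>n. Sn n \<subseteq> insert (Z n) M"
    and Z: "(\<lambda>n. f (dist X (Z n))) \<longlonglongrightarrow> 0"
    and ev: "\<And>Y. Y \<in> M \<Longrightarrow> \<forall>\<^sub>F n in sequentially. Y \<in> Sn n \<longleftrightarrow> Y \<in> S"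
  shows "(\<lambda>n. miss f X (Sn n)) \<longlonglongrightarrow> miss f X S"
proof (rule tendstoI)
  fix \<epsilon> :: real assume "\<epsilon> > 0"
  obtain F0 where F0: "finite F0" "F0 \<subseteq> M" "\<And>F. finite F \<Longrightarrow> F \<subseteq> M - F0 \<Longrightarrow> (\<Sum>Y\<in>F. f (dist X Y)) \<le> \<epsilon> / 3"
    using bounded_sums_tail[OF sums, of "\<epsilon> / 3"] \<open>\<epsilon> > 0\<close> by auto
  have "\<forall>\<^sub>F n in sequentially. \<forall>Y\<in>F0. Y \<in> Sn n \<longleftrightarrow> Y \<in> S"
    using F0 ev by (intro eventually_ball_finite) auto
  moreover have "\<forall>\<^sub>F n in sequentially. f (dist X (Z n)) < \<epsilon> / 3"
    using order_tendstoD(2)[OF Z, of "\<epsilon> / 3"] \<open>\<epsilon> > 0\<close> by simp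
  ultimately show "\<forall>\<^sub>F n in sequentially. dist (miss f X (Sn n)) (miss f X S) < \<epsilon>"
  proof eventually_elim
    case (elim n)
    have small: "(\<Sum>Y\<in>F. f (dist X Y)) \<le> 2 * \<epsilon> / 3" if F: "finite F" "F \<subseteq> insert (Z n) (M - F0)" for F
    proof -
      have "(\<Sum>Y\<in>F. f (dist X Y)) \<le> (\<Sum>Y\<in>insert (Z n) (F - {Z n}). f (dist X Y))"
        using F f01 by (intro sum_mono2) auto
      also have "\<dots> = f (dist X (Z n)) + (\<Sum>Y\<in>F - {Z n}. f (dist X Y))" by (subst sum.insert) (use F in auto)
      also have "(\<Sum>Y\<in>F - {Z n}. f (dist X Y)) \<le> \<epsilon> / 3" using F by (intro F0(3)) auto
      finally show ?thesis using elim(2) by linarith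
    qed
    have "S - Sn n \<subseteq> insert (Z n) (M - F0)" "Sn n - S \<subseteq> insert (Z n) (M - F0)"
      using S(1) S(2)[of n] elim(1) by auto
    then have "miss f X S \<le> miss f X (Sn n) + 2 * \<epsilon> / 3" "miss f X (Sn n) \<le> miss f X S + 2 * \<epsilon> / 3"
      using small by (intro miss_le_add; blast)+
    then show ?case using \<open>\<epsilon> > 0\<close> by (auto simp: dist_real_def)
  qed
qed

lemma miss_exhaust:
  assumes F: "incseq F" "\<And>n. finite (F n)" "(\<Union>n. F n) = S"
  shows "(\<lambda>n. \<Prod>Y\<in>F n. 1 - f (dist X Y)) \<longlonglongrightarrow> miss f X S"
proof (rule tendstoI)
  fix \<epsilon> :: real assume "\<epsilon> > 0"
  have le: "miss f X S \<le> (\<Prod>Y\<in>F n. 1 - f (dist X Y))" for n using F by (intro miss_le) auto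
  have "\<not> miss f X S + \<epsilon> / 2 \<le> miss f X S" using \<open>\<epsilon> > 0\<close> by simp
  then obtain G where G: "finite G" "G \<subseteq> S" "(\<Prod>Y\<in>G. 1 - f (dist X Y)) < miss f X S + \<epsilon> / 2"
    using miss_greatest[of S "miss f X S + \<epsilon> / 2" X] by (meson not_le)
  have "\<exists>n0. G \<subseteq> F n0" using G(1,2)
  proof (induction G)
    case (insert Y G)
    then obtain n0 n1 where "G \<subseteq> F n0" "Y \<in> F n1" unfolding F(3)[symmetric] by blast
    then have "insert Y G \<subseteq> F (max n0 n1)"
      using incseqD[OF F(1), of n0 "max n0 n1"] incseqD[OF F(1), of n1 "max n0 n1"] by auto
    then show ?case by blast
  qed simp
  then obtain n0 where n0: "G \<subseteq> F n0" by blast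
  show "\<forall>\<^sub>F n in sequentially. dist (\<Prod>Y\<in>F n. 1 - f (dist X Y)) (miss f X S) < \<epsilon>"
    using eventually_ge_at_top[of n0]
  proof eventually_elim
    case (elim n)
    have "G \<subseteq> F n" using n0 F(1) elim unfolding incseq_def by blast
    then have "F n = G \<union> (F n - G)" by blast
    then have "(\<Prod>Y\<in>F n. 1 - f (dist X Y)) = (\<Prod>Y\<in>G. 1 - f (dist X Y)) * (\<Prod>Y\<in>F n - G. 1 - f (dist X Y))"
      using prod.union_disjoint[of G "F n - G" "\<lambda>Y. 1 - f (dist X Y)"] G F(2)[of n] by auto
    also have "\<dots> \<le> (\<Prod>Y\<in>G. 1 - f (dist X Y)) * 1" using prod01[of X] by (intro mult_left_mono) auto
    finally show ?case using G(3) le[of n] \<open>\<epsilon> > 0\<close> by (auto simp: dist_real_def)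
  qed
qed

lemma hit_nonneg: "0 \<le> hit f \<kappa> M X Y" by (simp add: hit_def f01 miss01)

lemma up_prob_nonneg: "0 \<le> up_prob f \<kappa> M X" using miss01 by (simp add: up_prob_def)

lemma navp_nonneg: "0 \<le> navp f \<kappa> M X Y"
  by (simp add: navp_def hit_nonneg up_prob_nonneg)

lemma up_prob_pos:
  assumes "Z \<in> M" "\<kappa> X < \<kappa> Z" "0 < f (dist X Z)"
  shows "0 < up_prob f \<kappa> M X"
  using miss_le[of "{Z}" "{Z \<in> M. \<kappa> X < \<kappa> Z}" X] assms by (simp add: up_prob_def)

text \<open>
  The conditioning keeps a positive probability, so it is enough that the products in \<open>hit\<close> and
  \<open>up_prob\<close> converge; for this, only the order of the keys of any two points has to stabilise.
\<close>

lemma navp_tendsto: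
  assumes sums: "bounded_sums (\<lambda>Y. f (dist X Y)) M"
    and XY: "X \<in> M" "Y \<in> M"
    and Z: "(\<lambda>n. f (dist X (Z n))) \<longlonglongrightarrow> 0"
    and ev: "\<And>Y1 Y2. Y1 \<in> M \<Longrightarrow> Y2 \<in> M \<Longrightarrow> \<forall>\<^sub>F n in sequentially. \<kappa>n n Y1 < \<kappa>n n Y2 \<longleftrightarrow> \<kappa> Y1 < \<kappa> Y2"
    and pos: "0 < up_prob f \<kappa> M X"
  shows "(\<lambda>n. navp f (\<kappa>n n) (insert (Z n) M) X Y) \<longlonglongrightarrow> navp f \<kappa> M X Y"
proof (cases "Y = X")
  case False
  have up: "(\<lambda>n. up_prob f (\<kappa>n n) (insert (Z n) M) X) \<longlonglongrightarrow> up_prob f \<kappa> M X"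
    unfolding up_prob_def
  proof (intro tendsto_diff tendsto_const miss_tendsto[OF sums _ _ Z])
    show "\<forall>\<^sub>F n in sequentially. W \<in> {W \<in> insert (Z n) M. \<kappa>n n X < \<kappa>n n W} \<longleftrightarrow> W \<in> {W \<in> M. \<kappa> X < \<kappa> W}"
      if W: "W \<in> M" for W
      using ev[OF XY(1) W] by eventually_elim (use W in auto)
  qed auto
  have hit: "(\<lambda>n. hit f (\<kappa>n n) (insert (Z n) M) X Y) \<longlonglongrightarrow> hit f \<kappa> M X Y"
    unfolding hit_def
  proof (intro tendsto_mult tendsto_const miss_tendsto[OF sums _ _ Z])
    show "\<forall>\<^sub>F n in sequentially. W \<in> {W \<in> insert (Z n) M. W \<noteq> X \<and> W \<noteq> Y \<and> \<kappa>n n Y \<le> \<kappa>n n W}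
        \<longleftrightarrow> W \<in> {W \<in> M. W \<noteq> X \<and> W \<noteq> Y \<and> \<kappa> Y \<le> \<kappa> W}" if W: "W \<in> M" for W
      using ev[OF W XY(2)] by eventually_elim (use W in \<open>auto simp: not_less[symmetric]\<close>)
  qed auto
  have ne: "\<forall>\<^sub>F n in sequentially. 0 < up_prob f (\<kappa>n n) (insert (Z n) M) X"
    using order_tendstoD(1)[OF up pos] .
  have "(\<lambda>n. if \<kappa> X < \<kappa> Y then hit f (\<kappa>n n) (insert (Z n) M) X Y / up_prob f (\<kappa>n n) (insert (Z n) M) X else 0)
      \<longlonglongrightarrow> (if \<kappa> X < \<kappa> Y then hit f \<kappa> M X Y / up_prob f \<kappa> M X else 0)"
    using hit up pos by (auto intro!: tendsto_divide)
  moreover have "\<forall>\<^sub>F n in sequentially.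
      (if \<kappa> X < \<kappa> Y then hit f (\<kappa>n n) (insert (Z n) M) X Y / up_prob f (\<kappa>n n) (insert (Z n) M) X else 0)
      = navp f (\<kappa>n n) (insert (Z n) M) X Y"
    using ne ev[OF XY] by eventually_elim (use XY False in \<open>simp add: navp_def\<close>)
  ultimately show ?thesis using tendsto_cong[of _ _ sequentially] XY False pos by (force simp: navp_def)
qed (simp add: navp_def)

lemma miss_translate: "miss f (X + z) ((\<lambda>v. v + z) ` S) = miss f X S"
proof -
  have "{F. finite F \<and> F \<subseteq> (\<lambda>v. v + z) ` S} = (\<lambda>F. (\<lambda>v. v + z) ` F) ` {F. finite F \<and> F \<subseteq> S}"
  proof (intro equalityI subsetI)
    fix F assume "F \<in> {F. finite F \<and> F \<subseteq> (\<lambda>v. v + z) ` S}"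
    then obtain C where "C \<subseteq> S" "finite C" "F = (\<lambda>v. v + z) ` C" using finite_subset_image[of F _ S] by blast
    then show "F \<in> (\<lambda>F. (\<lambda>v. v + z) ` F) ` {F. finite F \<and> F \<subseteq> S}" by blast
  qed auto
  then show ?thesis unfolding miss_def by (simp add: image_image prod.reindex)
qed

lemma navp_translate:
  "navp f \<kappa> ((\<lambda>v. v + z) ` M) (X + z) (Y + z) = navp f (\<lambda>v. \<kappa> (v + z)) M X Y"
proof -
  have "{Z \<in> (\<lambda>v. v + z) ` M. \<kappa> (X + z) < \<kappa> Z} = (\<lambda>v. v + z) ` {Z \<in> M. \<kappa> (X + z) < \<kappa> (Z + z)}" by auto
  moreover have "{Z \<in> (\<lambda>v. v + z) ` M. Z \<noteq> X + z \<and> Z \<noteq> Y + z \<and> \<kappa> (Y + z) \<le> \<kappa> Z}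
     = (\<lambda>v. v + z) ` {Z \<in> M. Z \<noteq> X \<and> Z \<noteq> Y \<and> \<kappa> (Y + z) \<le> \<kappa> (Z + z)}" by auto
  moreover have "Y + z \<in> (\<lambda>v. v + z) ` M \<longleftrightarrow> Y \<in> M" by auto
  ultimately show ?thesis unfolding navp_def up_prob_def hit_def by (simp add: miss_translate)
qed

end

abbreviation unif01 :: "real measure" where "unif01 \<equiv> uniform_measure lborel {0..1}"

lemma prob_space_unif01: "prob_space unif01"
  by (rule prob_space_uniform_measure) auto

lemma measure_unif01:
  assumes "0 \<le> t" "t \<le> (1::real)"
  shows "measure unif01 {..t} = t" "measure unif01 {t<..} = 1 - t"
proof -
  have "{0..1} \<inter> {..t} = {0..t}" "{0..1} \<inter> {t<..} = {t<..1}" using assms by auto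
  then show "measure unif01 {..t} = t" "measure unif01 {t<..} = 1 - t" using assms by simp_all
qed

interpretation unif01: prob_space unif01 by (rule prob_space_unif01)

interpretation unif01_product: product_prob_space "\<lambda>_. unif01" I for I :: "'i set" ..

lemma prob_space_row_law: "prob_space (row_law M X)"
  unfolding row_law_def by (rule prob_space_PiM) (rule prob_space_unif01)

lemma prob_space_conditioned:
  assumes "prob_space \<mu>"
  shows "prob_space (conditioned \<mu> A)"
proof -
  interpret prob_space \<mu> by fact
  show ?thesis unfolding conditioned_def using assms by (auto intro!: prob_space_uniform_measure)
qed

lemma sets_conditioned: "sets (conditioned \<mu> A) = sets \<mu>" "space (conditioned \<mu> A) = space \<mu>"
  by (auto simp: conditioned_def)

lemma measure_conditioned:
  assumes "prob_space \<mu>" "A \<in> sets \<mu>" "B \<in> sets \<mu>"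
  shows "measure (conditioned \<mu> A) B =
     (if measure \<mu> A = 0 then measure \<mu> B else measure \<mu> (A \<inter> B) / measure \<mu> A)"
proof -
  interpret prob_space \<mu> by fact
  show ?thesis using assms by (auto simp: conditioned_def emeasure_eq_measure)
qed

lemma row_component[measurable]:
  "Y \<in> M - {X} \<Longrightarrow> (\<lambda>u. u Y) \<in> borel_measurable (row_law M X)"
  unfolding row_law_def using measurable_component_singleton[of Y "M - {X}" "\<lambda>_. unif01"] by simp

context connection
begin

lemma row_finite:
  assumes "finite T" "T \<subseteq> M - {X}" "finite F" "F \<subseteq> M - {X}" "T \<inter> F = {}"
  shows "measure (row_law M X) {u \<in> space (row_law M X). (\<forall>Y\<in>T. u Y \<le> f (dist X Y)) \<and> (\<forall>Y\<in>F. f (dist X Y) < u Y)}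
     = (\<Prod>Y\<in>T. f (dist X Y)) * (\<Prod>Y\<in>F. 1 - f (dist X Y))"
proof -
  define A where "A Y = (if Y \<in> T then {..f (dist X Y)} else {f (dist X Y)<..})" for Y
  have "{u \<in> space (row_law M X). (\<forall>Y\<in>T. u Y \<le> f (dist X Y)) \<and> (\<forall>Y\<in>F. f (dist X Y) < u Y)}
      = {u \<in> space (row_law M X). \<forall>Y\<in>T \<union> F. u Y \<in> A Y}"
  proof -
    have "(\<forall>Y\<in>F. u Y \<in> A Y) \<longleftrightarrow> (\<forall>Y\<in>F. f (dist X Y) < u Y)" for u
      using assms(5) by (intro ball_cong refl) (auto simp: A_def)
    moreover have "(\<forall>Y\<in>T. u Y \<in> A Y) \<longleftrightarrow> (\<forall>Y\<in>T. u Y \<le> f (dist X Y))" for u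
      by (simp add: A_def)
    ultimately show ?thesis by (simp add: ball_Un)
  qed
  also have "emeasure (row_law M X) \<dots> = (\<Prod>Y\<in>T \<union> F. emeasure unif01 (A Y))"
    unfolding row_law_def by (rule unif01_product.emeasure_PiM_Collect) (use assms in \<open>auto simp: A_def\<close>)
  also have "\<dots> = (\<Prod>Y\<in>T \<union> F. ennreal (measure unif01 (A Y)))" by (simp add: unif01.emeasure_eq_measure)
  also have "\<dots> = ennreal (\<Prod>Y\<in>T \<union> F. measure unif01 (A Y))" by (simp add: prod_ennreal)
  also have "(\<Prod>Y\<in>T \<union> F. measure unif01 (A Y)) = (\<Prod>Y\<in>T. measure unif01 (A Y)) * (\<Prod>Y\<in>F. measure unif01 (A Y))"
    using assms by (intro prod.union_disjoint) auto
  also have "(\<Prod>Y\<in>T. measure unif01 (A Y)) = (\<Prod>Y\<in>T. f (dist X Y))"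
    by (rule prod.cong) (auto simp: A_def measure_unif01 f01)
  also have "(\<Prod>Y\<in>F. measure unif01 (A Y)) = (\<Prod>Y\<in>F. 1 - f (dist X Y))"
  proof (rule prod.cong)
    fix Y assume "Y \<in> F"
    then have "Y \<notin> T" using assms(5) by blast
    then have "A Y = {f (dist X Y)<..}" by (simp add: A_def)
    then show "measure unif01 (A Y) = 1 - f (dist X Y)" using measure_unif01(2)[OF f01] by metis
  qed simp
  finally have eq: "emeasure (row_law M X) {u \<in> space (row_law M X). (\<forall>Y\<in>T. u Y \<le> f (dist X Y)) \<and> (\<forall>Y\<in>F. f (dist X Y) < u Y)}
     = ennreal ((\<Prod>Y\<in>T. f (dist X Y)) * (\<Prod>Y\<in>F. 1 - f (dist X Y)))" .
  have "0 \<le> (\<Prod>Y\<in>T. f (dist X Y)) * (\<Prod>Y\<in>F. 1 - f (dist X Y))"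
    by (intro mult_nonneg_nonneg prod_nonneg) (use f01 in auto)
  then show ?thesis unfolding measure_def eq by (rule enn2real_ennreal)
qed

lemma row_countable_sets:
  assumes "countable M" "T \<subseteq> M - {X}" "S \<subseteq> M - {X}"
  shows "{u \<in> space (row_law M X). (\<forall>Y\<in>T. u Y \<le> f (dist X Y)) \<and> (\<forall>Y\<in>S. f (dist X Y) < u Y)} \<in> sets (row_law M X)"
proof -
  have "countable T" "countable S" using assms by (auto intro: countable_subset[of _ M])
  have [measurable]: "(\<lambda>u. u Y) \<in> borel_measurable (row_law M X)" if "Y \<in> T \<union> S" for Y
    using that assms by (intro row_component) auto
  have "{u \<in> space (row_law M X). \<forall>Y\<in>T. u Y \<le> f (dist X Y)} \<in> sets (row_law M X)"
    by (rule sets.sets_Collect_countable_All') (use \<open>countable T\<close> \<open>countable S\<close> in measurable)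
  moreover have "{u \<in> space (row_law M X). \<forall>Y\<in>S. f (dist X Y) < u Y} \<in> sets (row_law M X)"
    by (rule sets.sets_Collect_countable_All') (use \<open>countable T\<close> \<open>countable S\<close> in measurable)
  ultimately show ?thesis by (rule sets.sets_Collect_conj[rotated])
qed

lemma row_prob:
  assumes M: "countable M" and T: "finite T" "T \<subseteq> M - {X}" and S: "S \<subseteq> M - {X}" "T \<inter> S = {}"
  shows "measure (row_law M X) {u \<in> space (row_law M X). (\<forall>Y\<in>T. u Y \<le> f (dist X Y)) \<and> (\<forall>Y\<in>S. f (dist X Y) < u Y)}
     = (\<Prod>Y\<in>T. f (dist X Y)) * miss f X S"
proof -
  interpret R: prob_space "row_law M X" by (rule prob_space_row_law)
  have "countable S" using M S by (auto intro: countable_subset[of _ M])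
  define F where "F n = (from_nat_into S ` {..<n}) \<inter> S" for n :: nat
  have F: "incseq F" "\<And>n. finite (F n)" "\<And>n. F n \<subseteq> S" by (auto simp: F_def incseq_def)
  have FS: "(\<Union>n. F n) = S"
  proof (intro equalityI subsetI)
    fix Y assume "Y \<in> S"
    then obtain m where "from_nat_into S m = Y" using from_nat_into_surj[OF \<open>countable S\<close>] by blast
    then have "Y \<in> F (Suc m)" using \<open>Y \<in> S\<close> by (auto simp: F_def)
    then show "Y \<in> (\<Union>n. F n)" by blast
  qed (use F in blast)
  define E where "E G = {u \<in> space (row_law M X). (\<forall>Y\<in>T. u Y \<le> f (dist X Y)) \<and> (\<forall>Y\<in>G. f (dist X Y) < u Y)}" for G
  have "(\<lambda>n. measure (row_law M X) (E (F n))) \<longlonglongrightarrow> measure (row_law M X) (\<Inter>n. E (F n))"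
  proof (rule R.finite_Lim_measure_decseq)
    show "range (\<lambda>n. E (F n)) \<subseteq> sets (row_law M X)"
      unfolding E_def using row_countable_sets[OF M T(2)] F(3) S(1) by blast
    show "decseq (\<lambda>n. E (F n))" using F(1) unfolding decseq_def incseq_def E_def by blast
  qed
  moreover have "(\<Inter>n. E (F n)) = E S" unfolding FS[symmetric] E_def by auto
  moreover have "measure (row_law M X) (E (F n)) = (\<Prod>Y\<in>T. f (dist X Y)) * (\<Prod>Y\<in>F n. 1 - f (dist X Y))" for n
    unfolding E_def using T S F(2,3)[of n] by (intro row_finite) auto
  moreover have "(\<lambda>n. (\<Prod>Y\<in>T. f (dist X Y)) * (\<Prod>Y\<in>F n. 1 - f (dist X Y))) \<longlonglongrightarrow> (\<Prod>Y\<in>T. f (dist X Y)) * miss f X S"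
    by (intro tendsto_mult tendsto_const miss_exhaust F FS)
  ultimately have "measure (row_law M X) (E S) = (\<Prod>Y\<in>T. f (dist X Y)) * miss f X S"
    using LIMSEQ_unique by simp
  then show ?thesis unfolding E_def .
qed

text \<open>
  The choice has to be strictly highest, because \<^const>\<open>unique_or\<close> returns \<open>X\<close> in case of a tie.
\<close>

lemma key_nav_eq_iff:
  assumes "Y \<noteq> X"
  shows "key_nav f \<kappa> M X u = Y \<longleftrightarrow> Y \<in> M \<and> u Y \<le> f (dist X Y) \<and>
     (\<forall>Z\<in>{Z \<in> M. Z \<noteq> X \<and> Z \<noteq> Y \<and> \<kappa> Y \<le> \<kappa> Z}. f (dist X Z) < u Z)" (is "?L \<longleftrightarrow> ?R")
proof -
  let ?Q = "is_arg_max \<kappa> (\<lambda>Y. Y \<in> M \<and> Y \<noteq> X \<and> u Y \<le> f (dist X Y))"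
  show ?thesis
  proof
    assume L: ?L
    then have ex: "\<exists>!Y. ?Q Y" using assms unfolding key_nav_def unique_or_def by (metis (no_types, lifting))
    then have "?Q Y" using L theI'[OF ex] unfolding key_nav_def unique_or_def by simp
    have "f (dist X Z) < u Z" if Z: "Z \<in> M" "Z \<noteq> X" "Z \<noteq> Y" "\<kappa> Y \<le> \<kappa> Z" for Z
    proof (rule ccontr)
      assume n: "\<not> f (dist X Z) < u Z"
      have "\<nexists>y. (y \<in> M \<and> y \<noteq> X \<and> u y \<le> f (dist X y)) \<and> \<kappa> Y < \<kappa> y"
        using \<open>?Q Y\<close> unfolding is_arg_max_def by blast
      then have "\<not> \<kappa> Y < \<kappa> Z" using Z n by (meson not_less)
      then have "\<kappa> Y = \<kappa> Z" using Z(4) by simp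
      then have "?Q Z" using \<open>?Q Y\<close> Z n unfolding is_arg_max_def by simp
      then show False using ex \<open>?Q Y\<close> Z(3) by blast
    qed
    then show ?R using \<open>?Q Y\<close> by (auto simp: is_arg_max_def)
  next
    assume R: ?R
    have Q: "?Q Y" unfolding is_arg_max_def using R assms by (auto simp: not_less[symmetric])
    moreover have "W = Y" if W: "?Q W" for W
    proof (rule ccontr)
      assume "W \<noteq> Y"
      then have "\<not> \<kappa> Y \<le> \<kappa> W" using R W unfolding is_arg_max_def by (auto simp: not_le[symmetric])
      then show False using R W assms unfolding is_arg_max_def by auto
    qed
    ultimately have ex: "\<exists>!Y. ?Q Y" by blast
    then have "(THE Y. ?Q Y) = Y" using Q by (rule the1_equality)
    then show ?L unfolding key_nav_def unique_or_def using ex by (simp only: if_True)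
  qed
qed

lemma key_nav_range: "key_nav f \<kappa> M X u \<in> insert X M"
  using key_nav_eq_iff[of "key_nav f \<kappa> M X u" X \<kappa> M u] by blast

lemma key_nav_set:
  assumes "Y \<in> M - {X}"
  shows "{u \<in> space (row_law M X). key_nav f \<kappa> M X u = Y} =
   {u \<in> space (row_law M X). (\<forall>W\<in>{Y}. u W \<le> f (dist X W)) \<and>
     (\<forall>Z\<in>{Z \<in> M. Z \<noteq> X \<and> Z \<noteq> Y \<and> \<kappa> Y \<le> \<kappa> Z}. f (dist X Z) < u Z)}"
  using assms by (intro Collect_cong conj_cong refl, subst key_nav_eq_iff) auto

lemma key_nav_sets:
  assumes "countable M"
  shows "{u \<in> space (row_law M X). key_nav f \<kappa> M X u = Y} \<in> sets (row_law M X)"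
proof -
  have *: "{u \<in> space (row_law M X). key_nav f \<kappa> M X u = Y} \<in> sets (row_law M X)" if "Y \<in> M - {X}" for Y
    unfolding key_nav_set[OF that] using assms that by (intro row_countable_sets) auto
  show ?thesis
  proof (cases "Y \<in> insert X M")
    case False
    then have "{u \<in> space (row_law M X). key_nav f \<kappa> M X u = Y} = {}" using key_nav_range[of \<kappa> M X] False by auto
    then show ?thesis by (simp only: sets.empty_sets)
  next
    case True
    show ?thesis
    proof (cases "Y = X")
      case eq: True
      have "{u \<in> space (row_law M X). key_nav f \<kappa> M X u = X} = space (row_law M X) -
         (\<Union>Y\<in>M - {X}. {u \<in> space (row_law M X). key_nav f \<kappa> M X u = Y})"
        using key_nav_range[of \<kappa> M X] by auto
      also have "\<dots> \<in> sets (row_law M X)" using assms * by (intro sets.compl_sets sets.countable_UN') auto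
      finally show ?thesis using eq by simp
    next
      case False
      with True have "Y \<in> M - {X}" by blast
      then show ?thesis by (rule *)
    qed
  qed
qed

lemma has_neighbour_eq:
  fixes \<kappa> :: "'a::euclidean_space \<Rightarrow> real"
  shows "has_neighbour_in f M X {Y. \<kappa> X < \<kappa> Y} = space (row_law M X) -
    {u \<in> space (row_law M X). (\<forall>Y\<in>{}. u Y \<le> f (dist X Y)) \<and> (\<forall>Y\<in>{Z \<in> M. \<kappa> X < \<kappa> Z}. f (dist X Y) < u Y)}"
proof -
  have "(\<exists>Y\<in>M \<inter> {Y. \<kappa> X < \<kappa> Y} - {X}. u Y \<le> f (norm (X - Y))) \<longleftrightarrow>
      \<not> (\<forall>Y\<in>{Z \<in> M. \<kappa> X < \<kappa> Z}. f (dist X Y) < u Y)" for u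
  proof -
    have "M \<inter> {Y. \<kappa> X < \<kappa> Y} - {X} = {Z \<in> M. \<kappa> X < \<kappa> Z}" by auto
    then show ?thesis by (simp only: dist_norm not_less[symmetric]) blast
  qed
  then show ?thesis unfolding has_neighbour_in_def by auto
qed

lemma has_neighbour_sets:
  fixes \<kappa> :: "'a::euclidean_space \<Rightarrow> real"
  assumes "countable M"
  shows "has_neighbour_in f M X {Y. \<kappa> X < \<kappa> Y} \<in> sets (row_law M X)"
proof -
  have "{Z \<in> M. \<kappa> X < \<kappa> Z} \<subseteq> M - {X}" by auto
  from row_countable_sets[OF assms empty_subsetI this]
  show ?thesis unfolding has_neighbour_eq by (rule sets.compl_sets)
qed

lemma prob_has_neighbour:
  assumes "countable M"
  shows "measure (row_law M X) (has_neighbour_in f M X {Y. \<kappa> X < \<kappa> Y}) = up_prob f \<kappa> M X"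
proof -
  interpret R: prob_space "row_law M X" by (rule prob_space_row_law)
  have sub: "{Z \<in> M. \<kappa> X < \<kappa> Z} \<subseteq> M - {X}" by auto
  show ?thesis unfolding has_neighbour_eq up_prob_def
      R.prob_compl[OF row_countable_sets[OF assms empty_subsetI sub]]
      row_prob[OF assms finite.emptyI empty_subsetI sub Int_empty_left] by simp
qed

text \<open>
  If \<open>Y\<close> lies above \<open>X\<close>, choosing \<open>Y\<close> implies the conditioning event; otherwise it excludes it.
\<close>

lemma key_nav_prob:
  assumes M: "countable M" and Y: "Y \<in> M" "Y \<noteq> X"
  shows "measure (key_row f \<kappa> M X) {u \<in> space (key_row f \<kappa> M X). key_nav f \<kappa> M X u = Y} = navp f \<kappa> M X Y"
proof -
  let ?R = "row_law M X"
  let ?E = "has_neighbour_in f M X {Y. \<kappa> X < \<kappa> Y}"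
  let ?H = "{u \<in> space ?R. key_nav f \<kappa> M X u = Y}"
  have hit: "measure ?R ?H = hit f \<kappa> M X Y"
  proof -
    have "Y \<in> M - {X}" using Y by blast
    then show ?thesis unfolding hit_def key_nav_set[OF \<open>Y \<in> M - {X}\<close>]
      by (subst row_prob[OF M]) auto
  qed
  have sub: "?H \<subseteq> ?E" if "\<kappa> X < \<kappa> Y"
    using that Y key_nav_eq_iff[OF Y(2), of \<kappa> M] unfolding has_neighbour_in_def by (auto simp: dist_norm)
  have dis: "?E \<inter> ?H = {}" if le: "\<not> \<kappa> X < \<kappa> Y"
  proof (rule ccontr)
    assume "?E \<inter> ?H \<noteq> {}"
    then obtain u Z where u: "key_nav f \<kappa> M X u = Y" "Z \<in> M" "\<kappa> X < \<kappa> Z" "Z \<noteq> X" "u Z \<le> f (dist X Z)"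
      unfolding has_neighbour_in_def by (auto simp: dist_norm)
    then have "Z \<noteq> Y" "\<kappa> Y \<le> \<kappa> Z" using le by auto
    then show False using u key_nav_eq_iff[OF Y(2), of \<kappa> M u] by fastforce
  qed
  have "measure (key_row f \<kappa> M X) ?H =
     (if measure ?R ?E = 0 then measure ?R ?H else measure ?R (?E \<inter> ?H) / measure ?R ?E)"
    unfolding key_row_def by (rule measure_conditioned[OF prob_space_row_law has_neighbour_sets[OF M] key_nav_sets[OF M]])
  also have "\<dots> = navp f \<kappa> M X Y"
  proof (cases "\<kappa> X < \<kappa> Y")
    case True
    then have "?E \<inter> ?H = ?H" using sub by blast
    then show ?thesis using True Y hit prob_has_neighbour[OF M, of X \<kappa>] by (simp add: navp_def)
  next
    case False
    then show ?thesis using dis[OF False] Y hit prob_has_neighbour[OF M, of X \<kappa>] by (simp add: navp_def)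
  qed
  finally show ?thesis unfolding key_row_def by (simp add: sets_conditioned)
qed

lemma prob_space_key_row: "prob_space (key_row f \<kappa> M X)"
  unfolding key_row_def by (rule prob_space_conditioned[OF prob_space_row_law])

text \<open>
  By the Borel-Cantelli lemma there are finitely many neighbours, and by the conditioning at least
  one.  Hence there is a highest one, and it is unique since keys are distinct.
\<close>

lemma AE_key_nav_moves:
  assumes M: "countable M" and sums: "bounded_sums (\<lambda>Y. f (dist X Y)) M"
    and inj: "inj_on \<kappa> M" and pos: "0 < up_prob f \<kappa> M X"
  shows "AE u in key_row f \<kappa> M X. key_nav f \<kappa> M X u \<noteq> X"
proof -
  let ?R = "row_law M X"
  let ?E = "has_neighbour_in f M X {Y. \<kappa> X < \<kappa> Y}"
  interpret R: prob_space ?R by (rule prob_space_row_law)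
  let ?N = "\<lambda>u. {Y \<in> M - {X}. u Y \<le> f (dist X Y)}"
  have fin: "AE u in ?R. finite (?N u)"
  proof -
    define A where "A n = {u \<in> space ?R. \<exists>Y\<in>M - {X}. to_nat_on M Y = n \<and> u Y \<le> f (dist X Y)}" for n
    have A: "A n \<in> sets ?R \<and> measure ?R (A n) = (\<Sum>Y\<in>{Y \<in> M - {X}. to_nat_on M Y = n}. f (dist X Y))" for n
    proof (cases "\<exists>Y\<in>M - {X}. to_nat_on M Y = n")
      case True
      then obtain Y where Y: "Y \<in> M - {X}" "to_nat_on M Y = n" by blast
      have eq: "{Y \<in> M - {X}. to_nat_on M Y = n} = {Y}"
      proof (intro equalityI subsetI)
        fix W assume "W \<in> {Y \<in> M - {X}. to_nat_on M Y = n}"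
        then show "W \<in> {Y}" using Y inj_onD[OF inj_on_to_nat_on[OF M], of W Y] by simp
      qed (use Y in simp)
      then have "A n = {u \<in> space ?R. (\<forall>Y\<in>{Y}. u Y \<le> f (dist X Y)) \<and> (\<forall>Y\<in>{}. f (dist X Y) < u Y)}"
      proof -
        have "(\<exists>W\<in>M - {X}. to_nat_on M W = n \<and> u W \<le> f (dist X W)) \<longleftrightarrow>
            (\<exists>W\<in>{W \<in> M - {X}. to_nat_on M W = n}. u W \<le> f (dist X W))" for u
          by (simp only: Bex_def mem_Collect_eq conj_assoc)
        then show ?thesis unfolding A_def eq by simp
      qed
      then show ?thesis unfolding eq using Y row_finite[of "{Y}" M X "{}"] row_countable_sets[OF M, of "{Y}" X "{}"] by simp
    next
      case False
      then have e: "A n = {}" "{Y \<in> M - {X}. to_nat_on M Y = n} = {}" unfolding A_def by blast+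
      show ?thesis unfolding e by simp
    qed
    have fin1: "finite {Y \<in> M - {X}. to_nat_on M Y = n}" for n
      by (rule finite_subset[of _ "from_nat_into M ` {n}"]) (use M in auto)
    have "summable (\<lambda>n. measure ?R (A n))"
    proof -
      obtain C where C: "\<And>F. finite F \<Longrightarrow> F \<subseteq> M \<Longrightarrow> (\<Sum>Y\<in>F. f (dist X Y)) \<le> C"
        using sums by (auto simp: bounded_sums_def)
      show ?thesis
      proof (rule summableI_nonneg_bounded[where x = C])
        fix n
        have "(\<Sum>i<n. measure ?R (A i)) = (\<Sum>i<n. \<Sum>Y\<in>{Y \<in> M - {X}. to_nat_on M Y = i}. f (dist X Y))"
          using A by simp
        also have "\<dots> = (\<Sum>Y\<in>(\<Union>i<n. {Y \<in> M - {X}. to_nat_on M Y = i}). f (dist X Y))"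
          by (rule sum.UNION_disjoint[symmetric]) (use fin1 in auto)
        also have "\<dots> \<le> C" by (rule C) (use fin1 in auto)
        finally show "(\<Sum>i<n. measure ?R (A i)) \<le> C" .
      qed simp
    qed
    then have "AE u in ?R. \<forall>\<^sub>F n in sequentially. u \<in> space ?R - A n"
      using A by (intro borel_cantelli_AE1) (auto simp: R.emeasure_eq_measure)
    then show ?thesis
    proof eventually_elim
      case (elim u)
      then obtain n0 where n0: "\<And>n. n \<ge> n0 \<Longrightarrow> u \<in> space ?R - A n" unfolding eventually_sequentially by blast
      have "?N u \<subseteq> from_nat_into M ` {..<n0}"
      proof
        fix Y assume Y: "Y \<in> ?N u"
        have "\<not> n0 \<le> to_nat_on M Y" using n0[of "to_nat_on M Y"] Y unfolding A_def by blast
        then show "Y \<in> from_nat_into M ` {..<n0}"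
          using Y M by (intro image_eqI[of _ _ "to_nat_on M Y"]) auto
      qed
      then show ?case by (rule finite_subset) simp
    qed
  qed
  have "AE u in ?R. u \<in> ?E \<longrightarrow> key_nav f \<kappa> M X u \<noteq> X"
    using fin
  proof eventually_elim
    case (elim u)
    show ?case
    proof
      assume "u \<in> ?E"
      then obtain W where W: "W \<in> M \<inter> {Y. \<kappa> X < \<kappa> Y} - {X}" "u W \<le> f (norm (X - W))"
        unfolding has_neighbour_in_def by blast
      then have "W \<in> ?N u" by (auto simp: dist_norm)
      then have "?N u \<noteq> {}" by (metis empty_iff)
      then have "Max (\<kappa> ` ?N u) \<in> \<kappa> ` ?N u" using elim by (intro Max_in) simp_all
      then obtain Y where Y: "Y \<in> ?N u" "\<kappa> Y = Max (\<kappa> ` ?N u)" by (auto elim!: imageE)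
      have less: "\<kappa> Z < \<kappa> Y" if "Z \<in> ?N u" "Z \<noteq> Y" for Z
      proof -
        have "\<kappa> Z \<le> \<kappa> Y" unfolding Y(2) using elim that by (intro Max_ge) auto
        moreover have "\<kappa> Z \<noteq> \<kappa> Y" using inj_onD[OF inj, of Z Y] that Y(1) by blast
        ultimately show ?thesis by simp
      qed
      have "f (dist X Z) < u Z" if "Z \<in> M" "Z \<noteq> X" "Z \<noteq> Y" "\<kappa> Y \<le> \<kappa> Z" for Z
      proof (rule ccontr)
        assume "\<not> f (dist X Z) < u Z"
        then have "Z \<in> ?N u" using that by simp
        then show False using less[of Z] that by simp
      qed
      then have "key_nav f \<kappa> M X u = Y" using Y(1) by (subst key_nav_eq_iff) simp_all
      then show "key_nav f \<kappa> M X u \<noteq> X" using Y(1) by blast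
    qed
  qed
  then show ?thesis unfolding key_row_def conditioned_def
    using pos prob_has_neighbour[OF M, of X \<kappa>] has_neighbour_sets[OF M, of X \<kappa>]
    by (auto simp: R.emeasure_eq_measure intro: AE_uniform_measureI)
qed

end

section \<open>Quantile coupling of the choices\<close>

text \<open>
  For uniform \<open>u\<close>, the value is \<open>Suc j\<close> with probability \<open>q j\<close>; the remaining mass, if any, is put on
  \<open>Suc i\<close>, the code of making no choice.
\<close>

definition quant :: "nat \<Rightarrow> (nat \<Rightarrow> real) \<Rightarrow> real \<Rightarrow> nat" where
  "quant i q u = (if \<exists>j. u < sum q {..j} then Suc (LEAST j. u < sum q {..j}) else Suc i)"

lemma measurable_quant[measurable]:
  assumes [measurable]: "\<And>j. (\<lambda>x. q x j) \<in> borel_measurable M" "u \<in> borel_measurable M"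
  shows "(\<lambda>x. quant i (q x) (u x)) \<in> M \<rightarrow>\<^sub>M count_space UNIV"
  unfolding quant_def by measurable

lemma measurable_quant_unif01: "quant i q \<in> unif01 \<rightarrow>\<^sub>M count_space UNIV"
proof -
  have eq: "measurable unif01 (count_space UNIV) = (measurable borel (count_space UNIV) :: (real \<Rightarrow> nat) set)"
    by (rule measurable_cong_sets) simp_all
  show ?thesis unfolding eq by measurable
qed

lemma quant_eq_Suc:
  assumes q: "\<And>j. 0 \<le> q j" and u: "0 \<le> u" and j: "j \<noteq> i"
  shows "quant i q u = Suc j \<longleftrightarrow> sum q {..<j} \<le> u \<and> u < sum q {..j}"
proof
  assume L: "quant i q u = Suc j"
  then have ex: "\<exists>j. u < sum q {..j}" using j by (auto simp: quant_def split: if_splits)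
  then have jL: "j = (LEAST j. u < sum q {..j})" using L by (simp add: quant_def)
  have "u < sum q {..j}" unfolding jL using ex by (rule LeastI_ex)
  moreover have "sum q {..<j} \<le> u"
  proof (cases j)
    case (Suc k)
    then have "\<not> u < sum q {..k}" using not_less_Least[of k "\<lambda>j. u < sum q {..j}"] jL by simp
    then show ?thesis using Suc by (simp add: lessThan_Suc_atMost)
  qed (use u in simp)
  ultimately show "sum q {..<j} \<le> u \<and> u < sum q {..j}" by simp
next
  assume R: "sum q {..<j} \<le> u \<and> u < sum q {..j}"
  have "(LEAST j. u < sum q {..j}) = j"
  proof (rule Least_equality)
    fix k assume k: "u < sum q {..k}"
    show "j \<le> k"
    proof (rule ccontr)
      assume "\<not> j \<le> k"
      then have "sum q {..k} \<le> sum q {..<j}" using q by (intro sum_mono2) auto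
      then show False using k R by linarith
    qed
  qed (use R in simp)
  then show "quant i q u = Suc j" using R by (auto simp: quant_def)
qed

lemma measure_quant:
  assumes q: "\<And>j. 0 \<le> q j" and le: "sum q {..j} \<le> 1" and j: "j \<noteq> i"
  shows "measure unif01 {u. quant i q u = Suc j} = q j"
proof -
  have "{u. quant i q u = Suc j} = (\<lambda>u. quant i q u) -` {Suc j} \<inter> space borel" by auto
  also have "\<dots> \<in> sets borel" by measurable
  finally have m: "{u. quant i q u = Suc j} \<in> sets lborel" by simp
  have sums: "sum q {..j} = sum q {..<j} + q j" by (simp add: lessThan_Suc_atMost[symmetric])
  have "{0..1} \<inter> {u. quant i q u = Suc j} = {sum q {..<j}..<sum q {..j}}"
    using quant_eq_Suc[of q _ j i, OF q _ j] le sum_nonneg[of "{..<j}" q] q by auto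
  then have "measure unif01 {u. quant i q u = Suc j} = measure lborel {sum q {..<j}..<sum q {..j}}"
    using measure_uniform_measure[of lborel "{0..1}" "{u. quant i q u = Suc j}"] m by simp
  also have "\<dots> = q j" using sums q[of j] by simp
  finally show ?thesis .
qed

text \<open>
  As \<open>q\<close> has total mass one, some partial sum exceeds \<open>u < 1\<close>.  The first such sum and the
  finitely many before it determine the value, and they differ from \<open>u\<close>, so that small perturbations
  have no effect.
\<close>

lemma quant_eventually_eq:
  assumes q: "\<And>j. 0 \<le> q j" "q sums 1" and qn: "\<And>j. (\<lambda>n. qn n j) \<longlonglongrightarrow> q j"
    and u: "u < 1" "\<And>j. u \<noteq> sum q {..j}"
  shows "\<forall>\<^sub>F n in sequentially. quant i (qn n) u = quant i q u"
proof -
  have "(\<lambda>n. sum q {..n}) \<longlonglongrightarrow> 1" using q(2) by (simp add: sums_def_le)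
  then have "\<forall>\<^sub>F n in sequentially. u < sum q {..n}" using u(1) by (rule order_tendstoD(1))
  then have ex: "\<exists>j. u < sum q {..j}" by (meson eventually_sequentially order_refl)
  define j where "j = (LEAST j. u < sum q {..j})"
  have j: "u < sum q {..j}" unfolding j_def using ex by (rule LeastI_ex)
  have less: "sum q {..k} < u" if "k < j" for k
    using not_less_Least[of k "\<lambda>j. u < sum q {..j}"] that u(2)[of k] unfolding j_def by force
  have lim: "(\<lambda>n. sum (qn n) {..k}) \<longlonglongrightarrow> sum q {..k}" for k by (intro tendsto_sum qn)
  have "\<forall>\<^sub>F n in sequentially. \<forall>k\<in>{..<j}. sum (qn n) {..k} < u"
    using less by (intro eventually_ball_finite ballI order_tendstoD(2)[OF lim]) auto
  moreover have "\<forall>\<^sub>F n in sequentially. u < sum (qn n) {..j}" using j by (rule order_tendstoD(1)[OF lim])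
  ultimately show ?thesis
  proof eventually_elim
    case (elim n)
    have "(LEAST j. u < sum (qn n) {..j}) = j"
    proof (rule Least_equality)
      fix k assume "u < sum (qn n) {..k}"
      then show "j \<le> k" using elim(1) by (metis lessThan_iff less_asym not_le)
    qed (use elim in simp)
    then have "quant i (qn n) u = Suc j" using elim(2) by (auto simp: quant_def)
    moreover have "quant i q u = Suc j" using ex by (simp add: quant_def j_def)
    ultimately show ?case by simp
  qed
qed

text \<open>
  Two probability measures on the natural numbers that agree in all points but one are equal.
\<close>

lemma quant_law:
  assumes R: "prob_space R" and h[measurable]: "h \<in> R \<rightarrow>\<^sub>M count_space UNIV" and h0: "\<And>x. h x \<noteq> 0"
    and q: "\<And>j. j \<noteq> i \<Longrightarrow> measure R {x \<in> space R. h x = Suc j} = q j" "q i = 0"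
  shows "distr R (count_space UNIV) h = distr unif01 (count_space UNIV) (quant i q)"
proof -
  interpret R: prob_space R by fact
  have q0: "0 \<le> q j" for j using q(1)[of j] q(2) by (cases "j = i") (auto simp flip: q(1))
  have le: "sum q {..j} \<le> 1" for j
  proof -
    have "sum q {..j} \<le> (\<Sum>k\<le>j. measure R {x \<in> space R. h x = Suc k})"
    proof (rule sum_mono)
      fix k show "q k \<le> measure R {x \<in> space R. h x = Suc k}" using q by (cases "k = i") auto
    qed
    also have "\<dots> = measure R (\<Union>k\<le>j. {x \<in> space R. h x = Suc k})"
      by (rule R.finite_measure_finite_Union[symmetric]) (auto simp: disjoint_family_on_def)
    also have "\<dots> \<le> 1" by (rule R.prob_le_1)
    finally show ?thesis .
  qed
  note m = measurable_quant_unif01[of i q]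
  interpret A: prob_space "distr R (count_space UNIV) h" by (rule R.prob_space_distr) simp
  interpret B: prob_space "distr unif01 (count_space UNIV) (quant i q)"
    by (rule unif01.prob_space_distr) (rule m)
  have single: "emeasure (distr R (count_space UNIV) h) {a} = emeasure (distr unif01 (count_space UNIV) (quant i q)) {a}"
    if "a \<noteq> Suc i" for a
  proof (cases a)
    case 0
    have "h -` {0} \<inter> space R = {}" "quant i q -` {0} \<inter> space unif01 = {}"
      by (auto simp: quant_def h0 split: if_splits)
    then show ?thesis using 0 m by (simp add: emeasure_distr)
  next
    case (Suc j)
    then have "j \<noteq> i" using that by simp
    have "h -` {Suc j} \<inter> space R = {x \<in> space R. h x = Suc j}"
      "quant i q -` {Suc j} \<inter> space unif01 = {u. quant i q u = Suc j}" by auto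
    then show ?thesis unfolding Suc
      using m measure_quant[OF q0 le \<open>j \<noteq> i\<close>] q(1)[OF \<open>j \<noteq> i\<close>]
      by (simp add: emeasure_distr R.emeasure_eq_measure unif01.emeasure_eq_measure)
  qed
  have C: "emeasure (distr R (count_space UNIV) h) (- {Suc i}) = emeasure (distr unif01 (count_space UNIV) (quant i q)) (- {Suc i})"
    by (subst (1 2) emeasure_countable_singleton) (auto intro!: nn_integral_cong single)
  have Si: "emeasure (distr R (count_space UNIV) h) {Suc i} = emeasure (distr unif01 (count_space UNIV) (quant i q)) {Suc i}"
    using C A.prob_compl[of "{Suc i}"] B.prob_compl[of "{Suc i}"]
    by (simp add: A.emeasure_eq_measure B.emeasure_eq_measure Compl_eq_Diff_UNIV)
  show ?thesis
  proof (rule measure_eqI_countable[where A = UNIV])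
    fix a
    show "emeasure (distr R (count_space UNIV) h) {a} = emeasure (distr unif01 (count_space UNIV) (quant i q)) {a}"
      by (cases "a = Suc i") (simp only: Si, rule single)
  qed auto
qed

lemma emeasure_PiM_coordinates:
  fixes y :: "nat \<Rightarrow> 'i"
  assumes K: "\<And>X. prob_space (K X)" and y: "inj_on y V" "y ` V \<subseteq> I"
    and h: "\<And>i. i \<in> V \<Longrightarrow> h i \<in> K (y i) \<rightarrow>\<^sub>M count_space UNIV" and J: "finite J"
  shows "emeasure (PiM I K) {U \<in> space (PiM I K). \<forall>i\<in>J. (if i \<in> V then h i (U (y i)) else (0::nat)) \<in> A i} =
    (\<Prod>i\<in>J. if i \<in> V then emeasure (distr (K (y i)) (count_space UNIV) (h i)) (A i) else indicator (A i) 0)"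
proof (cases "\<exists>i\<in>J - V. 0 \<notin> A i")
  case True
  then obtain i where i: "i \<in> J" "i \<notin> V" "0 \<notin> A i" by blast
  then have "{U \<in> space (PiM I K). \<forall>i\<in>J. (if i \<in> V then h i (U (y i)) else (0::nat)) \<in> A i} = {}" by auto
  moreover have "(\<Prod>i\<in>J. if i \<in> V then emeasure (distr (K (y i)) (count_space UNIV) (h i)) (A i) else indicator (A i) 0) = 0"
    using i J by (intro prod_zero) (auto intro!: bexI[of _ i])
  ultimately show ?thesis by (simp only: emeasure_empty)
next
  case False
  interpret product_prob_space K I
    by (intro product_prob_spaceI K)
  define B where "B X = h (the_inv_into V y X) -` A (the_inv_into V y X) \<inter> space (K X)" for X
  have B: "B (y i) = h i -` A i \<inter> space (K (y i))" if "i \<in> V" for i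
    unfolding B_def using the_inv_into_f_f[OF y(1) that] by simp
  have "{U \<in> space (PiM I K). \<forall>i\<in>J. (if i \<in> V then h i (U (y i)) else (0::nat)) \<in> A i}
     = {U \<in> space (PiM I K). \<forall>X\<in>y ` (J \<inter> V). U X \<in> B X}"
  proof (intro Collect_cong conj_cong refl)
    fix U assume U: "U \<in> space (PiM I K)"
    have "U (y i) \<in> space (K (y i))" if "i \<in> V" for i
      using U y(2) that by (auto simp: space_PiM)
    then show "(\<forall>i\<in>J. (if i \<in> V then h i (U (y i)) else (0::nat)) \<in> A i) \<longleftrightarrow> (\<forall>X\<in>y ` (J \<inter> V). U X \<in> B X)"
      using False B by auto
  qed
  also have "emeasure (PiM I K) \<dots> = (\<Prod>X\<in>y ` (J \<inter> V). emeasure (K X) (B X))"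
  proof (rule emeasure_PiM_Collect)
    fix X assume "X \<in> y ` (J \<inter> V)"
    then obtain i where i: "i \<in> V" "X = y i" by blast
    show "B X \<in> sets (K X)" unfolding i(2) B[OF i(1)] using h[OF i(1)] by (rule measurable_sets) simp
  qed (use y J in auto)
  also have "\<dots> = (\<Prod>i\<in>J \<inter> V. emeasure (K (y i)) (B (y i)))"
    using y(1) by (subst prod.reindex) (auto intro: inj_on_subset)
  also have "\<dots> = (\<Prod>i\<in>J \<inter> V. emeasure (distr (K (y i)) (count_space UNIV) (h i)) (A i))"
    by (intro prod.cong refl) (use B h in \<open>auto simp: emeasure_distr\<close>)
  also have "\<dots> = (\<Prod>i\<in>J. if i \<in> V then emeasure (distr (K (y i)) (count_space UNIV) (h i)) (A i) else indicator (A i) 0)"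
    using False by (subst prod.inter_restrict[OF J]) (auto intro!: prod.cong)
  finally show ?thesis .
qed

text \<open>
  Independent rows, indexed by points, may be replaced by independent uniform variables, indexed by
  natural numbers, as soon as the codes of the choices have the right marginals.
\<close>

lemma distr_PiM_coordinates:
  fixes y :: "nat \<Rightarrow> 'i"
  assumes K: "\<And>X. prob_space (K X)" and y: "inj_on y V" "y ` V \<subseteq> I"
    and h: "\<And>i. i \<in> V \<Longrightarrow> h i \<in> K (y i) \<rightarrow>\<^sub>M count_space UNIV"
    and r: "\<And>i. i \<in> V \<Longrightarrow> r i \<in> unif01 \<rightarrow>\<^sub>M count_space UNIV"
    and eq: "\<And>i. i \<in> V \<Longrightarrow> distr (K (y i)) (count_space UNIV) (h i) = distr unif01 (count_space UNIV) (r i)"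
  shows "distr (PiM I K) (PiM UNIV (\<lambda>_. count_space UNIV)) (\<lambda>U i. if i \<in> V then h i (U (y i)) else (0::nat)) =
    distr (PiM UNIV (\<lambda>_. unif01)) (PiM UNIV (\<lambda>_. count_space UNIV)) (\<lambda>u i. if i \<in> V then r i (u i) else 0)"
proof -
  have m1: "(\<lambda>U i. if i \<in> V then h i (U (y i)) else (0::nat)) \<in> PiM I K \<rightarrow>\<^sub>M PiM UNIV (\<lambda>_. count_space UNIV)"
  proof (rule measurable_PiM_single')
    fix i
    show "(\<lambda>U. if i \<in> V then h i (U (y i)) else 0) \<in> PiM I K \<rightarrow>\<^sub>M count_space UNIV"
    proof (cases "i \<in> V")
      case True
      have "(\<lambda>U. U (y i)) \<in> PiM I K \<rightarrow>\<^sub>M K (y i)" using True y(2) by (intro measurable_component_singleton) auto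
      from measurable_compose[OF this h[OF True]] True show ?thesis by simp
    qed simp
  qed (simp add: space_PiM)
  have m2: "(\<lambda>u i. if i \<in> V then r i (u i) else (0::nat)) \<in> PiM UNIV (\<lambda>_. unif01) \<rightarrow>\<^sub>M PiM UNIV (\<lambda>_. count_space UNIV)"
  proof (rule measurable_PiM_single')
    fix i :: nat
    show "(\<lambda>u. if i \<in> V then r i (u i) else 0) \<in> PiM UNIV (\<lambda>_. unif01) \<rightarrow>\<^sub>M count_space UNIV"
    proof (cases "i \<in> V")
      case True
      have "(\<lambda>u. u i) \<in> PiM UNIV (\<lambda>_. unif01) \<rightarrow>\<^sub>M unif01" by (intro measurable_component_singleton) simp
      from measurable_compose[OF this r[OF True]] True show ?thesis by simp
    qed simp
  qed (simp add: space_PiM)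
  interpret P: prob_space "PiM I K" by (rule prob_space_PiM) (rule K)
  interpret D: prob_space "distr (PiM I K) (PiM UNIV (\<lambda>_. count_space UNIV)) (\<lambda>U i. if i \<in> V then h i (U (y i)) else (0::nat))"
    by (rule P.prob_space_distr[OF m1])
  show ?thesis
  proof (rule measure_eqI_PiM_infinite)
    fix A :: "nat \<Rightarrow> nat set" and J :: "nat set"
    assume J: "finite J"
    have sets: "prod_emb UNIV (\<lambda>_. count_space UNIV) J (Pi\<^sub>E J A) \<in> sets (PiM UNIV (\<lambda>_. count_space UNIV))"
      using J by (intro sets_PiM_I) auto
    have vi: "g -` prod_emb UNIV (\<lambda>_. count_space UNIV) J (Pi\<^sub>E J A) \<inter> S = {U \<in> S. \<forall>i\<in>J. g U i \<in> A i}"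
      for g :: "'z \<Rightarrow> nat \<Rightarrow> nat" and S
      by (auto simp: prod_emb_def space_PiM PiE_iff)
    have "emeasure (PiM I K) {U \<in> space (PiM I K). \<forall>i\<in>J. (if i \<in> V then h i (U (y i)) else (0::nat)) \<in> A i} =
      emeasure (PiM UNIV (\<lambda>_. unif01)) {u \<in> space (PiM UNIV (\<lambda>_. unif01)). \<forall>i\<in>J. (if i \<in> V then r i (u i) else (0::nat)) \<in> A i}"
    proof -
      have "emeasure (PiM I K) {U \<in> space (PiM I K). \<forall>i\<in>J. (if i \<in> V then h i (U (y i)) else (0::nat)) \<in> A i} =
          (\<Prod>i\<in>J. if i \<in> V then emeasure (distr (K (y i)) (count_space UNIV) (h i)) (A i) else indicator (A i) 0)"
        by (rule emeasure_PiM_coordinates) (use K y h J in auto)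
      also have "\<dots> = (\<Prod>i\<in>J. if i \<in> V then emeasure (distr unif01 (count_space UNIV) (r i)) (A i) else indicator (A i) 0)"
        by (intro prod.cong refl) (simp add: eq)
      also have "\<dots> = emeasure (PiM UNIV (\<lambda>_. unif01))
          {u \<in> space (PiM UNIV (\<lambda>_. unif01)). \<forall>i\<in>J. (if i \<in> V then r i (u (id i)) else (0::nat)) \<in> A i}"
        by (rule emeasure_PiM_coordinates[symmetric]) (use prob_space_unif01 r J in auto)
      finally show ?thesis by simp
    qed
    then show "emeasure (distr (PiM I K) (PiM UNIV (\<lambda>_. count_space UNIV)) (\<lambda>U i. if i \<in> V then h i (U (y i)) else (0::nat)))
        (prod_emb UNIV (\<lambda>_. count_space UNIV) J (Pi\<^sub>E J A)) =
      emeasure (distr (PiM UNIV (\<lambda>_. unif01)) (PiM UNIV (\<lambda>_. count_space UNIV)) (\<lambda>u i. if i \<in> V then r i (u i) else 0))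
        (prod_emb UNIV (\<lambda>_. count_space UNIV) J (Pi\<^sub>E J A))"
      unfolding emeasure_distr[OF m1 sets] emeasure_distr[OF m2 sets] vi .
  qed (auto intro: D.finite_measure_axioms)
qed

section \<open>Almost sure properties of the Poisson process\<close>

locale unit_poisson =
  fixes P :: "'w measure" and N :: "'w \<Rightarrow> 'a::euclidean_space set"
  assumes poisson: "poisson_point_process 1 P N"
begin

sublocale prob_space P using poisson by (rule poisson_prob_space)

lemma count_prob:
  assumes "B \<in> sets borel" "bounded B"
  shows "prob {\<omega> \<in> space P. card (N \<omega> \<inter> B) = k} =
     measure lborel B ^ k / fact k * exp (- measure lborel B)"
  using poisson_count_prob[OF poisson assms] by simp

lemma count_measurable[measurable]:
  assumes "B \<in> sets borel" "bounded B"
  shows "(\<lambda>\<omega>. card (N \<omega> \<inter> B)) \<in> P \<rightarrow>\<^sub>M count_space UNIV"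
  by (rule poisson_count_measurable[OF poisson assms])

lemma prob_point_le:
  assumes "B \<in> sets borel" "bounded B"
  shows "prob {\<omega> \<in> space P. 1 \<le> card (N \<omega> \<inter> B)} \<le> measure lborel B"
proof -
  note [measurable] = count_measurable[OF assms]
  have "{\<omega> \<in> space P. 1 \<le> card (N \<omega> \<inter> B)} = space P - {\<omega> \<in> space P. card (N \<omega> \<inter> B) = 0}" by auto
  then have "prob {\<omega> \<in> space P. 1 \<le> card (N \<omega> \<inter> B)} = 1 - exp (- measure lborel B)"
    using prob_compl[of "{\<omega> \<in> space P. card (N \<omega> \<inter> B) = 0}"] count_prob[OF assms, of 0] by simp
  also have "\<dots> \<le> measure lborel B" using exp_ge_add_one_self[of "- measure lborel B"] by linarith
  finally show ?thesis .
qed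

lemma prob_two_points_le:
  assumes "B \<in> sets borel" "bounded B"
  shows "prob {\<omega> \<in> space P. 2 \<le> card (N \<omega> \<inter> B)} \<le> (measure lborel B)\<^sup>2"
proof -
  note [measurable] = count_measurable[OF assms]
  let ?l = "measure lborel B"
  let ?A = "\<lambda>k. {\<omega> \<in> space P. card (N \<omega> \<inter> B) = k}"
  have "{\<omega> \<in> space P. 2 \<le> card (N \<omega> \<inter> B)} = space P - (?A 0 \<union> ?A 1)" by auto
  then have "prob {\<omega> \<in> space P. 2 \<le> card (N \<omega> \<inter> B)} = 1 - prob (?A 0 \<union> ?A 1)"
    using prob_compl[of "?A 0 \<union> ?A 1"] by simp
  also have "prob (?A 0 \<union> ?A 1) = prob (?A 0) + prob (?A 1)" by (rule finite_measure_Union) auto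
  also have "\<dots> = (1 + ?l) * exp (- ?l)" using count_prob[OF assms, of 0] count_prob[OF assms, of 1]
    by (simp add: distrib_right)
  also have "1 - (1 + ?l) * exp (- ?l) \<le> 1 - (1 + ?l) * (1 - ?l)"
    using exp_ge_add_one_self[of "- ?l"] by (intro diff_left_mono mult_left_mono) auto
  also have "\<dots> = ?l\<^sup>2" by (simp add: power2_eq_square algebra_simps)
  finally show ?thesis .
qed

lemma nn_integral_count:
  assumes "B \<in> sets borel" "bounded B"
  shows "(\<integral>\<^sup>+\<omega>. ennreal (real (card (N \<omega> \<inter> B))) \<partial>P) = ennreal (measure lborel B)"
proof -
  note [measurable] = count_measurable[OF assms]
  let ?l = "measure lborel B"
  let ?A = "\<lambda>k. {\<omega> \<in> space P. card (N \<omega> \<inter> B) = k}"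
  have "(\<integral>\<^sup>+\<omega>. ennreal (real (card (N \<omega> \<inter> B))) \<partial>P)
      = (\<integral>\<^sup>+\<omega>. (\<Sum>k. ennreal (real k) * indicator (?A k) \<omega>) \<partial>P)"
  proof (rule nn_integral_cong)
    fix \<omega> assume "\<omega> \<in> space P"
    then have "(\<Sum>k. ennreal (real k) * indicator (?A k) \<omega>) =
        (\<Sum>k\<in>{card (N \<omega> \<inter> B)}. ennreal (real k) * indicator (?A k) \<omega>)"
      by (intro suminf_finite) auto
    then show "ennreal (real (card (N \<omega> \<inter> B))) = (\<Sum>k. ennreal (real k) * indicator (?A k) \<omega>)"
      using \<open>\<omega> \<in> space P\<close> by simp
  qed
  also have "\<dots> = (\<Sum>k. ennreal (real k) * emeasure P (?A k))"
    by (subst nn_integral_suminf) (auto simp: nn_integral_cmult_indicator)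
  also have "\<dots> = (\<Sum>k. ennreal (real k * (?l ^ k / fact k * exp (- ?l))))"
    by (intro suminf_cong) (simp only: emeasure_eq_measure count_prob[OF assms],
        rule ennreal_mult[symmetric], auto)
  also have "\<dots> = ennreal ?l"
  proof -
    have "(\<lambda>k. ?l ^ k / fact k) sums exp ?l" using exp_converges[of ?l] by (simp add: divide_inverse_commute)
    then have 1: "(\<lambda>k. (?l * exp (- ?l)) * (?l ^ k / fact k)) sums ((?l * exp (- ?l)) * exp ?l)" by (rule sums_mult)
    have 2: "(?l * exp (- ?l)) * exp ?l = ?l" by (simp add: exp_minus)
    have 3: "(?l * exp (- ?l)) * (?l ^ k / fact k) = real (Suc k) * (?l ^ Suc k / fact (Suc k) * exp (- ?l))" for k
    proof -
      have "?l ^ k / fact k = real (Suc k) * (?l ^ k / fact (Suc k))"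
        by (simp add: fact_Suc del: of_nat_Suc)
      then show ?thesis by (simp only: power_Suc) (simp add: mult.assoc mult.left_commute)
    qed
    have "(\<lambda>k. real (Suc k) * (?l ^ Suc k / fact (Suc k) * exp (- ?l))) sums ?l"
      using 1 unfolding 2 3 .
    then have "(\<lambda>k. real k * (?l ^ k / fact k * exp (- ?l))) sums ?l" by (subst (asm) sums_Suc_iff) simp
    then show ?thesis by (intro suminf_ennreal_eq) auto
  qed
  finally show ?thesis .
qed

text \<open>
  The form in which null sets arise below: an exceptional event is contained in all \<open>A m\<close>, whose
  probabilities tend to zero.
\<close>

lemma AE_not_all_events:
  assumes A: "\<And>m::nat. A m \<in> events" and lim: "(\<lambda>m. prob (A m)) \<longlonglongrightarrow> 0"
  shows "AE \<omega> in P. \<exists>m. \<omega> \<notin> A m"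
proof -
  have "prob (\<Inter>m. A m) \<le> prob (A m)" for m by (rule finite_measure_mono) (use A in auto)
  then have "prob (\<Inter>m. A m) \<le> 0" by (intro LIMSEQ_le_const[OF lim]) auto
  then have "prob (\<Inter>m. A m) = 0" using measure_nonneg[of P "\<Inter>m. A m"] by linarith
  moreover have "(\<Inter>m. A m) \<in> events" using A by auto
  ultimately have "AE \<omega> in P. \<omega> \<notin> (\<Inter>m. A m)" using prob_eq_0 by blast
  then show ?thesis by eventually_elim blast
qed

text \<open>
  The balls \<open>ball ((k + R + 1) e) R\<close> lie beyond height \<open>k\<close> and have unbounded volume as \<open>R\<close> grows.
\<close>

lemma AE_unbounded:
  assumes e: "norm e = 1"
  shows "AE \<omega> in P. \<forall>k::nat. \<exists>Y\<in>N \<omega>. real k < Y \<bullet> e"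
  unfolding AE_all_countable
proof
  fix k :: nat
  let ?B = "\<lambda>R::nat. ball (real (k + R + 1) *\<^sub>R e) (real R) :: 'a set"
  define V where "V = unit_ball_vol (real DIM('a))"
  have V: "0 < V" unfolding V_def by simp
  have "AE \<omega> in P. \<exists>R. \<omega> \<notin> {\<omega> \<in> space P. card (N \<omega> \<inter> ?B R) = 0}"
  proof (rule AE_not_all_events)
    fix R :: nat
    have [measurable]: "(\<lambda>\<omega>. card (N \<omega> \<inter> ?B R)) \<in> P \<rightarrow>\<^sub>M count_space UNIV" by (rule count_measurable) auto
    show "{\<omega> \<in> space P. card (N \<omega> \<inter> ?B R) = 0} \<in> events" by measurable
  next
    have prob: "prob {\<omega> \<in> space P. card (N \<omega> \<inter> ?B R) = 0} = exp (- (V * real R ^ DIM('a)))" for R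
      using count_prob[of "?B R" 0] content_ball[of "real R" "real (k + R + 1) *\<^sub>R e"]
      by (simp add: V_def)
    have "filterlim (\<lambda>R::nat. V * real R ^ DIM('a)) at_top sequentially"
      by (intro filterlim_tendsto_pos_mult_at_top[OF tendsto_const V] filterlim_pow_at_top filterlim_real_sequentially) simp
    then have "filterlim (\<lambda>R::nat. - (V * real R ^ DIM('a))) at_bot sequentially" by (simp add: filterlim_uminus_at_top)
    then show "(\<lambda>R. prob {\<omega> \<in> space P. card (N \<omega> \<inter> ?B R) = 0}) \<longlonglongrightarrow> 0"
      unfolding prob by (rule filterlim_compose[OF exp_at_bot])
  qed
  then show "AE \<omega> in P. \<exists>Y\<in>N \<omega>. real k < Y \<bullet> e"
    using AE_space
  proof eventually_elim
    case (elim \<omega>)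
    then obtain R where "card (N \<omega> \<inter> ?B R) \<noteq> 0" by blast
    then have "N \<omega> \<inter> ?B R \<noteq> {}" by auto
    then obtain Y where Y: "Y \<in> N \<omega>" "dist (real (k + R + 1) *\<^sub>R e) Y < real R" by auto
    have "(real (k + R + 1) *\<^sub>R e - Y) \<bullet> e \<le> norm (real (k + R + 1) *\<^sub>R e - Y) * norm e"
      using norm_cauchy_schwarz by blast
    also have "\<dots> < real R" using Y(2) e by (simp add: dist_norm)
    finally have "real (k + R + 1) - Y \<bullet> e < real R"
      using e by (simp add: inner_diff_left power2_norm_eq_inner[symmetric])
    then show ?case using Y(1) by (intro bexI[of _ Y]) auto
  qed
qed

text \<open>
  Two points of equal height lie in a common slab of width \<open>1 / m\<close>, for every \<open>m\<close>.
\<close>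

definition slab :: "'a \<Rightarrow> nat \<Rightarrow> nat \<Rightarrow> int \<Rightarrow> 'a set" where
  "slab e R m j = {Y \<in> ball 0 (real R). \<lfloor>real m * (Y \<bullet> e)\<rfloor> = j}"

lemma slab_borel: "slab e R m j \<in> sets borel"
proof -
  have "slab e R m j = ball 0 (real R) \<inter> {Y \<in> space borel. \<lfloor>real m * (Y \<bullet> e)\<rfloor> = j}"
    by (auto simp: slab_def)
  also have "\<dots> \<in> sets borel" by measurable
  finally show ?thesis .
qed

lemma slab_bounded: "bounded (slab e R m j)"
  by (rule bounded_subset[of "ball 0 (real R)"]) (auto simp: slab_def)

text \<open>
  The ball of radius \<open>R + 1\<close> contains \<open>m\<close> disjoint translates of the slab, by multiples of \<open>e / m\<close>.
\<close>

lemma measure_slab_le: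
  assumes e: "norm e = 1" and m: "0 < m"
  shows "measure lborel (slab e R m j) \<le> measure lborel (ball (0::'a) (real R + 1)) / real m"
proof -
  let ?S = "\<lambda>i::nat. (\<lambda>v. v + (- (real i / real m)) *\<^sub>R e) -` slab e R m j"
  have sets: "?S i \<in> sets borel" for i by (rule vimage_translate_borel[OF slab_borel])
  have "e \<bullet> e = 1" using e by (simp add: power2_norm_eq_inner[symmetric])
  have floor: "\<lfloor>real m * (v \<bullet> e)\<rfloor> = j + int i" if "v \<in> ?S i" for v i
  proof -
    have "real m * ((v + (- (real i / real m)) *\<^sub>R e) \<bullet> e) = real m * (v \<bullet> e) - real i"
      using m \<open>e \<bullet> e = 1\<close> by (simp add: inner_left_distrib algebra_simps)
    then have "\<lfloor>real m * (v \<bullet> e) - real i\<rfloor> = j" using that by (simp add: slab_def)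
    then show ?thesis by linarith
  qed
  have sub: "?S i \<subseteq> ball 0 (real R + 1)" if "i < m" for i
  proof
    fix v assume "v \<in> ?S i"
    then have v: "norm (v + (- (real i / real m)) *\<^sub>R e) < real R" by (simp add: slab_def)
    have "norm v \<le> norm (v + (- (real i / real m)) *\<^sub>R e) + norm ((real i / real m) *\<^sub>R e)"
      using norm_triangle_ineq[of "v + (- (real i / real m)) *\<^sub>R e" "(real i / real m) *\<^sub>R e"] by simp
    also have "norm ((real i / real m) *\<^sub>R e) \<le> 1" using that e by simp
    finally show "v \<in> ball 0 (real R + 1)" using v by simp
  qed
  have fin: "emeasure lborel (?S i) \<noteq> \<infinity>" if "i < m" for i
    using emeasure_mono[OF sub[OF that], of lborel] emeasure_lborel_ball_finite[of "0::'a" "real R + 1"]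
    by (auto simp: top_unique less_top)
  have "measure lborel (?S i) = measure lborel (slab e R m j)" for i
    by (rule measure_lborel_translate[OF slab_borel])
  then have "real m * measure lborel (slab e R m j) = (\<Sum>i<m. measure lborel (?S i))"
    by (simp only: sum_constant card_lessThan)
  also have "\<dots> = measure lborel (\<Union>i<m. ?S i)"
  proof (rule measure_finite_Union[symmetric])
    show "disjoint_family_on ?S {..<m}"
      unfolding disjoint_family_on_def
    proof (intro ballI impI equals0I)
      fix i k v assume "i \<noteq> k" "v \<in> ?S i \<inter> ?S k"
      then show False using floor[of v i] floor[of v k] by simp
    qed
  qed (use sets fin in auto)
  also have "\<dots> \<le> measure lborel (ball (0::'a) (real R + 1))"
    by (rule measure_mono_fmeasurable) (use sub sets in \<open>auto simp: fmeasurable_def emeasure_bounded_finite[unfolded infinity_ennreal_def]\<close>)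
  finally show ?thesis using m by (simp add: field_simps)
qed

text \<open>
  There are \<open>2 m R + 2\<close> slabs of volume at most \<open>V / m\<close>, and each of them contains two points with
  probability at most \<open>(V / m)^2\<close>.  The sum of these bounds tends to zero as \<open>m\<close> grows.
\<close>

lemma AE_no_ties:
  assumes e: "norm e = 1"
  shows "AE \<omega> in P. inj_on (\<lambda>Y. Y \<bullet> e) (N \<omega>)"
proof -
  have "AE \<omega> in P. \<forall>R::nat. inj_on (\<lambda>Y. Y \<bullet> e) (N \<omega> \<inter> ball 0 (real R))"
    unfolding AE_all_countable
  proof
    fix R :: nat
    define V where "V = measure lborel (ball (0::'a) (real R + 1))"
    define J where "J m = {- int (m * R) - 1..int (m * R)}" for m :: nat
    define A where "A m = (\<Union>j\<in>J (Suc m). {\<omega> \<in> space P. 2 \<le> card (N \<omega> \<inter> slab e R (Suc m) j)})" for m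
    have ev: "{\<omega> \<in> space P. 2 \<le> card (N \<omega> \<inter> slab e R m j)} \<in> events" for m j
    proof -
      have [measurable]: "(\<lambda>\<omega>. card (N \<omega> \<inter> slab e R m j)) \<in> P \<rightarrow>\<^sub>M count_space UNIV"
        by (rule count_measurable[OF slab_borel slab_bounded])
      show ?thesis by measurable
    qed
    have bound: "prob (A m) \<le> (2 * real R + 2) * V\<^sup>2 / real (Suc m)" for m
    proof -
      have "prob (A m) \<le> (\<Sum>j\<in>J (Suc m). prob {\<omega> \<in> space P. 2 \<le> card (N \<omega> \<inter> slab e R (Suc m) j)})"
        unfolding A_def by (rule finite_measure_subadditive_finite) (use ev in \<open>auto simp: J_def\<close>)
      also have "\<dots> \<le> (\<Sum>j\<in>J (Suc m). (V / real (Suc m))\<^sup>2)"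
      proof (rule sum_mono)
        fix j
        have "prob {\<omega> \<in> space P. 2 \<le> card (N \<omega> \<inter> slab e R (Suc m) j)} \<le> (measure lborel (slab e R (Suc m) j))\<^sup>2"
          by (rule prob_two_points_le[OF slab_borel slab_bounded])
        also have "\<dots> \<le> (V / real (Suc m))\<^sup>2"
          unfolding V_def by (intro power_mono measure_slab_le e) auto
        finally show "prob {\<omega> \<in> space P. 2 \<le> card (N \<omega> \<inter> slab e R (Suc m) j)} \<le> (V / real (Suc m))\<^sup>2" .
      qed
      also have "\<dots> = (2 * real (Suc m) * real R + 2) * (V / real (Suc m))\<^sup>2"
      proof -
        have "card {- int a - 1..int a} = 2 * a + 2" for a :: nat
          unfolding card_atLeastAtMost_int by arith
        then have "card (J (Suc m)) = 2 * (Suc m * R) + 2" unfolding J_def .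
        then have "real (card (J (Suc m))) = 2 * (real (Suc m) * real R) + 2"
          by (simp only: of_nat_add of_nat_mult of_nat_numeral)
        then show ?thesis by (simp only: sum_constant mult.assoc)
      qed
      also have "\<dots> \<le> (real (Suc m) * (2 * real R + 2)) * (V / real (Suc m))\<^sup>2"
        by (intro mult_right_mono) (auto simp: algebra_simps)
      also have "\<dots> = (2 * real R + 2) * V\<^sup>2 / real (Suc m)"
      proof -
        have "(c * b) * (V / c)\<^sup>2 = b * V\<^sup>2 / c" if "0 < c" for b c :: real
          using that by (simp add: power2_eq_square)
        then show ?thesis by (metis of_nat_0_less_iff zero_less_Suc)
      qed
      finally show ?thesis .
    qed
    have "AE \<omega> in P. \<exists>m. \<omega> \<notin> A m"
    proof (rule AE_not_all_events)
      show "A m \<in> events" for m unfolding A_def using ev by (intro sets.finite_UN) (auto simp: J_def)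
      show "(\<lambda>m. prob (A m)) \<longlonglongrightarrow> 0"
      proof (rule tendsto_sandwich[OF always_eventually always_eventually])
        show "\<forall>m. 0 \<le> prob (A m)" "\<forall>m. prob (A m) \<le> (2 * real R + 2) * V\<^sup>2 / real (Suc m)"
          using bound by auto
        show "(\<lambda>m. (2 * real R + 2) * V\<^sup>2 / real (Suc m)) \<longlonglongrightarrow> 0"
          by (intro LIMSEQ_Suc lim_const_over_n)
      qed simp
    qed
    then show "AE \<omega> in P. inj_on (\<lambda>Y. Y \<bullet> e) (N \<omega> \<inter> ball 0 (real R))"
      using AE_space
    proof eventually_elim
      case (elim \<omega>)
      then obtain m where m: "\<omega> \<notin> A m" by blast
      show ?case
      proof (rule inj_onI, rule ccontr)
        fix Y Y' assume Y: "Y \<in> N \<omega> \<inter> ball 0 (real R)" "Y' \<in> N \<omega> \<inter> ball 0 (real R)" "Y \<bullet> e = Y' \<bullet> e" "Y \<noteq> Y'"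
        let ?j = "\<lfloor>real (Suc m) * (Y \<bullet> e)\<rfloor>"
        have "\<bar>Y \<bullet> e\<bar> \<le> norm Y * norm e" by (rule Cauchy_Schwarz_ineq2)
        also have "\<dots> \<le> real R" using Y e by simp
        finally have "\<bar>real (Suc m) * (Y \<bullet> e)\<bar> \<le> real (Suc m) * real R"
          unfolding abs_mult by (intro mult_mono) auto
        then have "\<bar>real (Suc m) * (Y \<bullet> e)\<bar> \<le> real (Suc m * R)" by (simp only: of_nat_mult)
        then have j: "?j \<in> J (Suc m)" unfolding J_def by (simp only: atLeastAtMost_iff) linarith
        have "{Y, Y'} \<subseteq> N \<omega> \<inter> slab e R (Suc m) ?j" using Y unfolding slab_def by auto
        moreover have "finite (N \<omega> \<inter> slab e R (Suc m) ?j)"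
          by (rule locfin_finite[OF poisson_locfin[OF poisson elim(2)] slab_bounded])
        ultimately have "card {Y, Y'} \<le> card (N \<omega> \<inter> slab e R (Suc m) ?j)" by (intro card_mono)
        then have "2 \<le> card (N \<omega> \<inter> slab e R (Suc m) ?j)" using Y(4) by simp
        then have "\<omega> \<in> A m" unfolding A_def using elim(2) j by blast
        then show False using m by blast
      qed
    qed
  qed
  then show ?thesis
  proof eventually_elim
    case (elim \<omega>)
    show ?case
    proof (rule inj_onI)
      fix Y Y' assume Y: "Y \<in> N \<omega>" "Y' \<in> N \<omega>" "Y \<bullet> e = Y' \<bullet> e"
      obtain R :: nat where "max (norm Y) (norm Y') < real R" using reals_Archimedean2 by blast
      then show "Y = Y'" using inj_onD[OF elim[rule_format, of R], of Y Y'] Y by simp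
    qed
  qed
qed

lemma AE_not_orthogonal:
  assumes e: "norm e = 1"
  shows "AE \<omega> in P. \<forall>Y\<in>N \<omega>. Y \<bullet> e \<noteq> 0"
proof -
  have "AE \<omega> in P. \<forall>R::nat. \<forall>Y\<in>N \<omega> \<inter> ball 0 (real R). Y \<bullet> e \<noteq> 0"
    unfolding AE_all_countable
  proof
    fix R :: nat
    define V where "V = measure lborel (ball (0::'a) (real R + 1))"
    define A where "A m = {\<omega> \<in> space P. 1 \<le> card (N \<omega> \<inter> slab e R (Suc m) 0)}" for m
    have "AE \<omega> in P. \<exists>m. \<omega> \<notin> A m"
    proof (rule AE_not_all_events)
      fix m
      have [measurable]: "(\<lambda>\<omega>. card (N \<omega> \<inter> slab e R (Suc m) 0)) \<in> P \<rightarrow>\<^sub>M count_space UNIV"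
        by (rule count_measurable[OF slab_borel slab_bounded])
      show "A m \<in> events" unfolding A_def by measurable
    next
      have "prob (A m) \<le> V / real (Suc m)" for m
        unfolding A_def V_def
        by (rule order_trans[OF prob_point_le[OF slab_borel slab_bounded] measure_slab_le[OF e]]) simp
      then show "(\<lambda>m. prob (A m)) \<longlonglongrightarrow> 0"
        by (intro tendsto_sandwich[OF always_eventually always_eventually tendsto_const LIMSEQ_Suc[OF lim_const_over_n]])
           auto
    qed
    then show "AE \<omega> in P. \<forall>Y\<in>N \<omega> \<inter> ball 0 (real R). Y \<bullet> e \<noteq> 0"
      using AE_space
    proof eventually_elim
      case (elim \<omega>)
      then obtain m where m: "card (N \<omega> \<inter> slab e R (Suc m) 0) = 0"
        by (auto simp: A_def not_less_eq_eq)
      moreover have "finite (N \<omega> \<inter> slab e R (Suc m) 0)"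
        by (rule locfin_finite[OF poisson_locfin[OF poisson elim(2)] slab_bounded])
      ultimately have "N \<omega> \<inter> slab e R (Suc m) 0 = {}" by simp
      then show ?case unfolding slab_def by auto
    qed
  qed
  then show ?thesis
  proof eventually_elim
    case (elim \<omega>)
    show ?case
    proof
      fix Y assume Y: "Y \<in> N \<omega>"
      obtain R :: nat where "norm Y < real R" using reals_Archimedean2 by blast
      then show "Y \<bullet> e \<noteq> 0" using elim Y by auto
    qed
  qed
qed

text \<open>
  The shell of points with \<open>1 + norm Y\<close> between \<open>2 ^ k\<close> and \<open>2 ^ (k + 1)\<close> has on average at most
  \<open>V 2 ^ ((k + 1) d)\<close> points, each contributing at most \<open>2 powr (- k \<beta>)\<close>: the expected sum is bounded
  by a geometric series, convergent for \<open>\<beta> > d\<close>.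
\<close>

lemma AE_bounded_sums:
  assumes \<beta>: "real DIM('a) < \<beta>"
  shows "AE \<omega> in P. bounded_sums (\<lambda>Y. (1 + norm Y) powr (- \<beta>)) (N \<omega>)"
proof -
  define \<kappa> where "\<kappa> Y = nat \<lfloor>log 2 (1 + norm Y)\<rfloor>" for Y :: 'a
  have \<kappa>: "2 ^ \<kappa> Y \<le> 1 + norm Y" "1 + norm Y < 2 ^ Suc (\<kappa> Y)" for Y
  proof -
    have "0 \<le> log 2 (1 + norm Y)" by (subst zero_le_log_cancel_iff) (auto simp: add_pos_nonneg)
    then have "real (\<kappa> Y) \<le> log 2 (1 + norm Y)" "log 2 (1 + norm Y) < real (Suc (\<kappa> Y))"
      unfolding \<kappa>_def by linarith+
    moreover have "0 < 1 + norm Y" by (simp add: add_pos_nonneg)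
    ultimately have "2 powr real (\<kappa> Y) \<le> 1 + norm Y" "1 + norm Y < 2 powr real (Suc (\<kappa> Y))"
      by (simp_all add: le_log_iff log_less_iff)
    then show "2 ^ \<kappa> Y \<le> 1 + norm Y" "1 + norm Y < 2 ^ Suc (\<kappa> Y)"
      by (simp_all only: powr_realpow zero_less_numeral)
  qed
  define S where "S k = {Y::'a. \<kappa> Y = k}" for k
  define w :: "nat \<Rightarrow> real" where "w k = (2 ^ k) powr (- \<beta>)" for k
  have sub: "S k \<subseteq> ball 0 (2 ^ Suc k)" for k
  proof
    fix Y assume "Y \<in> S k"
    then have "1 + norm Y < 2 ^ Suc k" using \<kappa>(2)[of Y] by (simp add: S_def)
    then show "Y \<in> ball 0 (2 ^ Suc k)" by simp
  qed
  have bdd: "bounded (S k)" for k by (rule bounded_subset[OF bounded_ball sub])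
  have borel: "S k \<in> sets borel" for k
  proof -
    have [measurable]: "\<kappa> \<in> borel \<rightarrow>\<^sub>M count_space UNIV" unfolding \<kappa>_def by measurable
    have "S k = \<kappa> -` {k} \<inter> space borel" by (auto simp: S_def)
    also have "\<dots> \<in> sets borel" by measurable
    finally show ?thesis .
  qed
  note [measurable] = count_measurable[OF borel bdd]
  define V where "V = unit_ball_vol (real DIM('a))"
  have V: "0 \<le> V" unfolding V_def by simp
  let ?q = "2 powr (real DIM('a) - \<beta>)"
  have vol: "w k * measure lborel (S k) \<le> V * 2 ^ DIM('a) * ?q ^ k" for k
  proof -
    have "measure lborel (S k) \<le> measure lborel (ball (0::'a) (2 ^ Suc k))"
      by (rule measure_mono_fmeasurable)
         (use sub borel in \<open>auto simp: fmeasurable_def emeasure_bounded_finite[unfolded infinity_ennreal_def]\<close>)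
    also have "\<dots> = V * (2 ^ Suc k) ^ DIM('a)" using content_ball[of "2 ^ Suc k" "0::'a"] by (simp add: V_def)
    finally have "w k * measure lborel (S k) \<le> w k * (V * (2 ^ Suc k) ^ DIM('a))"
      by (intro mult_left_mono) (auto simp: w_def)
    also have "\<dots> = V * 2 ^ DIM('a) * ((2 ^ k) ^ DIM('a) * w k)" by (simp add: power_mult_distrib)
    also have "(2 ^ k) ^ DIM('a) * w k = ?q ^ k"
    proof -
      have "((2::real) ^ k) ^ DIM('a) = (2 powr real k) powr real DIM('a)" by (simp add: powr_realpow)
      moreover have "w k = (2 powr real k) powr (- \<beta>)" by (simp add: w_def powr_realpow)
      moreover have "?q ^ k = ?q powr real k" by (simp add: powr_realpow)
      ultimately show ?thesis by (simp add: powr_powr powr_add[symmetric] algebra_simps)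
    qed
    finally show ?thesis .
  qed
  have q: "?q < 1" using \<beta> powr_less_mono[of "real DIM('a) - \<beta>" 0 2] by simp
  have "(\<integral>\<^sup>+\<omega>. (\<Sum>k. ennreal (w k) * ennreal (real (card (N \<omega> \<inter> S k)))) \<partial>P)
      = (\<Sum>k. ennreal (w k) * ennreal (measure lborel (S k)))"
  proof -
    have [measurable]: "(\<lambda>\<omega>. ennreal (real (card (N \<omega> \<inter> S k)))) \<in> borel_measurable P" for k
      by (rule measurable_compose[OF count_measurable[OF borel bdd]]) simp
    have "(\<integral>\<^sup>+\<omega>. (\<Sum>k. ennreal (w k) * ennreal (real (card (N \<omega> \<inter> S k)))) \<partial>P)
        = (\<Sum>k. \<integral>\<^sup>+\<omega>. ennreal (w k) * ennreal (real (card (N \<omega> \<inter> S k))) \<partial>P)"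
      by (rule nn_integral_suminf) measurable
    moreover have "(\<integral>\<^sup>+\<omega>. ennreal (w k) * ennreal (real (card (N \<omega> \<inter> S k))) \<partial>P)
        = ennreal (w k) * ennreal (measure lborel (S k))" for k
      unfolding nn_integral_count[OF borel bdd, symmetric] by (rule nn_integral_cmult) measurable
    ultimately show ?thesis by (simp only:)
  qed
  also have "\<dots> = (\<Sum>k. ennreal (w k * measure lborel (S k)))"
    by (intro suminf_cong) (simp add: ennreal_mult w_def)
  also have "\<dots> \<le> (\<Sum>k. ennreal (V * 2 ^ DIM('a) * ?q ^ k))"
    by (intro suminf_le ennreal_leI vol) auto
  also have "\<dots> < \<infinity>"
  proof -
    have "summable (\<lambda>k. V * 2 ^ DIM('a) * ?q ^ k)" using q by (intro summable_mult summable_geometric) auto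
    then have "(\<Sum>k. ennreal (V * 2 ^ DIM('a) * ?q ^ k)) \<noteq> top"
      by (intro ennreal_suminf_neq_top) (use V in auto)
    then show ?thesis by (simp add: less_top)
  qed
  finally have "(\<integral>\<^sup>+\<omega>. (\<Sum>k. ennreal (w k) * ennreal (real (card (N \<omega> \<inter> S k)))) \<partial>P) \<noteq> \<infinity>"
    by (simp add: less_top)
  moreover have "(\<lambda>\<omega>. \<Sum>k. ennreal (w k) * ennreal (real (card (N \<omega> \<inter> S k)))) \<in> borel_measurable P"
  proof -
    have [measurable]: "(\<lambda>\<omega>. ennreal (real (card (N \<omega> \<inter> S k)))) \<in> borel_measurable P" for k
      by (rule measurable_compose[OF count_measurable[OF borel bdd]]) simp
    show ?thesis by measurable
  qed
  ultimately have "AE \<omega> in P. (\<Sum>k. ennreal (w k) * ennreal (real (card (N \<omega> \<inter> S k)))) \<noteq> \<infinity>"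
    by (intro nn_integral_PInf_AE)
  then show ?thesis
    using AE_space
  proof eventually_elim
    case (elim \<omega>)
    let ?T = "\<Sum>k. ennreal (w k) * ennreal (real (card (N \<omega> \<inter> S k)))"
    show ?case unfolding bounded_sums_def
    proof (intro exI[of _ "enn2real ?T"] allI impI, elim conjE)
      fix F assume F: "finite F" "F \<subseteq> N \<omega>"
      obtain K where K: "\<kappa> ` F \<subseteq> {..<K}" using F finite_nat_set_iff_bounded[of "\<kappa> ` F"] by auto
      have "(\<Sum>Y\<in>F. (1 + norm Y) powr (- \<beta>)) \<le> (\<Sum>Y\<in>F. w (\<kappa> Y))"
      proof (rule sum_mono)
        fix Y
        have "0 < \<beta>" using \<beta> by (meson less_trans of_nat_0_less_iff DIM_positive)
        then show "(1 + norm Y) powr (- \<beta>) \<le> w (\<kappa> Y)" unfolding w_def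
          using \<kappa>(1)[of Y] by (intro powr_mono2') auto
      qed
      also have "\<dots> = (\<Sum>k<K. \<Sum>Y\<in>{Y \<in> F. \<kappa> Y = k}. w (\<kappa> Y))"
        by (rule sum.group[symmetric]) (use F K in auto)
      also have "\<dots> = (\<Sum>k<K. w k * real (card {Y \<in> F. \<kappa> Y = k}))" by (intro sum.cong) auto
      also have "\<dots> \<le> (\<Sum>k<K. w k * real (card (N \<omega> \<inter> S k)))"
      proof (intro sum_mono mult_left_mono)
        fix k
        have "finite (N \<omega> \<inter> S k)" by (rule locfin_finite[OF poisson_locfin[OF poisson elim(2)] bdd])
        then show "real (card {Y \<in> F. \<kappa> Y = k}) \<le> real (card (N \<omega> \<inter> S k))"
          using F(2) by (intro of_nat_mono card_mono) (auto simp: S_def)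
      qed (simp add: w_def)
      finally have "ennreal (\<Sum>Y\<in>F. (1 + norm Y) powr (- \<beta>)) \<le> ennreal (\<Sum>k<K. w k * real (card (N \<omega> \<inter> S k)))"
        by (rule ennreal_leI)
      also have "\<dots> = (\<Sum>k<K. ennreal (w k) * ennreal (real (card (N \<omega> \<inter> S k))))"
        by (subst sum_ennreal[symmetric]) (auto simp: w_def ennreal_mult)
      also have "\<dots> \<le> ?T" by (rule sum_le_suminf) auto
      finally show "(\<Sum>Y\<in>F. (1 + norm Y) powr (- \<beta>)) \<le> enn2real ?T"
        using elim(1) by (metis ennreal_enn2real ennreal_le_iff enn2real_nonneg infinity_ennreal_def less_top)
    qed
  qed
qed

end

section \<open>The navigation tree as a function of points and uniform variables\<close>

abbreviation unif_seq :: "(nat \<Rightarrow> real) measure" where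
  "unif_seq \<equiv> PiM UNIV (\<lambda>_. unif01)"

lemma prob_space_unif_seq: "prob_space unif_seq"
  by (rule prob_space_PiM) (rule prob_space_unif01)

lemma measurable_unif_seq_component[measurable]: "(\<lambda>u. u i) \<in> borel_measurable unif_seq"
  using measurable_component_singleton[of i UNIV "\<lambda>_. unif01"]
    measurable_cong_sets[of unif_seq unif_seq unif01 borel] by simp

text \<open>
  The choice \<open>0\<close> at a used index is turned into the code of no choice, so that every sequence of
  choices yields an element of \<open>configs\<close>.
\<close>

definition code_config :: "'a::euclidean_space set \<Rightarrow> (nat \<Rightarrow> nat) \<Rightarrow> nat \<Rightarrow> 'a \<times> nat \<times> nat" where
  "code_config M a i = (pt M i, if valid M i then (if a i = 0 then Suc i else a i) else 0, bnd M i)"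

lemma code_config_simps:
  "cpos (code_config M a) = pt M" "cbound (code_config M a) = bnd M"
  "cnav (code_config M a) i = (if valid M i then (if a i = 0 then Suc i else a i) else 0)"
  "idx (code_config M a) = {i. valid M i}"
  by (auto simp: code_config_def cpos_def cnav_def cbound_def idx_def fun_eq_iff)

lemma code_config_configs:
  assumes "M \<in> locfin" "0 \<in> M"
  shows "code_config M a \<in> configs"
  using valid_0[OF assms(2)] inj_on_pt[of M] less_bnd[OF assms(1)]
  by (simp add: configs_def code_config_simps)

lemma measurable_nat_borel: "(g \<in> M \<rightarrow>\<^sub>M (borel :: nat measure)) \<longleftrightarrow> g \<in> M \<rightarrow>\<^sub>M count_space UNIV"
proof -
  have "measurable M (borel :: nat measure) = measurable M (count_space UNIV)"
    by (rule measurable_cong_sets) (simp_all add: sets_borel_eq_count_space)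
  then show ?thesis by simp
qed

lemma measurable_code_config:
  assumes F[measurable]: "F \<in> L \<rightarrow>\<^sub>M point_space" and a[measurable]: "\<And>i. (\<lambda>x. a x i) \<in> L \<rightarrow>\<^sub>M count_space UNIV"
  shows "(\<lambda>x. code_config (F x) (a x)) \<in> borel_measurable L"
proof (rule measurable_coordinatewise_then_product)
  fix i
  have 1: "(\<lambda>x. pt (F x) i) \<in> borel_measurable L"
    by (rule measurable_compose[OF F measurable_pt])
  have 2: "(\<lambda>x. if valid (F x) i then (if a x i = 0 then Suc i else a x i) else 0) \<in> L \<rightarrow>\<^sub>M count_space UNIV"
    by measurable
  have 3: "(\<lambda>x. bnd (F x) i) \<in> L \<rightarrow>\<^sub>M count_space UNIV"
    by (rule measurable_compose[OF F measurable_bnd])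
  show "(\<lambda>x. code_config (F x) (a x) i) \<in> borel_measurable L"
    unfolding code_config_def
    by (intro borel_measurable_Pair 1 2[folded measurable_nat_borel] 3[folded measurable_nat_borel])
qed

locale decreasing_connection = connection +
  assumes decreasing: "antimono_on {0..} f"
begin

lemma measurable_f_dist[measurable]:
  assumes [measurable]: "X \<in> borel_measurable L" "Y \<in> borel_measurable L"
  shows "(\<lambda>x. f (dist (X x) (Y x :: 'a::euclidean_space))) \<in> borel_measurable L"
proof -
  have "mono (\<lambda>t. - f (max 0 t))"
    by (rule monoI) (use decreasing in \<open>auto simp: monotone_on_def\<close>)
  then have [measurable]: "(\<lambda>t. - f (max 0 t)) \<in> borel_measurable borel" by (rule borel_measurable_mono)
  have "(\<lambda>x. - (- f (max 0 (dist (X x) (Y x))))) \<in> borel_measurable L"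
    by (rule borel_measurable_uminus, rule measurable_compose[of _ _ borel "\<lambda>t. - f (max 0 t)"]) measurable
  then show ?thesis by simp
qed

text \<open>
  Writing the infinite product as a limit along the enumeration makes it a measurable function of the
  point set.
\<close>

lemma miss_enumeration:
  assumes M: "M \<in> locfin"
  shows "(\<lambda>K. \<Prod>k<K. if valid M k \<and> \<phi> (pt M k) then 1 - f (dist X (pt M k)) else 1)
     \<longlonglongrightarrow> miss f X {Z \<in> M. \<phi> Z}"
proof -
  define F where "F K = pt M ` {k \<in> {..<K}. valid M k \<and> \<phi> (pt M k)}" for K
  have "(\<lambda>K. \<Prod>Y\<in>F K. 1 - f (dist X Y)) \<longlonglongrightarrow> miss f X {Z \<in> M. \<phi> Z}"
  proof (rule miss_exhaust)
    show "incseq F" by (auto simp: F_def incseq_def)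
    show "(\<Union>K. F K) = {Z \<in> M. \<phi> Z}"
    proof (intro equalityI subsetI)
      fix Z assume Z: "Z \<in> {Z \<in> M. \<phi> Z}"
      then obtain k where "valid M k" "pt M k = Z" using pt_surj[OF M] by blast
      then have "Z \<in> F (Suc k)" using Z by (auto simp: F_def)
      then show "Z \<in> (\<Union>K. F K)" by blast
    qed (use valid_pt_mem in \<open>auto simp: F_def\<close>)
  qed (simp add: F_def)
  moreover have "(\<Prod>Y\<in>F K. 1 - f (dist X Y)) = (\<Prod>k<K. if valid M k \<and> \<phi> (pt M k) then 1 - f (dist X (pt M k)) else 1)" for K
  proof -
    have "inj_on (pt M) {k \<in> {..<K}. valid M k \<and> \<phi> (pt M k)}" by (rule inj_on_subset[OF inj_on_pt]) auto
    then have "(\<Prod>Y\<in>F K. 1 - f (dist X Y)) = (\<Prod>k\<in>{k \<in> {..<K}. valid M k \<and> \<phi> (pt M k)}. 1 - f (dist X (pt M k)))"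
      unfolding F_def by (simp only: prod.reindex comp_def)
    then show ?thesis by (simp only: prod.inter_filter[OF finite_lessThan])
  qed
  ultimately show ?thesis by simp
qed

lemma measurable_miss:
  assumes [measurable]: "\<And>k. Measurable.pred point_space (\<lambda>M. \<phi> M (pt M k))"
  shows "(\<lambda>M. miss f (pt M i) {Z \<in> M. \<phi> M Z}) \<in> borel_measurable point_space"
proof (rule borel_measurable_LIMSEQ_real)
  fix M :: "'a set" assume "M \<in> space point_space"
  then show "(\<lambda>K. \<Prod>k<K. if valid M k \<and> \<phi> M (pt M k) then 1 - f (dist (pt M i) (pt M k)) else 1)
     \<longlonglongrightarrow> miss f (pt M i) {Z \<in> M. \<phi> M Z}"
    using miss_enumeration[of M "\<phi> M"] by (simp add: space_point_space)
next
  show "(\<lambda>M. \<Prod>k<K. if valid M k \<and> \<phi> M (pt M k) then 1 - f (dist (pt M i) (pt M k)) else 1)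
      \<in> borel_measurable point_space" for K
    by measurable
qed

text \<open>
  The matrix of choice probabilities in terms of indices.  Points of \<open>T\<close> make no choice, like
  the target of the small-world navigation.
\<close>

definition navq :: "('a::euclidean_space \<Rightarrow> real) \<Rightarrow> 'a set \<Rightarrow> 'a set \<Rightarrow> nat \<Rightarrow> nat \<Rightarrow> real" where
  "navq \<kappa> T M i j = (if pt M i \<in> T \<or> \<not> valid M j then 0 else navp f \<kappa> M (pt M i) (pt M j))"

lemma measurable_navq[measurable]:
  assumes [measurable]: "\<kappa> \<in> borel_measurable borel" "T \<in> sets borel"
  shows "(\<lambda>M. navq \<kappa> T M i j) \<in> borel_measurable point_space"
proof -
  have [measurable]: "(\<lambda>M. up_prob f \<kappa> M (pt M i)) \<in> borel_measurable point_space"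
    unfolding up_prob_def by (intro borel_measurable_diff borel_measurable_const measurable_miss) measurable
  have [measurable]: "(\<lambda>M. hit f \<kappa> M (pt M i) (pt M j)) \<in> borel_measurable point_space"
    unfolding hit_def by (intro borel_measurable_times measurable_miss) measurable
  have "navq \<kappa> T M i j = (if pt M i \<in> T \<or> \<not> valid M j \<or> pt M j = pt M i then 0
      else if up_prob f \<kappa> M (pt M i) = 0 then hit f \<kappa> M (pt M i) (pt M j)
      else if \<kappa> (pt M i) < \<kappa> (pt M j) then hit f \<kappa> M (pt M i) (pt M j) / up_prob f \<kappa> M (pt M i) else 0)" for M
    using valid_pt_mem[of M j] by (auto simp: navq_def navp_def)
  then show ?thesis by simp
qed

lemma navq_nonneg: "0 \<le> navq \<kappa> T M i j" by (simp add: navq_def navp_nonneg)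

definition nav_codes :: "('a::euclidean_space \<Rightarrow> real) \<Rightarrow> 'a set \<Rightarrow> 'a set \<Rightarrow> (nat \<Rightarrow> real) \<Rightarrow> nat \<Rightarrow> nat" where
  "nav_codes \<kappa> T M u i = (if valid M i then quant i (navq \<kappa> T M i) (u i) else 0)"

definition nav_tree :: "('a::euclidean_space \<Rightarrow> real) \<Rightarrow> 'a set \<Rightarrow> 'a set \<Rightarrow> (nat \<Rightarrow> real) \<Rightarrow> 'a rooted_graph" where
  "nav_tree \<kappa> T M u = ctree (code_config M (nav_codes \<kappa> T M u))"

lemma measurable_nav_tree:
  fixes F :: "'a::euclidean_space set \<Rightarrow> 'a set"
  assumes F: "F \<in> point_space \<rightarrow>\<^sub>M point_space" "\<And>L. 0 \<in> F L"
    and [measurable]: "\<kappa> \<in> borel_measurable borel" "T \<in> sets borel"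
  shows "(\<lambda>(L, u). nav_tree \<kappa> T (F L) u) \<in> point_space \<Otimes>\<^sub>M unif_seq \<rightarrow>\<^sub>M local_borel"
  unfolding nav_tree_def split_beta
proof (rule measurable_ctree)
  note [measurable] = F(1)
  have [measurable]: "(\<lambda>x. nav_codes \<kappa> T (F (fst x)) (snd x) i) \<in> point_space \<Otimes>\<^sub>M unif_seq \<rightarrow>\<^sub>M count_space UNIV" for i
    unfolding nav_codes_def by measurable
  show "(\<lambda>x. code_config (F (fst x)) (nav_codes \<kappa> T (F (fst x)) (snd x))) \<in> borel_measurable (point_space \<Otimes>\<^sub>M unif_seq)"
    by (rule measurable_code_config) measurable
  fix x :: "'a set \<times> (nat \<Rightarrow> real)" assume "x \<in> space (point_space \<Otimes>\<^sub>M unif_seq)"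
  then have "fst x \<in> space point_space" by (auto simp: space_pair_measure)
  then have "F (fst x) \<in> locfin" using measurable_space[OF F(1)] by (simp add: space_point_space)
  then show "code_config (F (fst x)) (nav_codes \<kappa> T (F (fst x)) (snd x)) \<in> configs"
    by (rule code_config_configs[OF _ F(2)])
qed

definition key_nav_on :: "('a::euclidean_space \<Rightarrow> real) \<Rightarrow> 'a set \<Rightarrow> 'a set \<Rightarrow> ('a \<Rightarrow> 'a \<Rightarrow> real) \<Rightarrow> 'a \<Rightarrow> 'a" where
  "key_nav_on \<kappa> T M U X = (if X \<in> T then X else key_nav f \<kappa> M X (U X))"

text \<open>
  The law of the navigation graph depends on the marks only through the choices, whose codes are
  independent with marginals given by \<open>navq\<close>.  The set \<open>M0\<close> consists of the translated points, among
  which the root is the origin; distances, and with them the choice probabilities, do not change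
  under the translation.
\<close>

lemma nav_graph_law:
  fixes \<kappa> :: "'a::euclidean_space \<Rightarrow> real"
  assumes M0: "M0 \<in> locfin" "0 \<in> M0" and M: "M = (\<lambda>v. v + z) ` M0"
  shows "distr (PiM M (key_row f \<kappa> M)) local_borel
      (\<lambda>U. rooted_at_origin (translate (- z) (nav_graph M (key_nav_on \<kappa> T M U)))) =
    distr unif_seq local_borel (nav_tree (\<lambda>v. \<kappa> (v + z)) {v. v + z \<in> T} M0)"
proof -
  have cM: "countable M" unfolding M using locfin_countable[OF M0(1)] by simp
  define V where "V = {i. valid M0 i}"
  define y where "y i = pt M0 i + z" for i
  define q where "q = navq (\<lambda>v. \<kappa> (v + z)) {v. v + z \<in> T} M0"
  define ix where "ix v = the_inv_into V (pt M0) (v - z)" for v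
  define h where "h i w = Suc (if y i \<in> T then i else ix (key_nav f \<kappa> M (y i) w))" for i w
  have injV: "inj_on (pt M0) V" unfolding V_def by (rule inj_on_pt)
  have "y ` V = (\<lambda>v. v + z) ` pt M0 ` V" by (simp add: y_def image_image)
  also have "\<dots> = M" unfolding M V_def pt_image[OF M0(1)] ..
  finally have y: "inj_on y V" "y ` V = M"
    using injV unfolding y_def by (auto simp: inj_on_def)
  have ix: "ix (y i) = i" if "i \<in> V" for i
    unfolding ix_def y_def using the_inv_into_f_f[OF injV that] by simp
  have yix: "ix v \<in> V \<and> y (ix v) = v" if "v \<in> M" for v
    using that ix unfolding y(2)[symmetric] by auto
  have nav_M: "key_nav f \<kappa> M (y i) w \<in> M" if "i \<in> V" for i w
    using key_nav_range[of \<kappa> M "y i" w] that y(2) by blast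
  have h_eq: "h i w = Suc j \<longleftrightarrow> (if y i \<in> T then y i else key_nav f \<kappa> M (y i) w) = y j" if "i \<in> V" "j \<in> V" for i j w
    using that ix[OF that(1)] ix[OF that(2)] yix[OF nav_M[OF that(1), of w]] y(1)
    unfolding h_def by (auto simp: inj_on_def)
  have h_V: "h i w = Suc j \<Longrightarrow> i \<in> V \<Longrightarrow> j \<in> V" for i j w
    using yix[OF nav_M, of i w] unfolding h_def by (auto split: if_splits)
  have h_meas: "h i \<in> key_row f \<kappa> M (y i) \<rightarrow>\<^sub>M count_space UNIV" if i: "i \<in> V" for i
  proof (cases "y i \<in> T")
    case False
    have sets: "{w \<in> space (key_row f \<kappa> M (y i)). key_nav f \<kappa> M (y i) w = v} \<in> sets (key_row f \<kappa> M (y i))" for v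
      using key_nav_sets[OF cM] by (simp add: key_row_def sets_conditioned)
    have "h i -` {k} \<inter> space (key_row f \<kappa> M (y i)) \<in> sets (key_row f \<kappa> M (y i))" for k
    proof (cases "\<exists>j\<in>V. k = Suc j")
      case True
      then obtain j where "j \<in> V" "k = Suc j" by blast
      then have "h i -` {k} \<inter> space (key_row f \<kappa> M (y i)) =
          {w \<in> space (key_row f \<kappa> M (y i)). key_nav f \<kappa> M (y i) w = y j}"
        using h_eq[OF i] False by auto
      then show ?thesis using sets by simp
    next
      case False
      have "h i w \<noteq> k" for w
        using False h_V[OF _ i] by (cases k) (auto simp: h_def)
      then have "h i -` {k} \<inter> space (key_row f \<kappa> M (y i)) = {}" by blast
      then show ?thesis by (simp only: sets.empty_sets)
    qed
    then show ?thesis by (subst measurable_count_space_eq2_countable) auto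
  next
    case True
    then have "h i = (\<lambda>_. Suc i)" by (simp add: h_def fun_eq_iff)
    then show ?thesis by simp
  qed
  have h_law: "distr (key_row f \<kappa> M (y i)) (count_space UNIV) (h i) = distr unif01 (count_space UNIV) (quant i (q i))"
    if i: "i \<in> V" for i
  proof (rule quant_law[OF prob_space_key_row h_meas[OF i]])
    fix j assume "j \<noteq> i"
    show "measure (key_row f \<kappa> M (y i)) {w \<in> space (key_row f \<kappa> M (y i)). h i w = Suc j} = q i j"
    proof (cases "j \<in> V \<and> y i \<notin> T")
      case True
      then have ne: "y j \<noteq> y i" using y(1) i \<open>j \<noteq> i\<close> by (auto simp: inj_on_def)
      have "y j \<in> M" using True y(2) by blast
      have "{w \<in> space (key_row f \<kappa> M (y i)). h i w = Suc j} =
          {w \<in> space (key_row f \<kappa> M (y i)). key_nav f \<kappa> M (y i) w = y j}"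
        using h_eq[OF i, of j] True by simp
      then have "measure (key_row f \<kappa> M (y i)) {w \<in> space (key_row f \<kappa> M (y i)). h i w = Suc j} = navp f \<kappa> M (y i) (y j)"
        using key_nav_prob[OF cM \<open>y j \<in> M\<close> ne] by simp
      also have "\<dots> = q i j"
        using True unfolding q_def navq_def y_def V_def M navp_translate by simp
      finally show ?thesis .
    next
      case False
      have "h i w \<noteq> Suc j" for w
      proof
        assume w: "h i w = Suc j"
        then have "j \<in> V" by (rule h_V[OF _ i])
        then have "y i \<in> T" using False by blast
        then show False using w \<open>j \<noteq> i\<close> by (simp add: h_def)
      qed
      moreover have "pt M0 i \<in> {v. v + z \<in> T} \<or> \<not> valid M0 j" using False by (auto simp: y_def V_def)
      then have "q i j = 0" unfolding q_def navq_def by (simp only: if_True)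
      ultimately show ?thesis by simp
    qed
  next
    show "q i i = 0" by (simp add: q_def navq_def navp_def)
  qed (simp add: h_def)
  let ?C = "PiM UNIV (\<lambda>_. count_space UNIV) :: (nat \<Rightarrow> nat) measure"
  let ?A = "\<lambda>U i. if i \<in> V then h i (U (y i)) else 0"
  let ?B = "\<lambda>u i. if i \<in> V then quant i (q i) (u i) else 0"
  let ?G = "\<lambda>a. ctree (code_config M0 a)"
  note quant_meas = measurable_quant_unif01
  have law: "distr (PiM M (key_row f \<kappa> M)) ?C ?A = distr unif_seq ?C ?B"
    by (rule distr_PiM_coordinates)
       (use y h_meas h_law prob_space_key_row quant_meas in auto)
  have A: "?A \<in> PiM M (key_row f \<kappa> M) \<rightarrow>\<^sub>M ?C"
  proof (rule measurable_PiM_single')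
    fix i
    show "(\<lambda>U. if i \<in> V then h i (U (y i)) else 0) \<in> PiM M (key_row f \<kappa> M) \<rightarrow>\<^sub>M count_space UNIV"
    proof (cases "i \<in> V")
      case True
      have "(\<lambda>U. U (y i)) \<in> PiM M (key_row f \<kappa> M) \<rightarrow>\<^sub>M key_row f \<kappa> M (y i)"
        using True y(2) by (intro measurable_component_singleton) auto
      from measurable_compose[OF this h_meas[OF True]] True show ?thesis by simp
    qed simp
  qed (simp add: space_PiM)
  have B: "?B \<in> unif_seq \<rightarrow>\<^sub>M ?C"
  proof (rule measurable_PiM_single')
    fix i
    have "(\<lambda>u. u i) \<in> unif_seq \<rightarrow>\<^sub>M unif01" by (intro measurable_component_singleton) simp
    from measurable_compose[OF this quant_meas[of i]]
    show "(\<lambda>u. if i \<in> V then quant i (q i) (u i) else 0) \<in> unif_seq \<rightarrow>\<^sub>M count_space UNIV" by simp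
  qed (simp add: space_PiM)
  have G: "?G \<in> ?C \<rightarrow>\<^sub>M local_borel"
  proof (rule measurable_ctree)
    have M0': "(\<lambda>_. M0) \<in> ?C \<rightarrow>\<^sub>M point_space" using M0(1) by (intro measurable_const) (simp add: space_point_space)
    show "code_config M0 \<in> borel_measurable ?C"
      using measurable_code_config[OF M0', of "\<lambda>a. a"] by (simp add: measurable_component_singleton)
  qed (rule code_config_configs[OF M0])
  have graph: "rooted_at_origin (translate (- z) (nav_graph M (key_nav_on \<kappa> T M U))) = ?G (?A U)" for U
  proof -
    have "(\<lambda>v. v + - z) ` M = pt M0 ` V" unfolding M pt_image[OF M0(1), folded V_def] by (simp add: image_image)
    moreover have "map_prod (\<lambda>v. v + - z) (\<lambda>v. v + - z) ` snd (nav_graph M (key_nav_on \<kappa> T M U)) =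
       map_prod (pt M0) (pt M0) ` links (code_config M0 (?A U))"
    proof -
      have key: "key_nav_on \<kappa> T M U (y i) = y j \<longleftrightarrow> h i (U (y i)) = Suc j" if "i \<in> V" "j \<in> V" for i j
        using h_eq[OF that] by (simp add: key_nav_on_def)
      have "snd (nav_graph M (key_nav_on \<kappa> T M U)) = map_prod y y ` {(i, j). i \<in> V \<and> j \<in> V \<and> i \<noteq> j \<and>
          (h i (U (y i)) = Suc j \<or> h j (U (y j)) = Suc i)}" (is "_ = _ ` ?L")
      proof (intro equalityI subsetI)
        fix p assume "p \<in> snd (nav_graph M (key_nav_on \<kappa> T M U))"
        then obtain v w where p: "p = (v, w)" "v \<in> M" "w \<in> M" "v \<noteq> w"
          "key_nav_on \<kappa> T M U v = w \<or> key_nav_on \<kappa> T M U w = v" by (auto simp: nav_graph_def)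
        then obtain i j where ij: "i \<in> V" "j \<in> V" "v = y i" "w = y j" unfolding y(2)[symmetric] by blast
        then have "(i, j) \<in> ?L" using p key by auto
        then show "p \<in> map_prod y y ` ?L" using p(1) ij by force
      next
        fix p assume "p \<in> map_prod y y ` ?L"
        then obtain i j where ij: "(i, j) \<in> ?L" "p = (y i, y j)" by auto
        then have "y i \<noteq> y j" using y(1) by (auto simp: inj_on_def)
        then show "p \<in> snd (nav_graph M (key_nav_on \<kappa> T M U))"
          using ij key y(2) by (auto simp: nav_graph_def)
      qed
      moreover have "links (code_config M0 (?A U)) = ?L"
        unfolding links_def code_config_simps V_def[symmetric] by (auto simp: V_def h_def)
      moreover have "map_prod (\<lambda>v. v + - z) (\<lambda>v. v + - z) ` map_prod y y ` S = map_prod (pt M0) (pt M0) ` S" for S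
        by (simp add: image_image map_prod_def split_beta y_def)
      ultimately show ?thesis by simp
    qed
    ultimately have "translate (- z) (nav_graph M (key_nav_on \<kappa> T M U)) = cgraph (code_config M0 (?A U))"
      unfolding translate_def cgraph_def code_config_simps V_def by (simp add: nav_graph_def)
    then show ?thesis by (simp add: ctree_def)
  qed
  have "distr (PiM M (key_row f \<kappa> M)) local_borel (\<lambda>U. ?G (?A U)) = distr (distr (PiM M (key_row f \<kappa> M)) ?C ?A) local_borel ?G"
    using distr_distr[OF G A] by (simp add: comp_def)
  also have "\<dots> = distr unif_seq local_borel (\<lambda>u. ?G (?B u))"
    unfolding law using distr_distr[OF G B] by (simp add: comp_def)
  also have "(\<lambda>u. ?G (?B u)) = nav_tree (\<lambda>v. \<kappa> (v + z)) {v. v + z \<in> T} M0"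
  proof -
    have "?B u = nav_codes (\<lambda>v. \<kappa> (v + z)) {v. v + z \<in> T} M0 u" for u
      by (rule ext) (simp add: nav_codes_def V_def q_def)
    then show ?thesis by (simp add: fun_eq_iff nav_tree_def)
  qed
  finally show ?thesis unfolding graph .
qed

text \<open>
  At the target \<open>0\<close> the conditioning event is empty, so that \<^const>\<open>conditioned\<close> leaves the law of
  the row unchanged: this is why the target can be treated like the other points in the law of the
  marks.
\<close>

lemma sw_law:
  fixes M :: "'a::euclidean_space set"
  assumes "M0 \<in> locfin" "0 \<in> M0" "M = (\<lambda>v. v + z) ` M0"
  shows "distr (sw_marks f M) local_borel (\<lambda>U. rooted_at_origin (translate (- z) (nav_graph M (sw_nav f M U)))) =
    distr unif_seq local_borel (nav_tree (\<lambda>v. - norm (v + z)) {- z} M0)"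
proof -
  have row: "(if X = 0 then row_law M X else conditioned (row_law M X) (has_neighbour_in f M X (ball 0 (norm X))))
      = key_row f (\<lambda>v. - norm v) M X" for X
  proof (cases "X = 0")
    case True
    have "has_neighbour_in f M 0 {Y. - norm (0::'a) < - norm Y} = {}" by (auto simp: has_neighbour_in_def)
    then show ?thesis using True by (simp add: key_row_def conditioned_def)
  next
    case False
    have "ball (0::'a) (norm X) = {Y. - norm X < - norm Y}" by auto
    then show ?thesis using False unfolding key_row_def by (simp only: if_False)
  qed
  have nav: "sw_nav f M U X = key_nav_on (\<lambda>v. - norm v) {0} M U X" if "X \<in> M" for U X
  proof (cases "X = 0")
    case False
    have "is_arg_min norm (\<lambda>Y. (X, Y) \<in> sw_edges f M U) =
        is_arg_max (\<lambda>v. - norm v) (\<lambda>Y. Y \<in> M \<and> Y \<noteq> X \<and> U X Y \<le> f (dist X Y))"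
      using that by (auto simp: fun_eq_iff is_arg_min_def is_arg_max_def sw_edges_def dist_norm)
    then show ?thesis using False by (simp add: sw_nav_def key_nav_on_def key_nav_def)
  qed (simp add: sw_nav_def key_nav_on_def)
  have "nav_graph M (sw_nav f M U) = nav_graph M (key_nav_on (\<lambda>v. - norm v) {0} M U)" for U
    unfolding nav_graph_def using nav by auto
  moreover have "{v. v + z \<in> {0}} = {- z}" by (auto simp: eq_neg_iff_add_eq_0)
  ultimately show ?thesis
    unfolding sw_marks_def row using nav_graph_law[OF assms, of "\<lambda>v. - norm v" "{0}"] by simp
qed

lemma dir_law:
  fixes M :: "'a::euclidean_space set"
  assumes "M \<in> locfin" "0 \<in> M"
  shows "distr (dir_marks f e M) local_borel (\<lambda>U. rooted_at_origin (nav_graph M (dir_nav f e M U))) =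
    distr unif_seq local_borel (nav_tree (\<lambda>v. v \<bullet> e) {} M)"
proof -
  have row: "conditioned (row_law M X) (has_neighbour_in f M X (half_space e X)) = key_row f (\<lambda>v. v \<bullet> e) M X" for X
  proof -
    have "half_space e X = {Y. X \<bullet> e < Y \<bullet> e}" by (auto simp: half_space_def inner_diff_left)
    then show ?thesis by (simp add: key_row_def)
  qed
  have nav: "dir_nav f e M U X = key_nav_on (\<lambda>v. v \<bullet> e) {} M U X" if "X \<in> M" for U X
  proof -
    have "(\<lambda>Y. (X, Y) \<in> sw_edges f M U) = (\<lambda>Y. Y \<in> M \<and> Y \<noteq> X \<and> U X Y \<le> f (dist X Y))"
      using that by (auto simp: fun_eq_iff sw_edges_def dist_norm)
    then show ?thesis by (simp add: dir_nav_def key_nav_on_def key_nav_def)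
  qed
  have "nav_graph M (dir_nav f e M U) = nav_graph M (key_nav_on (\<lambda>v. v \<bullet> e) {} M U)" for U
    unfolding nav_graph_def using nav by auto
  moreover have "translate (- 0) G = G" for G :: "'a graph" by (simp add: translate_def map_prod_def split_beta)
  ultimately show ?thesis
    unfolding dir_marks_def row using nav_graph_law[OF assms, of M 0 "\<lambda>v. v \<bullet> e" "{}"] by simp
qed

end

text \<open>
  Drawing first the points and then the marks amounts to drawing from a product measure, once the
  marks have been replaced by uniform variables whose law does not depend on the points.
\<close>

lemma bind_distr_eq:
  assumes "prob_space P" "prob_space Q" and \<Phi>: "\<Phi> \<in> P \<Otimes>\<^sub>M Q \<rightarrow>\<^sub>M L"
  shows "P \<bind> (\<lambda>\<omega>. distr Q L (\<lambda>u. \<Phi> (\<omega>, u))) = distr (P \<Otimes>\<^sub>M Q) L \<Phi>"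
proof -
  interpret P: prob_space P by fact
  interpret Q: prob_space Q by fact
  interpret PQ: pair_prob_space P Q ..
  have K: "(\<lambda>\<omega>. distr Q L (\<lambda>u. \<Phi> (\<omega>, u))) \<in> P \<rightarrow>\<^sub>M subprob_algebra L"
  proof (rule measurable_distr2)
    show "case_prod (\<lambda>\<omega> u. \<Phi> (\<omega>, u)) \<in> P \<Otimes>\<^sub>M Q \<rightarrow>\<^sub>M L" using \<Phi> by simp
    show "(\<lambda>\<omega>. Q) \<in> P \<rightarrow>\<^sub>M subprob_algebra Q"
      by (intro measurable_const) (simp add: space_subprob_algebra Q.subprob_space_axioms)
  qed
  show ?thesis
  proof (rule measure_eqI)
    show "sets (P \<bind> (\<lambda>\<omega>. distr Q L (\<lambda>u. \<Phi> (\<omega>, u)))) = sets (distr (P \<Otimes>\<^sub>M Q) L \<Phi>)"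
      by (subst sets_bind[OF sets_kernel[OF K]]) (auto simp: P.not_empty)
    fix A assume "A \<in> sets (P \<bind> (\<lambda>\<omega>. distr Q L (\<lambda>u. \<Phi> (\<omega>, u))))"
    then have A: "A \<in> sets L" by (subst (asm) sets_bind[OF sets_kernel[OF K]]) (auto simp: P.not_empty)
    have "emeasure (P \<bind> (\<lambda>\<omega>. distr Q L (\<lambda>u. \<Phi> (\<omega>, u)))) A = (\<integral>\<^sup>+\<omega>. emeasure (distr Q L (\<lambda>u. \<Phi> (\<omega>, u))) A \<partial>P)"
      by (rule emeasure_bind[OF P.not_empty K A])
    also have "\<dots> = (\<integral>\<^sup>+\<omega>. emeasure Q (Pair \<omega> -` (\<Phi> -` A \<inter> space (P \<Otimes>\<^sub>M Q))) \<partial>P)"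
    proof (rule nn_integral_cong)
      fix \<omega> assume w: "\<omega> \<in> space P"
      have "(\<lambda>u. \<Phi> (\<omega>, u)) \<in> Q \<rightarrow>\<^sub>M L" using measurable_compose[OF measurable_Pair1'[OF w] \<Phi>] .
      then show "emeasure (distr Q L (\<lambda>u. \<Phi> (\<omega>, u))) A = emeasure Q (Pair \<omega> -` (\<Phi> -` A \<inter> space (P \<Otimes>\<^sub>M Q)))"
        using A w by (subst emeasure_distr) (auto simp: space_pair_measure intro!: arg_cong[where f = "emeasure Q"])
    qed
    also have "\<dots> = emeasure (P \<Otimes>\<^sub>M Q) (\<Phi> -` A \<inter> space (P \<Otimes>\<^sub>M Q))"
      by (rule Q.emeasure_pair_measure_alt[symmetric]) (use \<Phi> A in measurable)
    also have "\<dots> = emeasure (distr (P \<Otimes>\<^sub>M Q) L \<Phi>) A" using \<Phi> A by (simp add: emeasure_distr)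
    finally show "emeasure (P \<bind> (\<lambda>\<omega>. distr Q L (\<lambda>u. \<Phi> (\<omega>, u)))) A = emeasure (distr (P \<Otimes>\<^sub>M Q) L \<Phi>) A" .
  qed
qed

section \<open>Convergence of the trees along a fixed point set\<close>

lemma tendsto_fun_componentwise:
  fixes s :: "'i \<Rightarrow> 'b::topological_space"
  assumes "\<And>i. ((\<lambda>n. S n i) \<longlongrightarrow> s i) F"
  shows "(S \<longlongrightarrow> s) F"
  unfolding limitin_canonical_iff[symmetric] euclidean_product_topology[symmetric] limitin_componentwise
  using assms by auto

text \<open>
  Expanding squares, the claim is \<open>2 * (Z n \<bullet> (Y2 - Y1)) > Y2 \<bullet> Y2 - Y1 \<bullet> Y1\<close>, and the left hand side
  tends to infinity.
\<close>

lemma eventually_closer_to_far_point: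
  fixes Z :: "nat \<Rightarrow> 'a::euclidean_space"
  assumes Z: "filterlim (\<lambda>n. norm (Z n)) at_top sequentially" "(\<lambda>n. Z n /\<^sub>R norm (Z n)) \<longlonglongrightarrow> e"
    and Y: "Y1 \<bullet> e < Y2 \<bullet> e"
  shows "\<forall>\<^sub>F n in sequentially. norm (Y2 - Z n) < norm (Y1 - Z n)"
proof -
  have "(\<lambda>n. (Z n /\<^sub>R norm (Z n)) \<bullet> (Y2 - Y1)) \<longlonglongrightarrow> e \<bullet> (Y2 - Y1)"
    by (intro tendsto_inner Z(2) tendsto_const)
  moreover have "0 < e \<bullet> (Y2 - Y1)" using Y by (simp add: inner_diff_right inner_commute)
  ultimately have "filterlim (\<lambda>n. (Z n /\<^sub>R norm (Z n)) \<bullet> (Y2 - Y1) * norm (Z n)) at_top sequentially"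
    by (intro filterlim_tendsto_pos_mult_at_top[OF _ _ Z(1)])
  then have "\<forall>\<^sub>F n in sequentially. \<bar>Y2 \<bullet> Y2 - Y1 \<bullet> Y1\<bar> < (Z n /\<^sub>R norm (Z n)) \<bullet> (Y2 - Y1) * norm (Z n)"
    unfolding filterlim_at_top_dense by blast
  then show ?thesis
  proof eventually_elim
    case (elim n)
    have "(Z n /\<^sub>R norm (Z n)) \<bullet> (Y2 - Y1) * norm (Z n) = Z n \<bullet> (Y2 - Y1)" by (cases "Z n = 0") auto
    then have *: "\<bar>Y2 \<bullet> Y2 - Y1 \<bullet> Y1\<bar> < Z n \<bullet> Y2 - Z n \<bullet> Y1" using elim by (simp add: inner_diff_right)
    have "0 < Z n \<bullet> Y2 - Z n \<bullet> Y1" using * by linarith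
    then have "(Y2 - Z n) \<bullet> (Y2 - Z n) < (Y1 - Z n) \<bullet> (Y1 - Z n)"
      using * by (simp add: inner_diff_left inner_diff_right inner_commute)
    then have "(norm (Y2 - Z n))\<^sup>2 < (norm (Y1 - Z n))\<^sup>2" by (simp add: power2_norm_eq_inner)
    then show ?case by (rule power_less_imp_less_base) simp
  qed
qed

context decreasing_connection
begin

lemma navq_sums_1:
  fixes M :: "'a::euclidean_space set"
  assumes M: "M \<in> locfin" and i: "valid M i"
    and sums: "bounded_sums (\<lambda>Y. f (dist (pt M i) Y)) M"
    and inj: "inj_on \<kappa> M" and pos: "0 < up_prob f \<kappa> M (pt M i)"
  shows "navq \<kappa> {} M i sums 1"
proof -
  let ?K = "key_row f \<kappa> M (pt M i)"
  interpret K: prob_space ?K by (rule prob_space_key_row)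
  have cM: "countable M" by (rule locfin_countable[OF M])
  define A where "A j = (if valid M j \<and> j \<noteq> i then {u \<in> space ?K. key_nav f \<kappa> M (pt M i) u = pt M j} else {})" for j
  have pt_ne: "pt M j \<noteq> pt M k" if "valid M j" "valid M k" "j \<noteq> k" for j k
    using inj_onD[OF inj_on_pt, of M j k] that by auto
  have sets: "A j \<in> sets ?K" for j
    unfolding A_def using key_nav_sets[OF cM] by (auto simp: key_row_def sets_conditioned)
  have "disjoint_family A" unfolding disjoint_family_on_def
  proof (intro ballI impI)
    fix j k :: nat assume "j \<noteq> k"
    then show "A j \<inter> A k = {}" using pt_ne[of j k] unfolding A_def by (auto split: if_splits)
  qed
  then have "(\<lambda>j. measure ?K (A j)) sums measure ?K (\<Union>j. A j)"
    using sets by (intro K.finite_measure_UNION) auto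
  moreover have "measure ?K (A j) = navq \<kappa> {} M i j" for j
  proof (cases "valid M j \<and> j \<noteq> i")
    case True
    then show ?thesis using key_nav_prob[OF cM valid_pt_mem pt_ne, of j i \<kappa>] i
      by (simp add: A_def navq_def)
  next
    case False
    then show ?thesis by (auto simp: A_def navq_def navp_def)
  qed
  moreover have "measure ?K (\<Union>j. A j) = 1"
  proof -
    have "AE u in ?K. u \<in> (\<Union>j. A j)"
      using AE_key_nav_moves[OF cM sums inj pos] AE_space
    proof eventually_elim
      case (elim u)
      have "key_nav f \<kappa> M (pt M i) u \<in> M" using key_nav_range[of \<kappa> M "pt M i" u] elim(1) by blast
      then obtain j where j: "valid M j" "pt M j = key_nav f \<kappa> M (pt M i) u" using pt_surj[OF M] by blast
      then have "u \<in> A j" using elim by (auto simp: A_def)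
      then show ?case by blast
    qed
    then show ?thesis using sets K.prob_eq_1[of "\<Union>j. A j"] by auto
  qed
  ultimately show ?thesis by simp
qed

text \<open>
  For almost every sequence of uniform variables, each entry of the code of the tree is eventually
  constant: positions and bounds because the added point \<open>Z n\<close> is far away, and choices because their
  probabilities converge.
\<close>

lemma nav_tree_tendsto:
  fixes L :: "'a::euclidean_space set" and Z :: "nat \<Rightarrow> 'a"
  assumes L: "L \<in> locfin" and M: "M = insert 0 L"
    and sums: "\<And>X. X \<in> M \<Longrightarrow> bounded_sums (\<lambda>Y. f (dist X Y)) M"
    and inj: "inj_on (\<lambda>v. v \<bullet> e) M"
    and up: "\<And>X. X \<in> M \<Longrightarrow> \<exists>Y\<in>M. X \<bullet> e < Y \<bullet> e"
    and f_pos: "\<And>t. 0 \<le> t \<Longrightarrow> 0 < f t" and f_lim: "(f \<longlongrightarrow> 0) at_top"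
    and Z: "filterlim (\<lambda>n. norm (Z n)) at_top sequentially" "(\<lambda>n. Z n /\<^sub>R norm (Z n)) \<longlonglongrightarrow> e"
    and g: "continuous_map local_topology euclideanreal g"
  shows "AE u in unif_seq. (\<lambda>n. g (nav_tree (\<lambda>v. - norm (v - Z n)) {Z n} (insert (Z n) M) u))
      \<longlonglongrightarrow> g (nav_tree (\<lambda>v. v \<bullet> e) {} M u)"
proof -
  let ?\<kappa> = "\<lambda>v. v \<bullet> e" and ?\<kappa>n = "\<lambda>n v. - norm (v - Z n)"
  let ?M = "\<lambda>n. insert (Z n) M"
  have M': "M \<in> locfin" "0 \<in> M" using L by (simp_all add: M locfin_insert)
  have Mn: "?M n \<in> locfin" "0 \<in> ?M n" for n using M' by (simp_all add: locfin_insert)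
  have fZ: "(\<lambda>n. f (dist X (Z n))) \<longlonglongrightarrow> 0" for X
  proof -
    have lim: "filterlim (\<lambda>n. - norm X + norm (Z n)) at_top sequentially"
      by (rule filterlim_tendsto_add_at_top[OF tendsto_const Z(1)])
    have "- norm X + norm (Z n) \<le> dist X (Z n)" for n
      using norm_triangle_ineq2[of "Z n" X] by (simp add: dist_norm norm_minus_commute)
    then have "filterlim (\<lambda>n. dist X (Z n)) at_top sequentially"
      by (intro filterlim_at_top_mono[OF lim] always_eventually allI)
    then show ?thesis by (rule filterlim_compose[OF f_lim])
  qed
  have order: "\<forall>\<^sub>F n in sequentially. ?\<kappa>n n Y1 < ?\<kappa>n n Y2 \<longleftrightarrow> ?\<kappa> Y1 < ?\<kappa> Y2"
    if Y: "Y1 \<in> M" "Y2 \<in> M" for Y1 Y2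
  proof -
    consider "Y1 = Y2" | "?\<kappa> Y1 < ?\<kappa> Y2" | "?\<kappa> Y2 < ?\<kappa> Y1"
      using inj_onD[OF inj, of Y1 Y2] Y by linarith
    then show ?thesis
    proof cases
      case 2
      from eventually_closer_to_far_point[OF Z 2] show ?thesis by eventually_elim (use 2 in simp)
    next
      case 3
      from eventually_closer_to_far_point[OF Z 3] show ?thesis by eventually_elim (use 3 in simp)
    qed simp
  qed
  have pos: "0 < up_prob f ?\<kappa> M X" if "X \<in> M" for X
    using up[OF that] up_prob_pos[of _ M ?\<kappa> X] f_pos by (meson zero_le_dist)
  note enum = eventually_enumeration_insert[OF M'(1) Z(1)]
  have navq_lim: "(\<lambda>n. navq (?\<kappa>n n) {Z n} (?M n) i j) \<longlonglongrightarrow> navq ?\<kappa> {} M i j" if i: "valid M i" for i j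
  proof (cases "valid M j")
    case True
    have "(\<lambda>n. navp f (?\<kappa>n n) (?M n) (pt M i) (pt M j)) \<longlonglongrightarrow> navp f ?\<kappa> M (pt M i) (pt M j)"
      by (rule navp_tendsto[OF sums _ _ fZ order pos]) (use True i valid_pt_mem in auto)
    moreover have "\<forall>\<^sub>F n in sequentially. norm (pt M i) < norm (Z n)"
      using Z(1) unfolding filterlim_at_top_dense by blast
    then have "\<forall>\<^sub>F n in sequentially. navp f (?\<kappa>n n) (?M n) (pt M i) (pt M j) = navq (?\<kappa>n n) {Z n} (?M n) i j"
      using enum(1)[of i] enum(1)[of j] by eventually_elim (use True in \<open>auto simp: navq_def\<close>)
    ultimately have "(\<lambda>n. navq (?\<kappa>n n) {Z n} (?M n) i j) \<longlonglongrightarrow> navp f ?\<kappa> M (pt M i) (pt M j)"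
      by (rule Lim_transform_eventually)
    then show ?thesis using True by (simp add: navq_def)
  next
    case False
    have "\<forall>\<^sub>F n in sequentially. navq (?\<kappa>n n) {Z n} (?M n) i j = 0"
      using enum(1)[of j] by eventually_elim (use False in \<open>simp add: navq_def\<close>)
    then show ?thesis using False by (simp add: navq_def tendsto_eventually)
  qed
  have "AE u in unif_seq. \<forall>i. u i < 1 \<and> (\<forall>j. u i \<noteq> sum (navq ?\<kappa> {} M i) {..j})"
    unfolding AE_all_countable
  proof
    fix i
    have "AE x in lborel. x \<noteq> 1 \<and> (\<forall>j. x \<noteq> sum (navq ?\<kappa> {} M i) {..j})"
      unfolding AE_conj_iff AE_all_countable by (intro conjI allI AE_lborel_singleton)
    then have "AE x in lborel. x \<in> {0..1} \<longrightarrow> x < 1 \<and> (\<forall>j. x \<noteq> sum (navq ?\<kappa> {} M i) {..j})"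
      by eventually_elim auto
    then have "AE x in unif01. x < 1 \<and> (\<forall>j. x \<noteq> sum (navq ?\<kappa> {} M i) {..j})"
      by (intro AE_uniform_measureI) simp_all
    then show "AE u in unif_seq. u i < 1 \<and> (\<forall>j. u i \<noteq> sum (navq ?\<kappa> {} M i) {..j})"
      by (intro AE_PiM_component[where i = i] prob_space_unif01) auto
  qed
  then show ?thesis
  proof eventually_elim
    case (elim u)
    let ?s = "code_config M (nav_codes ?\<kappa> {} M u)"
    let ?S = "\<lambda>n. code_config (?M n) (nav_codes (?\<kappa>n n) {Z n} (?M n) u)"
    have codes: "\<forall>\<^sub>F n in sequentially. nav_codes (?\<kappa>n n) {Z n} (?M n) u i = nav_codes ?\<kappa> {} M u i" for i
    proof (cases "valid M i")
      case True
      have "pt M i \<in> M" using True by (rule valid_pt_mem)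
      have "\<forall>\<^sub>F n in sequentially. quant i (navq (?\<kappa>n n) {Z n} (?M n) i) (u i) = quant i (navq ?\<kappa> {} M i) (u i)"
        by (rule quant_eventually_eq[OF navq_nonneg navq_sums_1 navq_lim[OF True]])
           (use M' True sums[OF \<open>pt M i \<in> M\<close>] inj pos[OF \<open>pt M i \<in> M\<close>] elim in auto)
      with enum(1)[of i] show ?thesis by eventually_elim (use True in \<open>simp add: nav_codes_def\<close>)
    next
      case False
      from enum(1)[of i] show ?thesis by eventually_elim (use False in \<open>simp add: nav_codes_def\<close>)
    qed
    have "?S \<longlonglongrightarrow> ?s"
    proof (rule tendsto_fun_componentwise)
      fix i
      have "\<forall>\<^sub>F n in sequentially. ?S n i = ?s i"
        using enum(1)[of i] enum(2)[of i] codes[of i] by eventually_elim (simp add: code_config_def)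
      then show "(\<lambda>n. ?S n i) \<longlonglongrightarrow> ?s i" by (rule tendsto_eventually)
    qed
    then show ?case unfolding nav_tree_def
      by (rule continuous_ctree_tendsto[OF g _ code_config_configs[OF Mn] code_config_configs[OF M']])
  qed
qed

end

section \<open>Decay of the connection function\<close>

lemma connection_positive:
  fixes f :: "real \<Rightarrow> real"
  assumes f: "\<And>t. 0 \<le> t \<Longrightarrow> f t \<in> {0..1}" "antimono_on {0..} f"
    and lim: "f \<sim>[at_top] (\<lambda>t. c * t powr (- \<beta>))" "0 < c" and t: "0 \<le> t"
  shows "0 < f t"
proof -
  have "\<forall>\<^sub>F t in at_top. c * t powr (- \<beta>) \<noteq> 0"
    using eventually_gt_at_top[of 0] by eventually_elim (use lim(2) in auto)
  then have "\<forall>\<^sub>F t in at_top. f t \<noteq> 0" using asymp_equiv_eventually_zeros[OF lim(1)] by eventually_elim simp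
  then have "\<forall>\<^sub>F s in at_top. f s \<noteq> 0 \<and> t \<le> s" using eventually_ge_at_top by (rule eventually_conj)
  from eventually_happens'[OF trivial_limit_at_top_linorder this]
  obtain s where s: "f s \<noteq> 0" "t \<le> s" by blast
  then have "0 < f s" using f(1)[of s] t by auto
  also have "f s \<le> f t" using f(2) s(2) t by (auto simp: monotone_on_def)
  finally show ?thesis .
qed

text \<open>
  The asymptotics give the bound for large arguments, where \<open>t powr (- \<beta>) \<le> 2 powr \<beta> * (1 + t) powr (- \<beta>)\<close>;
  for the others \<open>f \<le> 1\<close> is enough.
\<close>

lemma connection_decay:
  fixes f :: "real \<Rightarrow> real"
  assumes f: "\<And>t. 0 \<le> t \<Longrightarrow> f t \<in> {0..1}"
    and lim: "f \<sim>[at_top] (\<lambda>t. c * t powr (- \<beta>))" "0 < c" and \<beta>: "0 < \<beta>"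
  shows "\<exists>C>0. \<forall>t\<ge>0. f t \<le> C * (1 + t) powr (- \<beta>)"
proof -
  have "\<forall>\<^sub>F t in at_top. f t \<noteq> 0 \<or> c * t powr (- \<beta>) \<noteq> 0"
    using eventually_gt_at_top[of 0] by eventually_elim (use lim(2) in auto)
  from asymp_equivD_strong[OF lim(1) this] have "((\<lambda>t. f t / (c * t powr (- \<beta>))) \<longlongrightarrow> 1) at_top" .
  then have "\<forall>\<^sub>F t in at_top. f t / (c * t powr (- \<beta>)) < 2" by (rule order_tendstoD(2)) simp
  then obtain T0 where T0: "\<And>t. t \<ge> T0 \<Longrightarrow> f t / (c * t powr (- \<beta>)) < 2"
    unfolding eventually_at_top_linorder by blast
  define T where "T = max T0 1"
  define C where "C = max (2 * c * 2 powr \<beta>) ((1 + T) powr \<beta>)"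
  have "f t \<le> C * (1 + t) powr (- \<beta>)" if t: "0 \<le> t" for t
  proof (cases "T \<le> t")
    case True
    then have t1: "1 \<le> t" "T0 \<le> t" by (auto simp: T_def)
    have "f t \<le> 2 * c * t powr (- \<beta>)" using T0[OF t1(2)] t1(1) lim(2) by (simp add: field_simps)
    also have "t powr (- \<beta>) = 2 powr \<beta> * (2 * t) powr (- \<beta>)"
      using t1 by (simp add: powr_mult powr_minus)
    also have "(2 * t) powr (- \<beta>) \<le> (1 + t) powr (- \<beta>)"
      using t1 \<beta> by (intro powr_mono2') auto
    finally have "f t \<le> (2 * c * 2 powr \<beta>) * (1 + t) powr (- \<beta>)"
      using lim(2) by (simp add: mult.assoc)
    also have "\<dots> \<le> C * (1 + t) powr (- \<beta>)" unfolding C_def by (intro mult_right_mono) auto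
    finally show ?thesis .
  next
    case False
    have "f t \<le> 1" using f[OF t] by simp
    also have "1 = (1 + t) powr \<beta> * (1 + t) powr (- \<beta>)" using t by (simp add: powr_minus)
    also have "\<dots> \<le> C * (1 + t) powr (- \<beta>)"
    proof (rule mult_right_mono)
      have "(1 + t) powr \<beta> \<le> (1 + T) powr \<beta>" using False t \<beta> by (intro powr_mono2) auto
      then show "(1 + t) powr \<beta> \<le> C" unfolding C_def by simp
    qed simp
    finally show ?thesis .
  qed
  moreover have "0 < C"
  proof -
    have "0 < (1 + T) powr \<beta>" by (simp add: T_def)
    then show ?thesis unfolding C_def by linarith
  qed
  ultimately show ?thesis by blast
qed

lemma bounded_sums_insert: "bounded_sums g M \<Longrightarrow> bounded_sums g (insert x M)"
proof -
  assume "bounded_sums g M"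
  then obtain C where C: "\<And>F. finite F \<Longrightarrow> F \<subseteq> M \<Longrightarrow> sum g F \<le> C" by (auto simp: bounded_sums_def)
  have "sum g F \<le> \<bar>g x\<bar> + C" if F: "finite F" "F \<subseteq> insert x M" for F
  proof -
    have "sum g (F - {x}) \<le> C" using F by (intro C) auto
    moreover have "sum g F = (if x \<in> F then g x else 0) + sum g (F - {x})"
    proof (cases "x \<in> F")
      case True
      then show ?thesis using sum.remove[OF F(1) True, of g] by simp
    qed simp
    moreover have "(if x \<in> F then g x else 0) \<le> \<bar>g x\<bar>" by (simp add: abs_ge_self)
    ultimately show ?thesis by linarith
  qed
  then show ?thesis unfolding bounded_sums_def by blast
qed

text \<open>
  From \<open>1 + norm Y \<le> (1 + norm X) * (1 + dist X Y)\<close>, the decay seen from \<open>X\<close> is, up to a factor, the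
  decay seen from the origin.
\<close>

lemma bounded_sums_connection:
  fixes M :: "'a::euclidean_space set"
  assumes C: "0 < C" "\<And>t. 0 \<le> t \<Longrightarrow> f t \<le> C * (1 + t) powr (- \<beta>)" and \<beta>: "0 < \<beta>"
    and M: "bounded_sums (\<lambda>Y. (1 + norm Y) powr (- \<beta>)) M"
  shows "bounded_sums (\<lambda>Y. f (dist X Y)) M"
proof -
  obtain D where D: "\<And>F. finite F \<Longrightarrow> F \<subseteq> M \<Longrightarrow> (\<Sum>Y\<in>F. (1 + norm Y) powr (- \<beta>)) \<le> D"
    using M by (auto simp: bounded_sums_def)
  define A where "A = C * (1 + norm X) powr \<beta>"
  have le: "f (dist X Y) \<le> A * (1 + norm Y) powr (- \<beta>)" for Y
  proof -
    have "norm Y \<le> norm X + dist X Y" using norm_triangle_ineq2[of Y X] by (simp add: dist_norm norm_minus_commute)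
    moreover have "0 \<le> norm X * dist X Y" by simp
    moreover have "(1 + norm X) * (1 + dist X Y) = 1 + norm X + dist X Y + norm X * dist X Y"
      by (simp add: algebra_simps)
    ultimately have "1 + norm Y \<le> (1 + norm X) * (1 + dist X Y)" by linarith
    then have "((1 + norm X) * (1 + dist X Y)) powr (- \<beta>) \<le> (1 + norm Y) powr (- \<beta>)"
      using \<beta> by (intro powr_mono2') (auto simp: add_pos_nonneg)
    then have "(1 + norm X) powr (- \<beta>) * (1 + dist X Y) powr (- \<beta>) \<le> (1 + norm Y) powr (- \<beta>)"
      by (simp add: powr_mult)
    then have "(1 + norm X) powr \<beta> * ((1 + norm X) powr (- \<beta>) * (1 + dist X Y) powr (- \<beta>))
        \<le> (1 + norm X) powr \<beta> * (1 + norm Y) powr (- \<beta>)"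
      by (rule mult_left_mono) simp
    moreover have "(1 + norm X) powr \<beta> * (1 + norm X) powr (- \<beta>) = 1"
      by (simp add: powr_minus add_pos_nonneg less_imp_neq[THEN not_sym])
    ultimately have "(1 + dist X Y) powr (- \<beta>) \<le> (1 + norm X) powr \<beta> * (1 + norm Y) powr (- \<beta>)"
      by (simp add: mult.assoc[symmetric])
    then have "C * (1 + dist X Y) powr (- \<beta>) \<le> C * ((1 + norm X) powr \<beta> * (1 + norm Y) powr (- \<beta>))"
      using C(1) by (intro mult_left_mono) auto
    then show ?thesis using C(2)[of "dist X Y"] unfolding A_def by (simp add: mult.assoc)
  qed
  have "(\<Sum>Y\<in>F. f (dist X Y)) \<le> A * D" if F: "finite F" "F \<subseteq> M" for F
  proof -
    have "(\<Sum>Y\<in>F. f (dist X Y)) \<le> A * (\<Sum>Y\<in>F. (1 + norm Y) powr (- \<beta>))"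
      unfolding sum_distrib_left by (rule sum_mono) (rule le)
    also have "\<dots> \<le> A * D" using C(1) D[OF F] unfolding A_def by (intro mult_left_mono) auto
    finally show ?thesis .
  qed
  then show ?thesis by (auto simp: bounded_sums_def)
qed

lemma connection_tendsto_0:
  fixes f :: "real \<Rightarrow> real"
  assumes f: "\<And>t. 0 \<le> t \<Longrightarrow> f t \<in> {0..1}"
    and lim: "f \<sim>[at_top] (\<lambda>t. c * t powr (- \<beta>))" and \<beta>: "0 < \<beta>"
  shows "(f \<longlongrightarrow> 0) at_top"
proof -
  have "((\<lambda>t. c * t powr (- \<beta>)) \<longlongrightarrow> c * 0) at_top"
    using \<beta> by (intro tendsto_mult tendsto_const tendsto_neg_powr filterlim_ident) auto
  then show ?thesis using asymp_equiv_tendsto_transfer[OF asymp_equiv_symI[OF lim]] by simp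
qed

section \<open>Stationarity and convergence in law\<close>

theorem proposition1p3:
  fixes P :: "'w measure"
    and N :: "'w \<Rightarrow> 'a::euclidean_space set"
    and f :: "real \<Rightarrow> real"
    and c \<beta> :: real
    and e1 :: 'a
    and X :: "nat \<Rightarrow> 'a"
  assumes "poisson_point_process 1 P N"
    and "\<And>t. t \<ge> 0 \<Longrightarrow> f t \<in> {0..1}"
    and "antimono_on {0..} f"
    and "c > 0"
    and "f \<sim>[at_top] (\<lambda>t. c * t powr (- \<beta>))"
    and "\<beta> > real DIM('a)"
    and "e1 \<in> sphere 0 1"
    and "filterlim (\<lambda>n. norm (X n)) at_top sequentially"
    and "(\<lambda>n. X n /\<^sub>R norm (X n)) \<longlonglongrightarrow> e1"
  shows "local_weak_conv
           (\<lambda>n. sw_tree_law f P (\<lambda>\<omega>. insert 0 (insert (X n) (N \<omega>))) (- X n))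
           (dir_forest_law f (- e1) P (\<lambda>\<omega>. insert 0 (N \<omega>)))"
proof -
  interpret unit_poisson P N by unfold_locales (rule assms(1))
  interpret decreasing_connection f by unfold_locales (use assms(2,3) in auto)
  interpret U: prob_space unif_seq by (rule prob_space_unif_seq)
  have sf: "sigma_finite_measure unif_seq" by (rule prob_space_imp_sigma_finite[OF prob_space_unif_seq])
  interpret PU: pair_prob_space P unif_seq ..
  have \<beta>: "0 < \<beta>" using assms(6) by (meson DIM_positive less_trans of_nat_0_less_iff)
  define e where "e = - e1"
  have e: "norm e = 1" using assms(7) by (simp add: e_def)
  define Z where "Z n = - X n" for n
  have Z: "filterlim (\<lambda>n. norm (Z n)) at_top sequentially" "(\<lambda>n. Z n /\<^sub>R norm (Z n)) \<longlonglongrightarrow> e"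
    using assms(8) tendsto_minus[OF assms(9)] by (simp_all add: Z_def e_def)
  note Nm[measurable] = poisson_measurable[OF assms(1)]
  note loc = poisson_locfin[OF assms(1)]
  \<comment> \<open>the point sets whose navigation is observed, as functions of the Poisson process alone\<close>
  define Fn where "Fn n L = insert (Z n) (insert 0 L)" for n and L :: "'a set"
  define F where "F L = insert 0 L" for L :: "'a set"
  have F: "F \<in> point_space \<rightarrow>\<^sub>M point_space" "\<And>L. 0 \<in> F L"
    unfolding F_def by (rule measurable_insert_point) simp
  have Fn: "Fn n \<in> point_space \<rightarrow>\<^sub>M point_space" "\<And>L. 0 \<in> Fn n L" for n
    unfolding Fn_def using measurable_compose[OF measurable_insert_point measurable_insert_point] by auto
  define Tn where "Tn n = (\<lambda>(L, u). nav_tree (\<lambda>v. - norm (v - Z n)) {Z n} (Fn n L) u)" for n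
  define T where "T = (\<lambda>(L, u). nav_tree (\<lambda>v. v \<bullet> e) {} (F L) u)"
  have T[measurable]: "T \<in> point_space \<Otimes>\<^sub>M unif_seq \<rightarrow>\<^sub>M local_borel"
    unfolding T_def by (rule measurable_nav_tree[OF F]) measurable
  have Tn[measurable]: "Tn n \<in> point_space \<Otimes>\<^sub>M unif_seq \<rightarrow>\<^sub>M local_borel" for n
    unfolding Tn_def by (rule measurable_nav_tree[OF Fn]) measurable
  \<comment> \<open>the point set as seen from the root; it has the same law as \<open>N\<close>\<close>
  define Nn where "Nn n \<omega> = (\<lambda>v. v + Z n) ` N \<omega>" for n \<omega>
  have Nnm[measurable]: "Nn n \<in> P \<rightarrow>\<^sub>M point_space" for n
    unfolding Nn_def by (rule measurable_compose[OF Nm measurable_translate_points])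
  have law_n: "sw_tree_law f P (\<lambda>\<omega>. insert 0 (insert (X n) (N \<omega>))) (- X n) =
      distr (P \<Otimes>\<^sub>M unif_seq) local_borel (\<lambda>(\<omega>, u). Tn n (Nn n \<omega>, u))" for n
  proof -
    have "sw_tree_law f P (\<lambda>\<omega>. insert 0 (insert (X n) (N \<omega>))) (- X n) =
        P \<bind> (\<lambda>\<omega>. distr unif_seq local_borel (\<lambda>u. (\<lambda>(\<omega>, u). Tn n (Nn n \<omega>, u)) (\<omega>, u)))"
      unfolding sw_tree_law_def
    proof (rule bind_cong_simp[OF refl], unfold simp_implies_def)
      fix \<omega> assume "\<omega> \<in> space P"
      then have "Fn n (Nn n \<omega>) \<in> locfin" unfolding Fn_def Nn_def by (intro locfin_insert locfin_translate loc)
      moreover have "insert 0 (insert (X n) (N \<omega>)) = (\<lambda>v. v + X n) ` Fn n (Nn n \<omega>)"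
        by (auto simp: Fn_def Nn_def Z_def image_image)
      ultimately show "distr (sw_marks f (insert 0 (insert (X n) (N \<omega>)))) local_borel
          (\<lambda>U. rooted_at_origin (translate (- X n) (nav_graph (insert 0 (insert (X n) (N \<omega>)))
             (sw_nav f (insert 0 (insert (X n) (N \<omega>))) U)))) =
          distr unif_seq local_borel (\<lambda>u. (\<lambda>(\<omega>, u). Tn n (Nn n \<omega>, u)) (\<omega>, u))"
        using sw_law[OF _ Fn(2)] by (simp add: Tn_def Z_def)
    qed
    also have "\<dots> = distr (P \<Otimes>\<^sub>M unif_seq) local_borel (\<lambda>(\<omega>, u). Tn n (Nn n \<omega>, u))"
      by (rule bind_distr_eq) (unfold_locales, measurable)
    finally show ?thesis .
  qed
  have law: "dir_forest_law f (- e1) P (\<lambda>\<omega>. insert 0 (N \<omega>)) =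
      distr (P \<Otimes>\<^sub>M unif_seq) local_borel (\<lambda>(\<omega>, u). T (N \<omega>, u))"
  proof -
    have "dir_forest_law f (- e1) P (\<lambda>\<omega>. insert 0 (N \<omega>)) =
        P \<bind> (\<lambda>\<omega>. distr unif_seq local_borel (\<lambda>u. (\<lambda>(\<omega>, u). T (N \<omega>, u)) (\<omega>, u)))"
      unfolding dir_forest_law_def
    proof (rule bind_cong_simp[OF refl], unfold simp_implies_def)
      fix \<omega> assume "\<omega> \<in> space P"
      then have "F (N \<omega>) \<in> locfin" unfolding F_def by (intro locfin_insert loc)
      then show "distr (dir_marks f (- e1) (insert 0 (N \<omega>))) local_borel
          (\<lambda>U. rooted_at_origin (nav_graph (insert 0 (N \<omega>)) (dir_nav f (- e1) (insert 0 (N \<omega>)) U))) =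
          distr unif_seq local_borel (\<lambda>u. (\<lambda>(\<omega>, u). T (N \<omega>, u)) (\<omega>, u))"
        using dir_law[OF _ F(2), of "N \<omega>" e] by (simp add: T_def F_def e_def)
    qed
    also have "\<dots> = distr (P \<Otimes>\<^sub>M unif_seq) local_borel (\<lambda>(\<omega>, u). T (N \<omega>, u))"
      by (rule bind_distr_eq) (unfold_locales, measurable)
    finally show ?thesis .
  qed
  show ?thesis
    unfolding local_weak_conv_def law_n law
  proof (intro conjI allI impI)
    show "prob_space (distr (P \<Otimes>\<^sub>M unif_seq) local_borel (\<lambda>(\<omega>, u). Tn n (Nn n \<omega>, u)))" for n
      by (rule PU.prob_space_distr) measurable
    show "prob_space (distr (P \<Otimes>\<^sub>M unif_seq) local_borel (\<lambda>(\<omega>, u). T (N \<omega>, u)))"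
      by (rule PU.prob_space_distr) measurable
  next
    fix g :: "'a rooted_graph \<Rightarrow> real"
    assume "continuous_map local_topology euclideanreal g \<and> bounded (g ` geometric_graphs)"
    then have g: "continuous_map local_topology euclideanreal g" "bounded (g ` geometric_graphs)" by auto
    have [measurable]: "g \<in> borel_measurable local_borel" by (rule measurable_local_borel_continuous[OF g(1)])
    obtain B where B: "\<And>G. G \<in> geometric_graphs \<Longrightarrow> \<bar>g G\<bar> \<le> B"
      using g(2) unfolding bounded_iff by auto
    have space: "space local_borel = (geometric_graphs :: 'a rooted_graph set)"
      by (simp add: local_borel_def space_measure_of_conv)
    have integral: "integral\<^sup>L (distr (P \<Otimes>\<^sub>M unif_seq) local_borel (\<lambda>(\<omega>, u). S (K \<omega>, u))) g =
        (\<integral>L. (\<integral>u. g (S (L, u)) \<partial>unif_seq) \<partial>(distr P point_space K))"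
      if [measurable]: "S \<in> point_space \<Otimes>\<^sub>M unif_seq \<rightarrow>\<^sub>M local_borel" "K \<in> P \<rightarrow>\<^sub>M point_space"
      for S :: "'a set \<times> (nat \<Rightarrow> real) \<Rightarrow> 'a rooted_graph" and K
    proof -
      have m: "(\<lambda>(\<omega>, u). S (K \<omega>, u)) \<in> P \<Otimes>\<^sub>M unif_seq \<rightarrow>\<^sub>M local_borel" by measurable
      have "integrable (P \<Otimes>\<^sub>M unif_seq) (\<lambda>x. g ((\<lambda>(\<omega>, u). S (K \<omega>, u)) x))"
      proof (rule PU.integrable_const_bound[where B = B])
        show "AE x in P \<Otimes>\<^sub>M unif_seq. norm (g ((\<lambda>(\<omega>, u). S (K \<omega>, u)) x)) \<le> B"
          using measurable_space[OF m] B by (intro AE_I2) (simp add: space)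
      qed (use m in measurable)
      from PU.integral_fst'[OF this]
      have "integral\<^sup>L (distr (P \<Otimes>\<^sub>M unif_seq) local_borel (\<lambda>(\<omega>, u). S (K \<omega>, u))) g =
          (\<integral>\<omega>. (\<integral>u. g (S (K \<omega>, u)) \<partial>unif_seq) \<partial>P)"
        using m by (subst integral_distr) auto
      also have "\<dots> = (\<integral>L. (\<integral>u. g (S (L, u)) \<partial>unif_seq) \<partial>(distr P point_space K))"
      proof (rule integral_distr[symmetric, OF that(2)])
        show "(\<lambda>L. \<integral>u. g (S (L, u)) \<partial>unif_seq) \<in> borel_measurable point_space"
          by (rule sigma_finite_measure.borel_measurable_lebesgue_integral[OF sf]) measurable
      qed
      finally show ?thesis .
    qed
    \<comment> \<open>the expectations depend only on the law of the point process, so \<open>Nn n\<close> may be replaced by \<open>N\<close>\<close>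
    have stationary: "distr P point_space (Nn n) = distr P point_space N" for n
      unfolding Nn_def by (rule poisson_law_unique[OF poisson_translate[OF assms(1)] assms(1)])
    have Hm: "(\<lambda>L. \<integral>u. g (S (L, u)) \<partial>unif_seq) \<in> borel_measurable point_space"
      if [measurable]: "S \<in> point_space \<Otimes>\<^sub>M unif_seq \<rightarrow>\<^sub>M local_borel" for S :: "'a set \<times> (nat \<Rightarrow> real) \<Rightarrow> 'a rooted_graph"
      by (rule sigma_finite_measure.borel_measurable_lebesgue_integral[OF sf]) measurable
    have bound: "\<bar>g (S (L, u))\<bar> \<le> B" if "S \<in> point_space \<Otimes>\<^sub>M unif_seq \<rightarrow>\<^sub>M local_borel" "L \<in> locfin" "u \<in> space unif_seq"
      for S :: "'a set \<times> (nat \<Rightarrow> real) \<Rightarrow> 'a rooted_graph" and L u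
      using B measurable_space[OF that(1), of "(L, u)"] that(2,3) by (simp add: space space_pair_measure space_point_space)
    obtain C where C: "C > 0" "\<And>t. 0 \<le> t \<Longrightarrow> f t \<le> C * (1 + t) powr (- \<beta>)"
      using connection_decay[OF assms(2,5,4) \<beta>] by blast
    have f_pos: "\<And>t. 0 \<le> t \<Longrightarrow> 0 < f t" using connection_positive[OF assms(2,3,5,4)] .
    have f_lim: "(f \<longlongrightarrow> 0) at_top" using connection_tendsto_0[OF assms(2,5) \<beta>] .
    have inner_lim: "AE \<omega> in P. (\<lambda>n. \<integral>u. g (Tn n (N \<omega>, u)) \<partial>unif_seq) \<longlonglongrightarrow> (\<integral>u. g (T (N \<omega>, u)) \<partial>unif_seq)"
      using AE_bounded_sums[OF assms(6)] AE_no_ties[OF e] AE_not_orthogonal[OF e] AE_unbounded[OF e] AE_space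
    proof eventually_elim
      case (elim \<omega>)
      note L = loc[OF elim(5)]
      have sums: "bounded_sums (\<lambda>Y. f (dist X Y)) (insert 0 (N \<omega>))" for X
        by (rule bounded_sums_insert[OF bounded_sums_connection[OF C \<beta> elim(1)]])
      have inj: "inj_on (\<lambda>v. v \<bullet> e) (insert 0 (N \<omega>))"
        using elim(2,3) by (auto simp: inj_on_def)
      have up: "\<exists>Y\<in>insert 0 (N \<omega>). X \<bullet> e < Y \<bullet> e" for X
      proof -
        obtain k :: nat where "X \<bullet> e < real k" using reals_Archimedean2 by blast
        then show ?thesis using elim(4)[rule_format, of k] by (meson insertI2 less_trans)
      qed
      have lim: "AE u in unif_seq. (\<lambda>n. g (Tn n (N \<omega>, u))) \<longlonglongrightarrow> g (T (N \<omega>, u))"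
        using nav_tree_tendsto[OF L refl sums inj up f_pos f_lim Z g(1)]
        by (simp add: Tn_def T_def Fn_def F_def)
      have sec: "(\<lambda>u. S (N \<omega>, u)) \<in> unif_seq \<rightarrow>\<^sub>M local_borel"
        if "S \<in> point_space \<Otimes>\<^sub>M unif_seq \<rightarrow>\<^sub>M local_borel" for S :: "'a set \<times> (nat \<Rightarrow> real) \<Rightarrow> 'a rooted_graph"
        using measurable_compose[OF measurable_Pair1' that] L by (simp add: space_point_space)
      show ?case
      proof (rule integral_dominated_convergence[where w = "\<lambda>_. B"])
        show "(\<lambda>u. g (T (N \<omega>, u))) \<in> borel_measurable unif_seq"
          by (rule measurable_compose[OF sec[OF T]]) measurable
        show "(\<lambda>u. g (Tn n (N \<omega>, u))) \<in> borel_measurable unif_seq" for n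
          by (rule measurable_compose[OF sec[OF Tn]]) measurable
        show "AE u in unif_seq. norm (g (Tn n (N \<omega>, u))) \<le> B" for n
          using bound[OF Tn L] by (intro AE_I2) simp
      qed (use lim in simp_all)
    qed
    have "(\<lambda>n. \<integral>\<omega>. (\<integral>u. g (Tn n (N \<omega>, u)) \<partial>unif_seq) \<partial>P) \<longlonglongrightarrow> (\<integral>\<omega>. (\<integral>u. g (T (N \<omega>, u)) \<partial>unif_seq) \<partial>P)"
    proof (rule integral_dominated_convergence[where w = "\<lambda>_. B"])
      show "(\<lambda>\<omega>. \<integral>u. g (T (N \<omega>, u)) \<partial>unif_seq) \<in> borel_measurable P"
        by (rule measurable_compose[OF Nm Hm[OF T]])
      show "(\<lambda>\<omega>. \<integral>u. g (Tn n (N \<omega>, u)) \<partial>unif_seq) \<in> borel_measurable P" for n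
        by (rule measurable_compose[OF Nm Hm[OF Tn]])
      show "AE \<omega> in P. norm (\<integral>u. g (Tn n (N \<omega>, u)) \<partial>unif_seq) \<le> B" for n
      proof (rule AE_I2)
        fix \<omega> assume w: "\<omega> \<in> space P"
        have sec: "(\<lambda>u. Tn n (N \<omega>, u)) \<in> unif_seq \<rightarrow>\<^sub>M local_borel"
          using measurable_compose[OF measurable_Pair1' Tn] loc[OF w] by (simp add: space_point_space)
        have "integrable unif_seq (\<lambda>u. g (Tn n (N \<omega>, u)))"
          using bound[OF Tn loc[OF w]]
          by (intro finite_measure.integrable_const_bound[OF prob_space.finite_measure[OF prob_space_unif_seq], where B = B] AE_I2 measurable_compose[OF sec]) auto
        then have "norm (\<integral>u. g (Tn n (N \<omega>, u)) \<partial>unif_seq) \<le> (\<integral>u. norm (g (Tn n (N \<omega>, u))) \<partial>unif_seq)"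
          by (intro integral_norm_bound)
        also have "\<dots> \<le> B"
          using \<open>integrable unif_seq (\<lambda>u. g (Tn n (N \<omega>, u)))\<close> bound[OF Tn loc[OF w]]
          by (intro prob_space.integral_le_const[OF prob_space_unif_seq]) (auto intro!: AE_I2)
        finally show "norm (\<integral>u. g (Tn n (N \<omega>, u)) \<partial>unif_seq) \<le> B" .
      qed
    qed (use inner_lim in simp_all)
    then show "(\<lambda>n. integral\<^sup>L (distr (P \<Otimes>\<^sub>M unif_seq) local_borel (\<lambda>(\<omega>, u). Tn n (Nn n \<omega>, u))) g)
        \<longlonglongrightarrow> integral\<^sup>L (distr (P \<Otimes>\<^sub>M unif_seq) local_borel (\<lambda>(\<omega>, u). T (N \<omega>, u))) g"
      unfolding integral[OF Tn Nnm] integral[OF T Nm] stationary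
      by (subst (1 2) integral_distr[OF Nm]) (use Hm[OF T] Hm[OF Tn] in auto)
  qed simp_all
qed

end
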